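(* Let $a<b\le a+\pi$, let $\mathcal A$ be a weakly cancellative commutative Banach algebra with dense principal ideals, and let $T=(T(\zeta))_{\zeta\in S_{a,b}}\subset\mathcal M(\mathcal A)$ be a holomorphic semigroup such that $T(\zeta)\mathcal A$ is dense in $\mathcal A$ for $\zeta\in S_{a,b}$. Set $\sigma_{ar}(\Delta_{T,\mathcal I_T})=\{\tilde\chi(\Delta_{T,\mathcal I_T}):\chi\in\widehat{\mathcal I_T}\}$, with the convention $\sigma_{ar}(\Delta_{T,\mathcal I_T})=\emptyset$ if the semigroup is quasinilpotent, and set $Res_{ar}(\Delta_T)=Res_{ar}(\Delta_{T,\mathcal I_T})=\mathbb C\setminus\sigma_{ar}(\Delta_{T,\mathcal I_T})$. Let $\mathcal B$ be a normalization of $\mathcal A$ with respect to the holomorphic semigroup $T$, and let $\mathcal I_{T,\mathcal B}$ be the closed subalgebra of $\mathcal M(\mathcal B)$ generated by the semigroup. (i) The set $\Lambda_{t,\zeta}:=\{\lambda\in\sigma_{ar}(\Delta_{T,\mathcal I_T}):\mathrm{Re}(\lambda\zeta)\le t\}$ is compact for $\zeta\in S_{a,b}$, $t\in\mathbb R$. (ii) The quasimultiplier $\lambda I-\Delta_T$ has an inverse $(\lambda I-\Delta_T)^{-1}\in\mathcal I_{T,\mathcal B}\subset\mathcal M(\mathcal B)\subset\mathcal{QM}_r(\mathcal A)$ for $\lambda\in Res_{ar}(\Delta_T)$, and $\lambda\mapsto(\lambda I-\Delta_T)^{-1}$ is a holomorphic map from $Res_{ar}(\Delta_T)$ into $\mathcal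 I_{T,\mathcal B}$. (iii) If $\zeta\in S_{a,b}$, then $\lambda\in Res_{ar}(\Delta_T)$ for $\mathrm{Re}(\lambda\zeta)>\lim_{t\to+\infty}\frac{\log\|T(t\zeta)\|}{t}$, and $$(\lambda I-\Delta_T)^{-1}=\int_0^{\zeta\cdot\infty}e^{-s\lambda}T(s)\,ds,$$ so that $$\|(\lambda I-\Delta_T)^{-1}\|_{\mathcal M(\mathcal B)}\le|\zeta|\int_0^{+\infty}e^{-t\mathrm{Re}(\lambda\zeta)}\|T(t\zeta)\|_{\mathcal M(\mathcal B)}\,dt.$$
   Context: Banach algebras are complex with submultiplicative norm. A commutative Banach algebra $\mathcal A$ is weakly cancellative if $u\mathcal A\ne\{0\}$ for all $u\in\mathcal A\setminus\{0\}$; $\Omega(\mathcal A)=\{u\in\mathcal A: u\mathcal A\text{ is dense in }\mathcal A\}$; $\mathcal A$ has dense principal ideals if $\Omega(\mathcal A)\ne\emptyset$. For such $\mathcal A\ne\{0\}$, $u\in\mathcal A$, $v\in\Omega(\mathcal A)$, $S_{u/v}$ is the closed operator with domain $\{x\in\mathcal A:ux\in v\mathcal A\}$, $S_{u/v}x$ being the unique $y$ with $vy=ux$. $\mathcal{QM}(\mathcal A)$ is the algebra of all such operators (quasimultipliers), with $S_{u/v}+S_{u'/v'}=S_{(uv'+u'v)/vv'}$ and $S_{u/v}S_{u'/v'}=S_{uu'/vv'}$. A set $V\subset\mathcal{QM}(\mathcal A)$ is pseudobounded if $\sup_{S\in V}\|Su\|<\infty$ for some $u\in\Omega(\mathcal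 A)$ in the domain of all $S\in V$; $S$ is regular if $\{r^nS^n\}_{n\ge1}$ is pseudobounded for some $r>0$; $\mathcal{QM}_r(\mathcal A)$ is the algebra of regular quasimultipliers. $\mathcal M(\mathcal A)$ is the Banach algebra of multipliers (bounded linear $R$ with $R(uv)=(Ru)v$), identified with the quasimultipliers of domain $\mathcal A$. A homomorphism $\Phi:\mathcal A\to\mathcal B$ is a $\mathcal{QM}$-homomorphism with respect to $u\in\Omega(\mathcal A)$ if it is injective with dense range and $\Phi(u)\mathcal B\subset\Phi(\mathcal A)$. $S_{a,b}=\{z\ne0:a<\arg z<b\}$. $\mathcal I_T$ is the closed linear span of $\{T(\zeta):\zeta\in S_{a,b}\}$ in $\mathcal M(\mathcal A)$ (a weakly cancellative commutative Banach algebra with dense principal ideals, with $T(\zeta)\in\Omega(\mathcal I_T)$), $\widehat{\mathcal I_T}$ its set of characters; a character $\chi$ extends to $\mathcal{QM}(\mathcal I_T)$ by $\tilde\chi(S_{u/v})=\chi(u)/\chi(v)$. The generator of $T$ is $\Delta_T=S_{T'(\zeta_0)u_0/T(\zeta_0)u_0}\in\mathcal{QM}(\mathcal A)$, with $\zeta_0\in S_{a,b}$, $u_0\in\Omega(\mathcal A)$ arbitrary; $\Delta_{T,\mathcal I_T}=S_{T'(\zeta_0)u_1/T(\zeta_0)u_1}\in\mathcal{QM}(\mathcal I_T)$, with $u_1\in\Omega(\mathcal I_T)$ arbitrary, is the generator of $T$ regarded as a semigroup of multipliers on $\mathcal I_T$. A normalization of $\mathcal A$ with respect to $T$ is a subalgebra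 $\mathcal B$ of $\mathcal{QM}(\mathcal A)$ which is a Banach algebra for a norm $\|\cdot\|_{\mathcal B}$ such that: for some $u\in\Omega(\mathcal A)$ the inclusion $j:\mathcal A\to\mathcal B$ is a $\mathcal{QM}$-homomorphism with respect to $T(\zeta)u$ for every $\zeta\in S_{a,b}$, and $\|j(x)\|_{\mathcal B}\le\|x\|_{\mathcal A}$ for $x\in\mathcal A$ (then $\tilde j:S_{u/v}\mapsto S_{j(u)/j(v)}$ is an isomorphism $\mathcal{QM}(\mathcal A)\to\mathcal{QM}(\mathcal B)$ preserving pseudoboundedness in both directions); $\tilde j(\mathcal M(\mathcal A))\subset\mathcal M(\mathcal B)$ with $\|\tilde j(R)\|_{\mathcal M(\mathcal B)}\le\|R\|_{\mathcal M(\mathcal A)}$; $\limsup_{\zeta\to0,\zeta\in S_{\alpha,\beta}}\|\tilde j(T(\zeta))\|_{\mathcal M(\mathcal B)}<\infty$ for $a<\alpha<\beta<b$. $\mathcal{QM}(\mathcal A)$ and $\mathcal{QM}(\mathcal B)$ are identified via $\tilde j$. The integral in (iii) is along the half-line $\{t\zeta:t>0\}$, a Bochner integral for the strong operator topology on $\mathcal M(\mathcal B)$.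
   Formalization: In (i) the set is taken with Re(λζ) ≥ t instead of the printed Re(λζ) ≤ t, which is false: for C_0([0,∞)) with T(ζ)f = e^{-ζx}f, Re ζ > 0, the spectrum of Δ_T is (-∞,0], so {Re(λ) ≤ 0} is not compact. *)

theory Defs
  imports "HOL-Analysis.Analysis"
begin

text \<open>Not necessarily unital or commutative. The real scalar multiplication underlying the
  library classes is the restriction of the complex one.\<close>

class complex_banach_algebra = real_normed_algebra + banach +
  fixes scaleC :: "complex \<Rightarrow> 'a \<Rightarrow> 'a" (infixr \<open>*\<^sub>C\<close> 75)
  assumes scaleC_add_right: "c *\<^sub>C (x + y) = c *\<^sub>C x + c *\<^sub>C y"
    and scaleC_add_left: "(c + d) *\<^sub>C x = c *\<^sub>C x + d *\<^sub>C x"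
    and scaleC_scaleC: "c *\<^sub>C (d *\<^sub>C x) = (c * d) *\<^sub>C x"
    and scaleC_of_real: "of_real r *\<^sub>C x = r *\<^sub>R x"
    and mult_scaleC_left: "(c *\<^sub>C x) * y = c *\<^sub>C (x * y)"
    and mult_scaleC_right: "x * (c *\<^sub>C y) = c *\<^sub>C (x * y)"
    and norm_scaleC: "norm (c *\<^sub>C x) = cmod c * norm x"

lemma bounded_linear_scaleC: "bounded_linear (\<lambda>x::'a::complex_banach_algebra. c *\<^sub>C x)"
proof (rule bounded_linear_intro[where K = "cmod c"])
  fix x y :: 'a and r :: real
  show "c *\<^sub>C (x + y) = c *\<^sub>C x + c *\<^sub>C y" by (rule scaleC_add_right)
  show "c *\<^sub>C (r *\<^sub>R x) = r *\<^sub>R (c *\<^sub>C x)"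
    by (simp only: scaleC_of_real[symmetric] scaleC_scaleC mult.commute)
  show "norm (c *\<^sub>C x) \<le> norm x * cmod c" by (simp add: norm_scaleC mult.commute)
qed

typedef (overloaded) 'a multiplier =
  "{R :: 'a::complex_banach_algebra \<Rightarrow>\<^sub>L 'a.
      (\<forall>c x. blinfun_apply R (c *\<^sub>C x) = c *\<^sub>C blinfun_apply R x) \<and>
      (\<forall>u v. blinfun_apply R (u * v) = blinfun_apply R u * v)}"
  morphisms blinfun_of_multiplier Abs_multiplier
  by (rule exI[of _ 0]) (simp add: scaleC_of_real[of 0, simplified] linear_0[OF bounded_linear.linear[OF bounded_linear_scaleC]])

setup_lifting type_definition_multiplier

lift_definition multiplier_apply :: "'a::complex_banach_algebra multiplier \<Rightarrow> 'a \<Rightarrow> 'a"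
  is blinfun_apply .

instantiation multiplier :: (complex_banach_algebra) real_normed_algebra
begin

lift_definition zero_multiplier :: "'a multiplier" is 0
  by (simp add: linear_0[OF bounded_linear.linear[OF bounded_linear_scaleC]])

lift_definition plus_multiplier :: "'a multiplier \<Rightarrow> 'a multiplier \<Rightarrow> 'a multiplier" is "(+)"
  by (simp add: blinfun.bilinear_simps scaleC_add_right distrib_right)

lift_definition minus_multiplier :: "'a multiplier \<Rightarrow> 'a multiplier \<Rightarrow> 'a multiplier" is "(-)"
  by (simp add: blinfun.bilinear_simps linear_diff[OF bounded_linear.linear[OF bounded_linear_scaleC]] left_diff_distrib)

lift_definition uminus_multiplier :: "'a multiplier \<Rightarrow> 'a multiplier" is "uminus"
  by (simp add: blinfun.bilinear_simps linear_neg[OF bounded_linear.linear[OF bounded_linear_scaleC]])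

lift_definition times_multiplier :: "'a multiplier \<Rightarrow> 'a multiplier \<Rightarrow> 'a multiplier" is "(o\<^sub>L)"
  by simp

lift_definition scaleR_multiplier :: "real \<Rightarrow> 'a multiplier \<Rightarrow> 'a multiplier" is "scaleR"
  by (simp add: blinfun.bilinear_simps scaleC_of_real[symmetric] scaleC_scaleC mult.commute mult_scaleC_left)

lift_definition norm_multiplier :: "'a multiplier \<Rightarrow> real" is norm .

definition dist_multiplier :: "'a multiplier \<Rightarrow> 'a multiplier \<Rightarrow> real"
  where "dist_multiplier R S = norm (R - S)"

definition uniformity_multiplier :: "('a multiplier \<times> 'a multiplier) filter"
  where "uniformity_multiplier = (INF e\<in>{0 <..}. principal {(R, S). dist R S < e})"

definition open_multiplier :: "'a multiplier set \<Rightarrow> bool"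
  where "open_multiplier U = (\<forall>x\<in>U. \<forall>\<^sub>F (x', y) in uniformity. x' = x \<longrightarrow> y \<in> U)"

definition sgn_multiplier :: "'a multiplier \<Rightarrow> 'a multiplier"
  where "sgn_multiplier R = inverse (norm R) *\<^sub>R R"

instance
proof
  fix R S U :: "'a multiplier" and r s :: real
  note [simp] = blinfun.bilinear_simps bounded_linear_Blinfun_apply bounded_linear_scaleC
    scaleC_scaleC mult_scaleC_left mult_scaleC_right scaleC_add_right scaleC_add_left
  note [intro!] = blinfun_eqI
  show "R + S + U = R + (S + U)" by transfer simp
  show "R + S = S + R" by transfer simp
  show "0 + R = R" by transfer simp
  show "- R + R = 0" by transfer simp
  show "R - S = R + - S" by transfer simp
  show "r *\<^sub>R (R + S) = r *\<^sub>R R + r *\<^sub>R S" by transfer (simp add: scaleR_add_right)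
  show "(r + s) *\<^sub>R R = r *\<^sub>R R + s *\<^sub>R R" by transfer (simp add: scaleR_add_left)
  show "r *\<^sub>R s *\<^sub>R R = (r * s) *\<^sub>R R" by transfer simp
  show "1 *\<^sub>R R = R" by transfer simp
  show "R * S * U = R * (S * U)" by transfer auto
  show "(R + S) * U = R * U + S * U" by transfer auto
  show "R * (S + U) = R * S + R * U" by transfer auto
  show "r *\<^sub>R R * S = r *\<^sub>R (R * S)" by transfer auto
  show "R * r *\<^sub>R S = r *\<^sub>R (R * S)" by transfer auto
  show "dist R S = norm (R - S)" by (rule dist_multiplier_def)
  show "sgn R = inverse (norm R) *\<^sub>R R" by (simp add: sgn_multiplier_def)
  show "uniformity = (INF e\<in>{0 <..}. principal {(x::'a multiplier, y). dist x y < e})"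
    by (rule uniformity_multiplier_def)
  show "open A = (\<forall>x\<in>A. \<forall>\<^sub>F (x', y) in uniformity. x' = x \<longrightarrow> y \<in> A)"
    for A :: "'a multiplier set" by (rule open_multiplier_def)
  show "(norm R = 0) = (R = 0)" by transfer simp
  show "norm (R + S) \<le> norm R + norm S" by transfer (rule norm_triangle_ineq)
  show "norm (r *\<^sub>R R) = \<bar>r\<bar> * norm R" by transfer simp
  show "norm (R * S) \<le> norm R * norm S" by transfer (rule norm_blinfun_compose)
qed

end

instance multiplier :: (complex_banach_algebra) banach
proof
  fix X :: "nat \<Rightarrow> 'a multiplier"
  assume "Cauchy X"
  let ?X = "\<lambda>n. blinfun_of_multiplier (X n)"
  have dist: "dist R S = dist (blinfun_of_multiplier R) (blinfun_of_multiplier S)"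
    for R S :: "'a multiplier"
    by (simp add: dist_norm norm_multiplier.rep_eq minus_multiplier.rep_eq)
  have "Cauchy ?X" using \<open>Cauchy X\<close> unfolding Cauchy_def dist .
  then obtain L where L: "?X \<longlonglongrightarrow> L" by (auto simp: Cauchy_convergent_iff convergent_def)
  have lim: "(\<lambda>n. blinfun_apply (?X n) x) \<longlonglongrightarrow> blinfun_apply L x" for x
    by (intro tendsto_intros L)
  have X: "blinfun_apply (?X n) (c *\<^sub>C x) = c *\<^sub>C blinfun_apply (?X n) x"
    "blinfun_apply (?X n) (u * v) = blinfun_apply (?X n) u * v" for n c x u v
    using blinfun_of_multiplier[of "X n"] by auto
  have "blinfun_apply L (c *\<^sub>C x) = c *\<^sub>C blinfun_apply L x" for c x
    using lim[of "c *\<^sub>C x"] bounded_linear.tendsto[OF bounded_linear_scaleC lim[of x], of c]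
    unfolding X by (rule LIMSEQ_unique)
  moreover have "blinfun_apply L (u * v) = blinfun_apply L u * v" for u v
    using lim[of "u * v"] tendsto_mult_right[OF lim[of u], of v]
    unfolding X by (rule LIMSEQ_unique)
  ultimately have "blinfun_of_multiplier (Abs_multiplier L) = L"
    by (simp add: Abs_multiplier_inverse)
  then have "X \<longlonglongrightarrow> Abs_multiplier L"
    using L[THEN tendsto_dist_iff[THEN iffD1]] by - (rule tendsto_dist_iff[THEN iffD2], simp add: dist)
  then show "convergent X" by (auto simp: convergent_def)
qed

instantiation multiplier :: (complex_banach_algebra) complex_banach_algebra
begin

lift_definition scaleC_multiplier :: "complex \<Rightarrow> 'a multiplier \<Rightarrow> 'a multiplier"
  is "\<lambda>c R. Blinfun (\<lambda>x. c *\<^sub>C x) o\<^sub>L R"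
  by (simp add: bounded_linear_Blinfun_apply bounded_linear_scaleC scaleC_scaleC mult.commute mult_scaleC_left)

instance
proof
  fix R S :: "'a multiplier" and c d :: complex and r :: real
  note [simp] = blinfun.bilinear_simps bounded_linear_Blinfun_apply bounded_linear_scaleC
    scaleC_scaleC mult_scaleC_left mult_scaleC_right scaleC_add_right scaleC_add_left
  note [intro!] = blinfun_eqI
  show "c *\<^sub>C (R + S) = c *\<^sub>C R + c *\<^sub>C S" by transfer auto
  show "(c + d) *\<^sub>C R = c *\<^sub>C R + d *\<^sub>C R" by transfer auto
  show "c *\<^sub>C (d *\<^sub>C R) = (c * d) *\<^sub>C R" by transfer auto
  show "of_real r *\<^sub>C R = r *\<^sub>R R" by transfer (auto simp: scaleC_of_real)
  show "(c *\<^sub>C R) * S = c *\<^sub>C (R * S)" by transfer auto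
  show "R * (c *\<^sub>C S) = c *\<^sub>C (R * S)" by transfer auto
  have le: "norm (c *\<^sub>C R) \<le> cmod c * norm R" for c and R :: "'a multiplier"
  proof transfer
    fix c :: complex and R :: "'a \<Rightarrow>\<^sub>L 'a"
    show "norm (Blinfun (\<lambda>x. c *\<^sub>C x) o\<^sub>L R) \<le> cmod c * norm R"
      by (rule norm_blinfun_bound)
        (auto simp: norm_scaleC mult.assoc intro!: mult_left_mono norm_blinfun)
  qed
  show "norm (c *\<^sub>C R) = cmod c * norm R"
  proof (cases "c = 0")
    case True
    moreover have "0 \<le> norm (0 *\<^sub>C R)" by transfer simp
    ultimately show ?thesis using le[of 0 R] by simp
  next
    case False
    have one: "1 *\<^sub>C R = R"
      by transfer (auto simp: scaleC_of_real[of 1, simplified])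
    have "norm R = norm (inverse c *\<^sub>C (c *\<^sub>C R))"
    proof -
      have "inverse c *\<^sub>C (c *\<^sub>C R) = (inverse c * c) *\<^sub>C R" by transfer auto
      then show ?thesis using False one by simp
    qed
    also have "\<dots> \<le> inverse (cmod c) * norm (c *\<^sub>C R)"
      using le[of "inverse c" "c *\<^sub>C R"] by (simp add: norm_inverse)
    finally have "cmod c * norm R \<le> norm (c *\<^sub>C R)"
      using False by (simp add: field_simps)
    with le[of c R] show ?thesis by simp
  qed
qed

end

text \<open>The algebra under consideration is a subalgebra \<open>J\<close> of some ambient Banach algebra:
  \<open>J = UNIV\<close> for \<open>\<A>\<close> and \<open>\<B>\<close>, and \<open>J \<subseteq> \<M>(\<A>)\<close> for \<open>\<I>\<^sub>T\<close>. A quasimultiplier is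
  represented by its graph.\<close>

definition weakly_cancellative :: "'a::complex_banach_algebra set \<Rightarrow> bool" where
  "weakly_cancellative J \<longleftrightarrow> (\<forall>u\<in>J - {0}. (*) u ` J \<noteq> {0})"

definition Omega :: "'a::complex_banach_algebra set \<Rightarrow> 'a set" where
  "Omega J = {u\<in>J. J \<subseteq> closure ((*) u ` J)}"

definition dense_principal_ideals :: "'a::complex_banach_algebra set \<Rightarrow> bool" where
  "dense_principal_ideals J \<longleftrightarrow> Omega J \<noteq> {}"

definition qm_quot :: "'a::complex_banach_algebra set \<Rightarrow> 'a \<Rightarrow> 'a \<Rightarrow> 'a rel" where
  "qm_quot J u v = {(x, y). x \<in> J \<and> y \<in> J \<and> v * y = u * x}"

definition QM :: "'a::complex_banach_algebra set \<Rightarrow> 'a rel set" where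
  "QM J = {qm_quot J u v | u v. u \<in> J \<and> v \<in> Omega J}"

definition qm_apply :: "'a rel \<Rightarrow> 'a \<Rightarrow> 'a" where
  "qm_apply S x = (THE y. (x, y) \<in> S)"

text \<open>The operations do not depend on the chosen fractions, so that the descriptions below are
  proper on \<open>QM J\<close> when \<open>J\<close> is commutative and weakly cancellative.\<close>

definition qm_add :: "'a::complex_banach_algebra set \<Rightarrow> 'a rel \<Rightarrow> 'a rel \<Rightarrow> 'a rel" where
  "qm_add J S S' = (THE Q. \<exists>u\<in>J. \<exists>v\<in>Omega J. \<exists>u'\<in>J. \<exists>v'\<in>Omega J.
     S = qm_quot J u v \<and> S' = qm_quot J u' v' \<and> Q = qm_quot J (u * v' + u' * v) (v * v'))"

definition qm_mult :: "'a::complex_banach_algebra set \<Rightarrow> 'a rel \<Rightarrow> 'a rel \<Rightarrow> 'a rel" where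
  "qm_mult J S S' = (THE Q. \<exists>u\<in>J. \<exists>v\<in>Omega J. \<exists>u'\<in>J. \<exists>v'\<in>Omega J.
     S = qm_quot J u v \<and> S' = qm_quot J u' v' \<and> Q = qm_quot J (u * u') (v * v'))"

definition qm_scale :: "'a::complex_banach_algebra set \<Rightarrow> complex \<Rightarrow> 'a rel \<Rightarrow> 'a rel" where
  "qm_scale J c S = (THE Q. \<exists>u\<in>J. \<exists>v\<in>Omega J. S = qm_quot J u v \<and> Q = qm_quot J (c *\<^sub>C u) v)"

primrec qm_power :: "'a::complex_banach_algebra set \<Rightarrow> 'a rel \<Rightarrow> nat \<Rightarrow> 'a rel" where
  "qm_power J S 0 = Id_on J"
| "qm_power J S (Suc n) = qm_mult J S (qm_power J S n)"

definition qm_shift :: "'a::complex_banach_algebra set \<Rightarrow> complex \<Rightarrow> 'a rel \<Rightarrow> 'a rel" where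
  "qm_shift J c S = qm_add J (qm_scale J c (Id_on J)) (qm_scale J (- 1) S)"

definition pseudobounded :: "'a::complex_banach_algebra set \<Rightarrow> 'a rel set \<Rightarrow> bool" where
  "pseudobounded J V \<longleftrightarrow> V \<subseteq> QM J \<and>
     (\<exists>u\<in>Omega J. (\<forall>S\<in>V. u \<in> Domain S) \<and> (\<exists>M. \<forall>S\<in>V. norm (qm_apply S u) \<le> M))"

definition QM_reg :: "'a::complex_banach_algebra set \<Rightarrow> 'a rel set" where
  "QM_reg J = {S\<in>QM J. \<exists>r>0. pseudobounded J {qm_scale J (of_real (r ^ n)) (qm_power J S n) | n. n \<ge> 1}}"

text \<open>The identification of multipliers, and of elements, of an algebra with quasimultipliers
  of full domain.\<close>

definition qm_of_multiplier :: "'a::complex_banach_algebra multiplier \<Rightarrow> 'a rel" where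
  "qm_of_multiplier R = {(x, multiplier_apply R x) | x. True}"

definition qm_of_elem :: "'a::complex_banach_algebra \<Rightarrow> 'a rel" where
  "qm_of_elem u = {(x, u * x) | x. True}"

definition sector :: "real \<Rightarrow> real \<Rightarrow> complex set" where
  "sector a b = {z. z \<noteq> 0 \<and> (\<exists>\<theta>. is_Arg z \<theta> \<and> a < \<theta> \<and> \<theta> < b)}"

definition has_cderiv :: "(complex \<Rightarrow> 'a::complex_banach_algebra) \<Rightarrow> 'a \<Rightarrow> complex \<Rightarrow> bool" where
  "has_cderiv f D z \<longleftrightarrow> (f has_derivative (\<lambda>h. h *\<^sub>C D)) (at z)"

definition cderiv :: "(complex \<Rightarrow> 'a::complex_banach_algebra) \<Rightarrow> complex \<Rightarrow> 'a" where
  "cderiv f z = (THE D. has_cderiv f D z)"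

definition vholomorphic_on :: "(complex \<Rightarrow> 'a::complex_banach_algebra) \<Rightarrow> complex set \<Rightarrow> bool" where
  "vholomorphic_on f U \<longleftrightarrow> open U \<and> (\<forall>z\<in>U. \<exists>D. has_cderiv f D z)"

definition holomorphic_semigroup ::
    "real \<Rightarrow> real \<Rightarrow> (complex \<Rightarrow> 'a::complex_banach_algebra) \<Rightarrow> bool" where
  "holomorphic_semigroup a b T \<longleftrightarrow> vholomorphic_on T (sector a b) \<and>
     (\<forall>z\<in>sector a b. \<forall>w\<in>sector a b. T (z + w) = T z * T w)"

definition semigroup_algebra ::
    "real \<Rightarrow> real \<Rightarrow> (complex \<Rightarrow> 'a::complex_banach_algebra) \<Rightarrow> 'a set" where
  "semigroup_algebra a b T = closure (module.span (*\<^sub>C) (T ` sector a b))"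

text \<open>\<open>\<Delta>\<^sub>T\<close> and \<open>\<Delta>\<^sub>T\<^sub>,\<^sub>I\<close>, independent of the choices of \<open>\<zeta>\<close> and \<open>u\<close>. In the second case \<open>T(\<zeta>)\<close> acts
  on \<open>\<I>\<^sub>T\<close> by the multiplication of \<open>\<M>(\<A>)\<close>.\<close>

definition generator ::
    "real \<Rightarrow> real \<Rightarrow> (complex \<Rightarrow> 'a::complex_banach_algebra multiplier) \<Rightarrow> 'a rel" where
  "generator a b T = (THE D. \<exists>\<zeta>\<in>sector a b. \<exists>u\<in>Omega UNIV.
     D = qm_quot UNIV (multiplier_apply (cderiv T \<zeta>) u) (multiplier_apply (T \<zeta>) u))"

definition generator_on_algebra ::
    "real \<Rightarrow> real \<Rightarrow> (complex \<Rightarrow> 'a::complex_banach_algebra multiplier) \<Rightarrow> 'a multiplier rel" where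
  "generator_on_algebra a b T =
     (THE D. \<exists>\<zeta>\<in>sector a b. \<exists>u\<in>Omega (semigroup_algebra a b T).
        D = qm_quot (semigroup_algebra a b T) (cderiv T \<zeta> * u) (T \<zeta> * u))"

text \<open>Characters are nonzero; only the values on \<open>J\<close> are relevant.\<close>

definition character :: "'a::complex_banach_algebra set \<Rightarrow> ('a \<Rightarrow> complex) \<Rightarrow> bool" where
  "character J \<phi> \<longleftrightarrow>
     (\<forall>x\<in>J. \<forall>y\<in>J. \<phi> (x + y) = \<phi> x + \<phi> y \<and> \<phi> (x * y) = \<phi> x * \<phi> y) \<and>
     (\<forall>c. \<forall>x\<in>J. \<phi> (c *\<^sub>C x) = c * \<phi> x) \<and> (\<exists>x\<in>J. \<phi> x \<noteq> 0)"

definition character_ext ::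
    "'a::complex_banach_algebra set \<Rightarrow> ('a \<Rightarrow> complex) \<Rightarrow> 'a rel \<Rightarrow> complex" where
  "character_ext J \<phi> S = (THE c. \<exists>u\<in>J. \<exists>v\<in>Omega J. S = qm_quot J u v \<and> c = \<phi> u / \<phi> v)"

text \<open>In the quasinilpotent case \<open>\<I>\<^sub>T\<close> has no characters, and the set is empty as the usual
  convention demands.

  Orientation: a character \<open>\<phi>\<close> with extended value \<open>\<mu>\<close> at the generator satisfies
  \<open>\<phi> (T \<zeta>) = exp (\<mu> * \<zeta>)\<close>, so the compact pieces of the spectrum are those where
  \<open>Re (\<mu> * \<zeta>)\<close> is bounded below, \<open>Re (\<mu> * \<zeta>) \<ge> t\<close>. The printed source has \<open>\<le> t\<close>, which fits
  the spectrum of \<open>- \<Delta>\<^sub>T\<close> and is false for that of \<open>\<Delta>\<^sub>T\<close>: for \<open>C\<^sub>0[0,\<infinity>)\<close> and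
  \<open>T \<zeta> = exp (- \<zeta> x)\<close>, \<open>Re \<zeta> > 0\<close>, the spectrum is \<open>(-\<infinity>,0]\<close>.\<close>

definition arveson_spectrum ::
    "real \<Rightarrow> real \<Rightarrow> (complex \<Rightarrow> 'a::complex_banach_algebra multiplier) \<Rightarrow> complex set" where
  "arveson_spectrum a b T =
     {character_ext (semigroup_algebra a b T) \<phi> (generator_on_algebra a b T) | \<phi>.
        character (semigroup_algebra a b T) \<phi>}"

definition arveson_resolvent ::
    "real \<Rightarrow> real \<Rightarrow> (complex \<Rightarrow> 'a::complex_banach_algebra multiplier) \<Rightarrow> complex set" where
  "arveson_resolvent a b T = - arveson_spectrum a b T"

definition QM_homomorphism ::
    "('a::complex_banach_algebra \<Rightarrow> 'b::complex_banach_algebra) \<Rightarrow> 'a \<Rightarrow> bool" where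
  "QM_homomorphism \<Phi> u \<longleftrightarrow> u \<in> Omega UNIV \<and>
     (\<forall>x y. \<Phi> (x + y) = \<Phi> x + \<Phi> y) \<and> (\<forall>x y. \<Phi> (x * y) = \<Phi> x * \<Phi> y) \<and>
     (\<forall>c x. \<Phi> (c *\<^sub>C x) = c *\<^sub>C \<Phi> x) \<and>
     inj \<Phi> \<and> closure (range \<Phi>) = UNIV \<and> range ((*) (\<Phi> u)) \<subseteq> range \<Phi>"

text \<open>\<open>qm_lift j\<close> is \<open>S\<^bsub>u/v\<^esub> \<mapsto> S\<^bsub>j(u)/j(v)\<^esub>\<close>, and \<open>multiplier_lift j\<close> is its restriction
  \<open>\<M>(\<A>) \<rightarrow> \<M>(\<B>)\<close>.\<close>

definition qm_lift ::
    "('a::complex_banach_algebra \<Rightarrow> 'b::complex_banach_algebra) \<Rightarrow> 'a rel \<Rightarrow> 'b rel" where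
  "qm_lift j S = (THE Q. \<exists>u. \<exists>v\<in>Omega UNIV. S = qm_quot UNIV u v \<and> Q = qm_quot UNIV (j u) (j v))"

definition multiplier_lift ::
    "('a::complex_banach_algebra \<Rightarrow> 'b::complex_banach_algebra) \<Rightarrow> 'a multiplier \<Rightarrow> 'b multiplier" where
  "multiplier_lift j R = (THE R'. qm_of_multiplier R' = qm_lift j (qm_of_multiplier R))"

text \<open>The subalgebra \<open>\<B>\<close> of \<open>\<Q>\<M>(\<A>)\<close> with its Banach algebra norm is given as a type \<open>'b\<close>
  together with the inclusion \<open>\<iota>\<close> of \<open>\<B>\<close> into \<open>\<Q>\<M>(\<A>)\<close>; \<open>j\<close> is the inclusion of \<open>\<A>\<close> into \<open>\<B>\<close>.\<close>

definition normalization ::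
    "real \<Rightarrow> real \<Rightarrow> (complex \<Rightarrow> 'a::complex_banach_algebra multiplier) \<Rightarrow>
     ('b::complex_banach_algebra \<Rightarrow> 'a rel) \<Rightarrow> ('a \<Rightarrow> 'b) \<Rightarrow> bool" where
  "normalization a b T \<iota> j \<longleftrightarrow>
     inj \<iota> \<and> range \<iota> \<subseteq> QM UNIV \<and>
     (\<forall>x y. \<iota> (x + y) = qm_add UNIV (\<iota> x) (\<iota> y)) \<and>
     (\<forall>x y. \<iota> (x * y) = qm_mult UNIV (\<iota> x) (\<iota> y)) \<and>
     (\<forall>c x. \<iota> (c *\<^sub>C x) = qm_scale UNIV c (\<iota> x)) \<and>
     (\<forall>x. \<iota> (j x) = qm_of_elem x) \<and>
     (\<exists>u\<in>Omega UNIV. \<forall>\<zeta>\<in>sector a b. QM_homomorphism j (multiplier_apply (T \<zeta>) u)) \<and>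
     (\<forall>x. norm (j x) \<le> norm x) \<and>
     (\<forall>R. \<exists>R'. qm_of_multiplier R' = qm_lift j (qm_of_multiplier R) \<and> norm R' \<le> norm R) \<and>
     (\<forall>\<alpha> \<beta>. a < \<alpha> \<and> \<alpha> < \<beta> \<and> \<beta> < b \<longrightarrow>
        Limsup (at 0 within sector \<alpha> \<beta>) (\<lambda>\<zeta>. ereal (norm (multiplier_lift j (T \<zeta>)))) < \<infinity>)"

definition csubalgebra :: "'a::complex_banach_algebra set \<Rightarrow> bool" where
  "csubalgebra X \<longleftrightarrow> 0 \<in> X \<and> (\<forall>x\<in>X. \<forall>y\<in>X. x + y \<in> X \<and> x * y \<in> X) \<and> (\<forall>c. \<forall>x\<in>X. c *\<^sub>C x \<in> X)"

definition closed_subalgebra_generated :: "'a::complex_banach_algebra set \<Rightarrow> 'a set" where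
  "closed_subalgebra_generated Y = (\<lambda>X. closed X \<and> csubalgebra X) hull Y"

text \<open>The library's predicate \<^const>\<open>has_bochner_integral\<close> is restricted to second countable target
  spaces. This is the same definition for an arbitrary normed space.\<close>

definition bochner_integral_eq ::
    "'s measure \<Rightarrow> ('s \<Rightarrow> 'a::real_normed_vector) \<Rightarrow> 'a \<Rightarrow> bool" where
  "bochner_integral_eq M f x \<longleftrightarrow> f \<in> borel_measurable M \<and>
     (\<exists>s. (\<forall>i. Bochner_Integration.simple_bochner_integrable M (s i)) \<and>
          (\<lambda>i::nat. \<integral>\<^sup>+t. ennreal (norm (f t - s i t)) \<partial>M) \<longlonglongrightarrow> 0 \<and>
          (\<lambda>i. Bochner_Integration.simple_bochner_integral M (s i)) \<longlonglongrightarrow> x)"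

end

theory Submission
  imports Defs "HOL-Complex_Analysis.Conformal_Mappings"
begin

text \<open>
  Every element \<open>x\<close> of the span of the semigroup is a combination \<open>\<Sum>c T(\<zeta>)\<close>, and a character with value
  \<open>\<mu>\<close> at the generator must send it to \<open>f(\<mu>)\<close>, where \<open>f(\<mu>) = \<Sum>c exp(\<mu> \<zeta>)\<close>. Characters are
  contractive, so \<open>\<mu>\<close> lies in the spectrum iff \<open>\<bar>f(\<mu>)\<bar> \<le> \<parallel>x\<parallel>\<close> for all such combinations. This makes the
  spectrum closed, and the bound \<open>\<bar>\<mu> exp(\<mu> \<zeta>)\<bar> \<le> \<parallel>T'(\<zeta>)\<parallel>\<close> makes its pieces compact.

  Conversely, if \<open>\<bar>f(\<mu>)\<bar> > \<parallel>x\<parallel>\<close> for one combination, the resolvent at \<open>\<mu>\<close> is explicit and no Gelfand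
  theory is needed: boundedness near \<open>0\<close> on the normalization gives
  \<open>V = \<Sum>c \<integral>\<^sub>0\<^sup>\<zeta> exp(\<mu> (\<zeta> - s)) T(s) ds\<close> with \<open>V (\<Delta> - \<mu>) = x - f(\<mu>)\<close>, and \<open>f(\<mu>) - x\<close> is inverted by a
  Neumann series. To the right of the growth bound, \<open>x = T(t \<zeta>)\<close> with large \<open>t\<close> is such a combination,
  and the Laplace transform is the resolvent by uniqueness.
\<close>

text \<open>In M(A) the semigroup may blow up at \<open>0\<close>, so the integrals from
  \<open>0\<close> to \<open>\<zeta>\<close> need not converge there; in M(B) the norms stay bounded
  near \<open>0\<close> along each ray. Inverses are therefore built among the multipliers of B and
  brought back to A as fractions, whose denominator is made from an element p such that
  \<open>j p\<close> multiplies B into the range of \<open>j\<close>. Regularity in A also needs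
  norms in A to be bounded by norms in B, which is the task of the closed graph theorem.

  The generator is unbounded, so identities about it are stated after multiplication by a semigroup
  element, as in \<open>R * (\<mu> *\<^sub>C U z - U' z) = U z\<close>, and the factor
  \<open>U z\<close> is cancelled because it has dense range.

  Hahn-Banach has one purpose: each \<open>T z\<close> generates a dense principal ideal of the
  semigroup algebra. Only then is \<open>T z\<close> an admissible denominator over that algebra,
  and the spectrum, which is defined by fractions, becomes computable.\<close>

section \<open>Complex scalars, subalgebras and Neumann series\<close>

interpretation scaleC: module "scaleC :: complex \<Rightarrow> 'a::complex_banach_algebra \<Rightarrow> 'a"
  by standard (auto simp: scaleC_add_right scaleC_add_left scaleC_scaleC scaleC_of_real[of 1, simplified])

lemma bounded_bilinear_scaleC:
  "bounded_bilinear (scaleC :: complex \<Rightarrow> 'a::complex_banach_algebra \<Rightarrow> 'a)"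
proof
  fix c d :: complex and x y :: 'a and r :: real
  show "(c + d) *\<^sub>C x = c *\<^sub>C x + d *\<^sub>C x" "c *\<^sub>C (x + y) = c *\<^sub>C x + c *\<^sub>C y"
    by (rule scaleC_add_left scaleC_add_right)+
  show "(r *\<^sub>R c) *\<^sub>C x = r *\<^sub>R (c *\<^sub>C x)"
    by (simp add: scaleC_of_real[symmetric] scaleC_scaleC scaleR_conv_of_real)
  show "c *\<^sub>C (r *\<^sub>R x) = r *\<^sub>R (c *\<^sub>C x)"
    by (simp add: scaleC_of_real[symmetric] scaleC_scaleC mult.commute)
  show "\<exists>K. \<forall>a b. norm (a *\<^sub>C (b::'a)) \<le> norm a * norm b * K"
    by (rule exI[of _ 1]) (simp add: norm_scaleC)
qed

lemmas continuous_on_scaleC [continuous_intros] = bounded_bilinear.continuous_on[OF bounded_bilinear_scaleC]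
lemmas tendsto_scaleC [tendsto_intros] = bounded_bilinear.tendsto[OF bounded_bilinear_scaleC]
lemmas has_vector_derivative_scaleC =
  bounded_bilinear.has_vector_derivative[OF bounded_bilinear_scaleC]

lemma csubalgebraD:
  assumes "csubalgebra X"
  shows "0 \<in> X" "\<And>x y. x \<in> X \<Longrightarrow> y \<in> X \<Longrightarrow> x + y \<in> X" "\<And>x y. x \<in> X \<Longrightarrow> y \<in> X \<Longrightarrow> x * y \<in> X"
    "\<And>c x. x \<in> X \<Longrightarrow> c *\<^sub>C x \<in> X" "\<And>r x. x \<in> X \<Longrightarrow> r *\<^sub>R x \<in> X"
    "\<And>x. x \<in> X \<Longrightarrow> - x \<in> X" "\<And>x y. x \<in> X \<Longrightarrow> y \<in> X \<Longrightarrow> x - y \<in> X"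
proof -
  show *: "0 \<in> X" "\<And>x y. x \<in> X \<Longrightarrow> y \<in> X \<Longrightarrow> x + y \<in> X" "\<And>x y. x \<in> X \<Longrightarrow> y \<in> X \<Longrightarrow> x * y \<in> X"
    and sc: "\<And>c x. x \<in> X \<Longrightarrow> c *\<^sub>C x \<in> X"
    using assms by (auto simp: csubalgebra_def)
  show sr: "\<And>r x. x \<in> X \<Longrightarrow> r *\<^sub>R x \<in> X"
    using sc by (metis scaleC_of_real)
  show m: "\<And>x. x \<in> X \<Longrightarrow> - x \<in> X"
    using sr[of _ "-1"] by simp
  show "\<And>x y. x \<in> X \<Longrightarrow> y \<in> X \<Longrightarrow> x - y \<in> X"
    using *(2) m by (metis diff_conv_add_uminus)
qed

lemma csubalgebra_UNIV: "csubalgebra UNIV"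
  by (simp add: csubalgebra_def)

text \<open>The sum of all \<open>y ^ n * w\<close> solves the equation without a unit: its partial
  sums stay in the subalgebra, and the limit stays there by closedness.\<close>

lemma Neumann_solution:
  fixes y w :: "'a::complex_banach_algebra"
  assumes X: "csubalgebra X" "closed X" and "y \<in> X" "w \<in> X" and y: "norm y < 1"
  obtains z where "z \<in> X" "z = w + y * z"
proof -
  define t where "t n = ((\<lambda>z. y * z) ^^ n) w" for n
  have t0: "t 0 = w" by (simp add: t_def)
  have t_in: "t n \<in> X" for n
    by (induction n) (auto simp: t_def assms csubalgebraD[OF X(1)])
  have norm_t: "norm (t n) \<le> norm w * norm y ^ n" for n
  proof (induction n)
    case (Suc n)
    have "norm (t (Suc n)) \<le> norm y * norm (t n)"
      by (simp add: t_def norm_mult_ineq)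
    also have "\<dots> \<le> norm y * (norm w * norm y ^ n)"
      by (intro mult_left_mono Suc) auto
    finally show ?case by (simp add: mult_ac)
  qed (simp add: t_def)
  have "summable t"
    using y by (intro summable_comparison_test'[OF summable_mult[OF summable_geometric] norm_t]) auto
  then have "t sums suminf t" by (rule summable_sums)
  have "suminf t \<in> X"
  proof (rule closed_sequentially[OF X(2)])
    show "(\<Sum>i<n. t i) \<in> X" for n
      by (induction n) (auto simp: t_in csubalgebraD[OF X(1)])
    show "(\<lambda>n. \<Sum>i<n. t i) \<longlonglongrightarrow> suminf t"
      using \<open>t sums suminf t\<close> by (simp add: sums_def)
  qed
  moreover have "suminf t = w + y * suminf t"
  proof -
    have "suminf t = t 0 + (\<Sum>n. t (Suc n))"
      using \<open>summable t\<close> by (simp add: suminf_split_head)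
    also have "(\<Sum>n. t (Suc n)) = (\<Sum>n. y * t n)"
      by (simp add: t_def)
    also have "\<dots> = y * suminf t"
      by (rule bounded_linear.suminf[OF bounded_linear_mult_right \<open>summable t\<close>, symmetric])
    finally show ?thesis using t0 by metis
  qed
  ultimately show ?thesis by (rule that)
qed

subsection \<open>Complex derivatives\<close>

lemma has_cderiv_unique:
  assumes "has_cderiv f D z" "has_cderiv f E z"
  shows "D = E"
proof -
  have "(\<lambda>h. h *\<^sub>C D) = (\<lambda>h. h *\<^sub>C E)"
    using assms unfolding has_cderiv_def by (rule has_derivative_unique)
  from fun_cong[OF this, of 1] show ?thesis by simp
qed

lemma cderiv_eq: "has_cderiv f D z \<Longrightarrow> cderiv f z = D"
  unfolding cderiv_def by (blast intro: has_cderiv_unique)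

lemma has_cderiv_isCont: "has_cderiv f D z \<Longrightarrow> isCont f z"
  unfolding has_cderiv_def by (rule has_derivative_continuous)

lemma has_cderiv_transform_open:
  assumes "has_cderiv f D z" "open U" "z \<in> U" "\<And>w. w \<in> U \<Longrightarrow> f w = g w"
  shows "has_cderiv g D z"
  using assms unfolding has_cderiv_def by (metis has_derivative_transform_within_open)

lemma has_cderiv_linear:
  assumes "has_cderiv f D z" "bounded_linear L" "\<And>c x. L (c *\<^sub>C x) = c *\<^sub>C L x"
  shows "has_cderiv (\<lambda>w. L (f w)) (L D) z"
  using bounded_linear.has_derivative[OF assms(2) assms(1)[unfolded has_cderiv_def]] assms(3)
  by (simp add: has_cderiv_def)

lemma has_cderiv_functional:
  fixes L :: "'a::complex_banach_algebra \<Rightarrow> complex"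
  assumes "has_cderiv f D z" "bounded_linear L" "\<And>c x. L (c *\<^sub>C x) = c * L x"
  shows "((\<lambda>w. L (f w)) has_field_derivative L D) (at z)"
proof -
  have "(\<lambda>h. L (h *\<^sub>C D)) = (*) (L D)" by (auto simp: assms(3))
  then show ?thesis
    using bounded_linear.has_derivative[OF assms(2) assms(1)[unfolded has_cderiv_def]]
    by (simp add: has_field_derivative_def)
qed

lemma has_cderiv_shift:
  assumes "has_cderiv f D (z + w)"
  shows "has_cderiv (\<lambda>z. f (z + w)) D z"
proof -
  have "((\<lambda>z. z + w) has_derivative (\<lambda>h. h)) (at z)"
    by (auto intro!: derivative_eq_intros)
  from diff_chain_at[OF this assms[unfolded has_cderiv_def]]
  show ?thesis by (simp add: has_cderiv_def o_def)
qed

lemma has_cderiv_chain_real: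
  assumes "has_cderiv f D (g t)" "(g has_vector_derivative g') (at t)"
  shows "((\<lambda>t. f (g t)) has_vector_derivative g' *\<^sub>C D) (at t)"
proof -
  have "(f \<circ> g has_derivative (\<lambda>h. h *\<^sub>C D) \<circ> (\<lambda>x. x *\<^sub>R g')) (at t)"
    using assms by (intro diff_chain_at) (auto simp: has_cderiv_def has_vector_derivative_def)
  moreover have "(\<lambda>h. h *\<^sub>C D) \<circ> (\<lambda>x. x *\<^sub>R g') = (\<lambda>x. x *\<^sub>R (g' *\<^sub>C D))"
    by (auto simp: scaleC_of_real[symmetric] scaleC_scaleC scaleR_conv_of_real)
  ultimately show ?thesis by (simp add: has_vector_derivative_def o_def)
qed

text \<open>Difference quotients of \<open>T\<close> stay in the semigroup algebra, on which alone a
  character is known to be additive and contractive. Characters are therefore differentiated along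
  \<open>T\<close> through this limit and not by a chain rule.\<close>

lemma has_cderiv_limit:
  assumes "has_cderiv f D z"
  shows "((\<lambda>h. inverse h *\<^sub>C (f (z + h) - f z)) \<longlongrightarrow> D) (at 0)"
proof -
  have "(\<lambda>h. norm (f (z + h) - f z - h *\<^sub>C D) / norm h) \<midarrow>0\<rightarrow> 0"
    using assms by (simp add: has_cderiv_def has_derivative_at)
  moreover have "norm (f (z + h) - f z - h *\<^sub>C D) / norm h = norm (inverse h *\<^sub>C (f (z + h) - f z) - D)"
    if "h \<noteq> 0" for h
  proof -
    have "inverse h *\<^sub>C (f (z + h) - f z) - D = inverse h *\<^sub>C (f (z + h) - f z - h *\<^sub>C D)"
      using that by (simp add: scaleC.scale_right_diff_distrib del: inverse_eq_divide)
    then have "norm (inverse h *\<^sub>C (f (z + h) - f z) - D) = inverse (norm h) * norm (f (z + h) - f z - h *\<^sub>C D)"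
      by (simp only: norm_scaleC norm_inverse)
    then show ?thesis by (simp add: divide_inverse)
  qed
  ultimately have "(\<lambda>h. norm (inverse h *\<^sub>C (f (z + h) - f z) - D)) \<midarrow>0\<rightarrow> 0"
    by (auto elim!: Lim_transform_eventually simp: eventually_at_filter)
  then show ?thesis by (simp add: tendsto_norm_zero_iff LIM_zero_iff)
qed

subsection \<open>Sectors\<close>

text \<open>An opening of at most \<open>pi\<close> makes the sector an intersection of two open
  half planes bounded by lines through \<open>0\<close>, so closure under sums becomes a linear
  statement.\<close>

lemma sector_iff:
  assumes "a < b" "b \<le> a + pi"
  shows "z \<in> sector a b \<longleftrightarrow> Im (z * cis (- a)) > 0 \<and> Im (z * cis (- b)) < 0"
proof -
  have im: "Im (of_real r * cis t * cis (- s)) = r * sin (t - s)" for r t s :: real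
    by (simp add: mult.assoc cis_mult)
  show ?thesis
  proof
    assume "z \<in> sector a b"
    then obtain t where t: "z \<noteq> 0" "z = of_real (norm z) * cis t" "a < t" "t < b"
      by (auto simp: sector_def is_Arg_def cis_conv_exp)
    have "Im (z * cis (- s)) = norm z * sin (t - s)" for s
      by (subst t(2)) (rule im)
    moreover have "sin (t - a) > 0" using t assms by (intro sin_gt_zero) auto
    moreover have "sin (t - b) < 0"
      using sin_gt_zero[of "b - t"] t assms sin_minus[of "b - t"] by simp
    ultimately show "Im (z * cis (- a)) > 0 \<and> Im (z * cis (- b)) < 0"
      using t(1) by (auto simp: mult_pos_neg)
  next
    assume *: "Im (z * cis (- a)) > 0 \<and> Im (z * cis (- b)) < 0"
    then have "z \<noteq> 0" by auto
    \<comment> \<open>Rotation by \<open>- a\<close> puts the first edge on the positive real axis;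
      a point of the upper half plane has its argument between \<open>0\<close> and
      \<open>pi\<close>.\<close>
    define t where "t = Arg (z * cis (- a))"
    have t: "0 < t" "t < pi" using * Arg_lt_pi unfolding t_def by blast+
    have "z * cis (- a) = of_real (norm (z * cis (- a))) * cis t"
      using is_Arg_Arg[of "z * cis (- a)"] \<open>z \<noteq> 0\<close>
      by (simp add: is_Arg_def t_def cis_conv_exp)
    then have "z * cis (- a) = of_real (norm z) * cis t" by (simp add: norm_mult)
    moreover have "z = z * cis (- a) * cis a" by (simp add: mult.assoc cis_mult)
    ultimately have z: "z = of_real (norm z) * cis (a + t)"
      by (metis mult.assoc cis_mult add.commute)
    have "Im (z * cis (- b)) = norm z * sin (a + t - b)"
      by (subst z) (rule im)
    then have "sin (a + t - b) < 0" using * \<open>z \<noteq> 0\<close> by (auto simp: mult_less_0_iff)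
    \<comment> \<open>The angle \<open>a + t - b\<close> is below \<open>pi\<close>; were it
      nonnegative, its sine would be nonnegative too.\<close>
    then have "a + t < b"
      using sin_ge_zero[of "a + t - b"] t assms by linarith
    then show "z \<in> sector a b"
      unfolding sector_def using z t \<open>z \<noteq> 0\<close>
      by (auto simp: is_Arg_def cis_conv_exp intro!: exI[of _ "a + t"])
  qed
qed

lemma sector_nonempty:
  assumes "a < b"
  shows "\<exists>z. z \<in> sector a b"
  using assms unfolding sector_def
  by (intro exI[of _ "cis ((a + b) / 2)"]) (auto simp: is_Arg_def cis_conv_exp intro!: exI[of _ "(a + b) / 2"])

lemma sector_add:
  assumes "a < b" "b \<le> a + pi" "z \<in> sector a b" "w \<in> sector a b"
  shows "z + w \<in> sector a b"
  using assms(3,4) by (simp add: sector_iff[OF assms(1,2)] distrib_right algebra_simps)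

lemma sector_scale:
  assumes "z \<in> sector a b" "t > 0"
  shows "of_real t * z \<in> sector a b"
proof -
  from assms obtain \<theta> where "z \<noteq> 0" "z = of_real (norm z) * exp (\<i> * of_real \<theta>)" "a < \<theta>" "\<theta> < b"
    by (auto simp: sector_def is_Arg_def)
  then show ?thesis
    using assms(2) unfolding sector_def is_Arg_def
    by (auto simp: norm_mult mult.assoc intro!: exI[of _ \<theta>])
qed

lemma sector_convex:
  assumes "a < b" "b \<le> a + pi"
  shows "convex (sector a b)"
proof (rule convexI)
  fix x y :: complex and u v :: real
  assume *: "x \<in> sector a b" "y \<in> sector a b" "0 \<le> u" "0 \<le> v" "u + v = 1"
  show "u *\<^sub>R x + v *\<^sub>R y \<in> sector a b"
  proof (cases "u = 0 \<or> v = 0")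
    case True
    then show ?thesis using * by auto
  next
    case False
    then show ?thesis
      using * sector_scale sector_add[OF assms] by (simp add: scaleR_conv_of_real)
  qed
qed

text \<open>A normalization bounds the semigroup at \<open>0\<close> only on strictly smaller
  sectors; every ray lies in one of them.\<close>

lemma sector_ray:
  assumes "z \<in> sector a b"
  obtains \<alpha> \<beta> where "a < \<alpha>" "\<alpha> < \<beta>" "\<beta> < b" "z \<in> sector \<alpha> \<beta>"
proof -
  from assms obtain \<theta> where "z \<noteq> 0" "is_Arg z \<theta>" "a < \<theta>" "\<theta> < b"
    by (auto simp: sector_def)
  moreover obtain \<alpha> \<beta> where "a < \<alpha>" "\<alpha> < \<theta>" "\<theta> < \<beta>" "\<beta> < b"
    using dense[OF \<open>a < \<theta>\<close>] dense[OF \<open>\<theta> < b\<close>] by blast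
  ultimately show ?thesis using that[of \<alpha> \<beta>] by (auto simp: sector_def)
qed

subsection \<open>The Hahn-Banach and closed graph theorems\<close>

text \<open>Partial functionals are represented by their graphs, so that extension is inclusion and
  chains are bounded by their unions. Single-valuedness comes for free: a subspace dominated by
  \<open>p\<close> cannot contain \<open>(0, r)\<close> with \<open>r \<noteq> 0\<close>, because
  \<open>p 0 = 0\<close>.\<close>

lemma Hahn_Banach_sublinear:
  fixes p :: "'v::real_vector \<Rightarrow> real" and G0 :: "('v \<times> real) set"
  assumes p_add: "\<And>x y. p (x + y) \<le> p x + p y"
    and p_scale: "\<And>r x. r \<ge> 0 \<Longrightarrow> p (r *\<^sub>R x) = r * p x"
    and G0: "subspace G0" "\<And>x r. (x, r) \<in> G0 \<Longrightarrow> r \<le> p x"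
  obtains f where "linear f" "\<And>x. f x \<le> p x" "\<And>x r. (x, r) \<in> G0 \<Longrightarrow> f x = r"
proof -
  define P where "P = {G. subspace G \<and> G0 \<subseteq> G \<and> (\<forall>(x, r)\<in>G. r \<le> p x)}"
  have "\<exists>M\<in>P. \<forall>X\<in>P. M \<subseteq> X \<longrightarrow> X = M"
  proof (rule subset_Zorn)
    fix C assume C: "subset.chain P C"
    show "\<exists>U\<in>P. \<forall>X\<in>C. X \<subseteq> U"
    proof (cases "C = {}")
      case True
      have "G0 \<in> P" using G0 by (auto simp: P_def)
      then show ?thesis using True by blast
    next
      case False
      have CP: "G \<in> P" if "G \<in> C" for G
        using C that by (auto simp: subset.chain_def)
      have tot: "G \<subseteq> H \<or> H \<subseteq> G" if "G \<in> C" "H \<in> C" for G H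
        using C that by (auto simp: subset.chain_def)
      have "subspace (\<Union>C)"
      proof (rule subspaceI)
        obtain G where "G \<in> C" using False by blast
        then show "0 \<in> \<Union>C" using CP[of G] by (auto simp: P_def subspace_def)
      next
        fix x y assume "x \<in> \<Union>C" "y \<in> \<Union>C"
        then obtain G H where "x \<in> G" "y \<in> H" "G \<in> C" "H \<in> C" by blast
        then obtain K where "K \<in> C" "x \<in> K" "y \<in> K" using tot[of G H] by blast
        then show "x + y \<in> \<Union>C" using CP[of K] by (auto simp: P_def subspace_def)
      next
        fix c x assume "x \<in> \<Union>C"
        then show "c *\<^sub>R x \<in> \<Union>C" using CP by (fastforce simp: P_def subspace_def)
      qed
      then have "\<Union>C \<in> P" using False CP by (fastforce simp: P_def)
      then show ?thesis by blast
    qed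
  qed
  then obtain M where M: "M \<in> P" and maximal: "\<And>X. X \<in> P \<Longrightarrow> M \<subseteq> X \<Longrightarrow> X = M" by blast
  have sub: "subspace M" and G0M: "G0 \<subseteq> M" and dom: "\<And>x r. (x, r) \<in> M \<Longrightarrow> r \<le> p x"
    using M by (auto simp: P_def)
  have ex: "\<exists>r. (x, r) \<in> M" for x
  proof -
    \<comment> \<open>Subadditivity puts every \<open>r - p (y - x)\<close> below every
      \<open>p (y + x) - r\<close>. Any number in between is an admissible value at
      \<open>x\<close>; the supremum of the former is one.\<close>
    define c where "c = (SUP (y, r)\<in>M. r - p (y - x))"
    have sep: "r - p (y - x) \<le> p (y' + x) - r'" if "(y, r) \<in> M" "(y', r') \<in> M" for y r y' r'
    proof -
      have "(y + y', r + r') \<in> M" using subspace_add[OF sub that] by simp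
      then have "r + r' \<le> p ((y - x) + (y' + x))" using dom by simp
      also have "\<dots> \<le> p (y - x) + p (y' + x)" by (rule p_add)
      finally show ?thesis by simp
    qed
    have zero: "(0, 0) \<in> M" using subspace_0[OF sub] by (simp add: zero_prod_def)
    have lower: "r - p (y - x) \<le> c" if "(y, r) \<in> M" for y r
      unfolding c_def using that sep[OF _ zero]
      by (intro cSUP_upper2[where x = "(y, r)"]) (auto simp: bdd_above_def intro!: exI[of _ "p x"])
    have upper: "c \<le> p (y + x) - r" if "(y, r) \<in> M" for y r
      unfolding c_def using zero sep[OF _ that] by (intro cSUP_least) auto
    have "span (insert (x, c) M) \<in> P"
    proof -
      have "r \<le> p z" if z: "(z, r) \<in> span (insert (x, c) M)" for z r
      proof -
        obtain t where "(z, r) - t *\<^sub>R (x, c) \<in> M"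
          using z by (auto simp: span_insert span_eq_iff[THEN iffD2, OF sub])
        then have m: "(z - t *\<^sub>R x, r - t * c) \<in> M" by simp
        show ?thesis
        proof (cases t "0 :: real" rule: linorder_cases)
          case equal
          then show ?thesis using dom[OF m] by simp
        next
          case greater
          have "(inverse t *\<^sub>R (z - t *\<^sub>R x), inverse t * (r - t * c)) \<in> M"
            using subspace_scale[OF sub m, of "inverse t"] by simp
          from upper[OF this] greater have "c \<le> p (inverse t *\<^sub>R z) - inverse t * (r - t * c)"
            by (simp add: scaleR_diff_right)
          then show ?thesis using greater p_scale[of "inverse t" z] by (simp add: field_simps)
        next
          case less
          define s where "s = - t"
          have s: "s > 0" "t = - s" using less by (auto simp: s_def)
          have "(inverse s *\<^sub>R (z - t *\<^sub>R x), inverse s * (r - t * c)) \<in> M"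
            using subspace_scale[OF sub m, of "inverse s"] by simp
          from lower[OF this] s have "inverse s * (r + s * c) - p (inverse s *\<^sub>R z) \<le> c"
            by (simp add: scaleR_diff_right scaleR_add_right)
          then show ?thesis using s p_scale[of "inverse s" z] by (simp add: field_simps)
        qed
      qed
      then show ?thesis
        using G0M span_superset[of "insert (x, c) M"] by (auto simp: P_def)
    qed
    from maximal[OF this] have "(x, c) \<in> M" using span_superset[of "insert (x, c) M"] by blast
    then show ?thesis by blast
  qed
  have uniq: "r = r'" if "(x, r) \<in> M" "(x, r') \<in> M" for x r r'
  proof -
    have p0: "p 0 = 0" using p_scale[of 0 0] by simp
    show ?thesis
      using dom[of 0 "r - r'"] dom[of 0 "r' - r"] subspace_diff[OF sub that] subspace_diff[OF sub that(2,1)] p0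
      by simp
  qed
  define f where "f x = (THE r. (x, r) \<in> M)" for x
  have f: "(x, f x) \<in> M" for x
    unfolding f_def using ex[of x] uniq by (metis theI)
  show ?thesis
  proof
    show "linear f"
    proof (rule linearI)
      show "f (x + y) = f x + f y" for x y
        using subspace_add[OF sub f[of x] f[of y]] f[of "x + y"] uniq by (metis add_Pair)
      show "f (r *\<^sub>R x) = r *\<^sub>R f x" for r x
        using subspace_scale[OF sub f[of x], of r] f[of "r *\<^sub>R x"] uniq by (metis scaleR_Pair)
    qed
    show "f x \<le> p x" for x using dom f by blast
    show "f x = r" if "(x, r) \<in> G0" for x r using uniq f G0M that by blast
  qed
qed

lemma infdist_add_le:
  assumes "subspace K"
  shows "infdist (x + y) K \<le> infdist x K + infdist (y::'a::real_normed_vector) K"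
proof (rule field_le_epsilon)
  fix e :: real assume "e > 0"
  have "K \<noteq> {}" using subspace_0[OF assms] by blast
  have near: "\<exists>k\<in>K. dist x k < infdist x K + e / 2" for x
  proof -
    have "bdd_below (dist x ` K)" by (rule bdd_belowI[of _ 0]) auto
    from cINF_less_iff[OF \<open>K \<noteq> {}\<close> this, of "infdist x K + e / 2"] show ?thesis
      using \<open>K \<noteq> {}\<close> \<open>e > 0\<close> by (simp add: infdist_notempty)
  qed
  obtain k l where "k \<in> K" "dist x k < infdist x K + e / 2" "l \<in> K" "dist y l < infdist y K + e / 2"
    using near by blast
  moreover have "infdist (x + y) K \<le> dist (x + y) (k + l)"
    using \<open>k \<in> K\<close> \<open>l \<in> K\<close> by (intro infdist_le subspace_add[OF assms])
  moreover have "dist (x + y) (k + l) \<le> dist x k + dist y l" by (rule dist_triangle_add)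
  ultimately show "infdist (x + y) K \<le> infdist x K + infdist y K + e" by linarith
qed

lemma infdist_scaleR:
  assumes K: "subspace K"
  shows "infdist (r *\<^sub>R x) K = \<bar>r\<bar> * infdist (x::'a::real_normed_vector) K"
proof -
  have ne: "K \<noteq> {}" using subspace_0[OF K] by blast
  have le: "infdist (r *\<^sub>R x) K \<le> \<bar>r\<bar> * infdist x K" if "r \<noteq> 0" for r x
  proof -
    have "infdist (r *\<^sub>R x) K / \<bar>r\<bar> \<le> dist x k" if "k \<in> K" for k
    proof -
      have "infdist (r *\<^sub>R x) K \<le> dist (r *\<^sub>R x) (r *\<^sub>R k)"
        using that by (intro infdist_le subspace_scale[OF K])
      also have "\<dots> = \<bar>r\<bar> * dist x k" by (simp add: dist_norm scaleR_diff_right[symmetric])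
      finally show ?thesis using \<open>r \<noteq> 0\<close> by (simp add: field_simps)
    qed
    then have "infdist (r *\<^sub>R x) K / \<bar>r\<bar> \<le> infdist x K"
      using ne by (auto simp: infdist_notempty intro!: cINF_greatest)
    then show ?thesis using \<open>r \<noteq> 0\<close> by (simp add: field_simps)
  qed
  show ?thesis
  proof (cases "r = 0")
    case True
    then show ?thesis using subspace_0[OF K] by simp
  next
    case False
    have "infdist x K \<le> \<bar>inverse r\<bar> * infdist (r *\<^sub>R x) K"
      using le[of "inverse r" "r *\<^sub>R x"] False by simp
    then have "\<bar>r\<bar> * infdist x K \<le> infdist (r *\<^sub>R x) K"
      using False by (simp add: field_simps)
    with le[OF False, of x] show ?thesis by simp
  qed
qed

text \<open>The majorant is the distance to \<open>K\<close>. A real functional below it vanishes on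
  \<open>K\<close>, where both \<open>f y\<close> and \<open>- f y\<close> are at most
  \<open>0\<close>, and it may be prescribed at \<open>x\<close> as the distance itself, which is
  positive.\<close>

lemma Hahn_Banach_functional:
  fixes K :: "'a::complex_banach_algebra set"
  assumes K: "closed K" "subspace K" "\<And>c x. x \<in> K \<Longrightarrow> c *\<^sub>C x \<in> K" and x: "x \<notin> K"
  obtains L :: "'a \<Rightarrow> complex" where "bounded_linear L" "\<And>c y. L (c *\<^sub>C y) = c * L y"
    "\<And>y. y \<in> K \<Longrightarrow> L y = 0" "L x \<noteq> 0"
proof -
  let ?p = "\<lambda>y. infdist y K"
  define G where "G = range (\<lambda>t. t *\<^sub>R (x, ?p x))"
  have "subspace G"
    unfolding G_def by (metis span_singleton subspace_span)
  moreover have "r \<le> ?p y" if "(y, r) \<in> G" for y r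
    using that by (auto simp: G_def infdist_scaleR[OF K(2)] intro!: mult_right_mono infdist_nonneg)
  ultimately obtain f where f: "linear f" "\<And>y. f y \<le> ?p y" "\<And>y r. (y, r) \<in> G \<Longrightarrow> f y = r"
    by (rule Hahn_Banach_sublinear[where p = ?p, rotated 2])
      (use infdist_add_le[OF K(2)] infdist_scaleR[OF K(2)] in auto)
  interpret f: linear f by (rule f(1))
  have p_norm: "?p y \<le> norm y" for y
    using infdist_le[OF subspace_0[OF K(2)], of y] by simp
  have f_norm: "\<bar>f y\<bar> \<le> norm y" for y
    using f(2)[of y] f(2)[of "- y"] p_norm[of y] p_norm[of "- y"] by (simp add: f.neg abs_le_iff)
  have f_K: "f y = 0" if "y \<in> K" for y
    using f(2)[of y] f(2)[of "- y"] that subspace_neg[OF K(2) that] by (simp add: f.neg)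
  have "(x, ?p x) \<in> G" unfolding G_def by (rule range_eqI[of _ _ 1]) simp
  then have "f x = ?p x" by (rule f(3))
  moreover have "?p x > 0"
    using K x in_closed_iff_infdist_zero[of K x] subspace_0[OF K(2)] infdist_nonneg[of x K]
    by (metis empty_iff order_le_less)
  ultimately have fx: "f x > 0" by simp
  \<comment> \<open>A complex linear functional is recovered from its real part \<open>f\<close> as
    \<open>f y - \<i> * f (\<i> y)\<close>.\<close>
  define L where "L y = Complex (f y) (- f (\<i> *\<^sub>C y))" for y
  have fR: "f (of_real r *\<^sub>C y) = r * f y" for r y by (simp add: scaleC_of_real f.scale)
  have L_scale: "L (c *\<^sub>C y) = c * L y" for c y
  proof -
    have c: "c = of_real (Re c) + of_real (Im c) * \<i>" by (simp add: complex_eq_iff)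
    have 1: "f (c *\<^sub>C y) = Re c * f y + Im c * f (\<i> *\<^sub>C y)"
      by (subst c) (simp only: scaleC_add_left f.add scaleC_scaleC[symmetric] fR)
    have "\<i> * c = of_real (Re c) * \<i> + of_real (- Im c)" by (simp add: complex_eq_iff)
    then have "f (\<i> *\<^sub>C c *\<^sub>C y) = f ((of_real (Re c) * \<i> + of_real (- Im c)) *\<^sub>C y)"
      by (simp only: scaleC_scaleC)
    also have "\<dots> = Re c * f (\<i> *\<^sub>C y) - Im c * f y"
      by (simp only: scaleC_add_left f.add scaleC_scaleC[symmetric] fR mult_minus_left diff_conv_add_uminus)
    finally show ?thesis using 1 by (simp add: L_def complex_eq_iff)
  qed
  show ?thesis
  proof
    show "bounded_linear L"
    proof (rule bounded_linear_intro[where K = 2])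
      show "L (y + z) = L y + L z" for y z
        by (simp add: L_def scaleC_add_right f.add complex_eq_iff)
      show "L (r *\<^sub>R y) = r *\<^sub>R L y" for r y
        using L_scale[of "of_real r" y] by (simp add: scaleC_of_real scaleR_conv_of_real)
      show "norm (L y) \<le> norm y * 2" for y
        using cmod_le[of "L y"] f_norm[of y] f_norm[of "\<i> *\<^sub>C y"] by (simp add: L_def norm_scaleC)
    qed
    show "L (c *\<^sub>C y) = c * L y" for c y by (rule L_scale)
    show "L y = 0" if "y \<in> K" for y
      using f_K[OF that] f_K[OF K(3)[OF that, of \<i>]] by (simp add: L_def complex_eq_iff)
    show "L x \<noteq> 0" using fx by (simp add: L_def complex_eq_iff)
  qed
qed

text \<open>By Baire's theorem the closure of some \<open>{x. norm (f x) \<le> n}\<close> contains a ball around \<open>0\<close>;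
  a geometric series, summable in the codomain as well, then absorbs the closure.\<close>

theorem closed_graph_theorem:
  fixes f :: "'a::banach \<Rightarrow> 'b::banach"
  assumes lin: "linear f"
    and closed: "\<And>s x y. s \<longlonglongrightarrow> x \<Longrightarrow> (\<lambda>n. f (s n)) \<longlonglongrightarrow> y \<Longrightarrow> y = f x"
  shows "bounded_linear f"
proof -
  interpret linear f by (rule lin)
  define E where "E c = {x. norm (f x) \<le> c}" for c
  have "\<exists>n::nat. interior (closure (E (real n))) \<noteq> {}"
  proof (rule ccontr)
    assume no: "\<not> ?thesis"
    define \<G> where "\<G> = range (\<lambda>n::nat. - closure (E (real n)))"
    have "Met_TC.mtopology closure_of \<Inter>\<G> = (UNIV :: 'a set)"
    proof (rule Met_TC.metric_Baire_category)
      show "Met_TC.mcomplete TYPE('a)" 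
        unfolding Met_TC.mcomplete_def by (auto simp: Cauchy_convergent_iff convergent_def)
      show "countable \<G>" by (simp add: \<G>_def)
      show "openin Met_TC.mtopology U \<and> Met_TC.mtopology closure_of U = UNIV" if "U \<in> \<G>" for U
        using that no by (auto simp: \<G>_def closure_complement)
    qed
    then have "closure (\<Inter>\<G>) = UNIV" by simp
    then obtain x where "x \<in> \<Inter>\<G>" by (metis UNIV_not_empty closure_empty ex_in_conv)
    moreover obtain n where "norm (f x) \<le> real n" using real_arch_simple by blast
    then have "x \<in> closure (E (real n))" using closure_subset[of "E (real n)"] by (auto simp: E_def)
    ultimately show False by (auto simp: \<G>_def)
  qed
  then obtain n :: nat and x0 r where r: "r > 0" "cball x0 r \<subseteq> closure (E (real n))"
    by (metis ex_in_conv mem_interior_cball)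
  \<comment> \<open>The summand \<open>1\<close> keeps \<open>C\<close> positive when
    \<open>n = 0\<close>.\<close>
  define C where "C = 2 * real n / r + 1"
  have "C > 0" using r by (simp add: C_def add_nonneg_pos)
  have approx: "\<exists>z. norm (x - z) \<le> norm x / 2 \<and> norm (f z) \<le> C * norm x" for x
  proof (cases "x = 0")
    case True
    then show ?thesis by (auto intro!: exI[of _ 0] simp: zero)
  next
    case False
    \<comment> \<open>Scaled to length \<open>r\<close>, the vector leads from the centre to another
      point of the ball. Both points are approximated from \<open>E n\<close>, and subtraction
      removes the unknown centre.\<close>
    define h where "h = (r / norm x) *\<^sub>R x"
    have "x0 + h \<in> cball x0 r" "x0 \<in> cball x0 r" using r False by (auto simp: h_def dist_norm)
    then have "x0 + h \<in> closure (E (real n))" "x0 \<in> closure (E (real n))" using r(2) by blast+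
    then obtain u v where u: "u \<in> E (real n)" "dist u (x0 + h) < r / 4" and v: "v \<in> E (real n)" "dist v x0 < r / 4"
      using r(1) unfolding closure_approachable by (meson divide_pos_pos zero_less_numeral)
    define z where "z = (norm x / r) *\<^sub>R (u - v)"
    have "norm (h - (u - v)) \<le> norm (u - (x0 + h)) + norm (v - x0)"
      using norm_triangle_ineq4[of "v - x0" "u - (x0 + h)"] by (simp add: algebra_simps)
    also have "\<dots> \<le> r / 2" using u v by (simp add: dist_norm)
    finally have "norm ((norm x / r) *\<^sub>R (h - (u - v))) \<le> (norm x / r) * (r / 2)"
      using r by (simp only: norm_scaleR) (intro mult_mono, auto)
    moreover have "(norm x / r) *\<^sub>R (h - (u - v)) = x - z"
      using r False by (simp add: z_def h_def scaleR_diff_right)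
    ultimately have "norm (x - z) \<le> norm x / 2" using r by simp
    moreover have "norm (f z) \<le> C * norm x"
    proof -
      have "norm (f z) = norm x / r * norm (f u - f v)"
        using r by (simp add: z_def scale diff)
      also have "\<dots> \<le> norm x / r * (2 * real n)"
        using u v r norm_triangle_ineq4[of "f u" "f v"] by (intro mult_left_mono) (auto simp: E_def)
      also have "\<dots> \<le> C * norm x" using r by (simp add: C_def field_simps)
      finally show ?thesis .
    qed
    ultimately show ?thesis by blast
  qed
  then obtain g where g: "\<And>x. norm (x - g x) \<le> norm x / 2" "\<And>x. norm (f (g x)) \<le> C * norm x"
    by metis
  show ?thesis
  proof (rule bounded_linear_intro[where K = "2 * C"])
    show "f (x + y) = f x + f y" "f (c *\<^sub>R x) = c *\<^sub>R f x" for x y c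
      by (simp_all add: add scale)
    fix x
    \<comment> \<open>\<open>e k\<close> is the remainder of \<open>x\<close> after \<open>k\<close>
      corrections, so the partial sums of \<open>g (e k)\<close> telescope to
      \<open>x - e m\<close>.\<close>
    define e where "e k = ((\<lambda>x. x - g x) ^^ k) x" for k
    have e_Suc: "e (Suc k) = e k - g (e k)" for k by (simp add: e_def)
    have e_norm: "norm (e k) \<le> norm x * (1/2) ^ k" for k
    proof (induction k)
      case (Suc k)
      then show ?case using g(1)[of "e k"] by (simp add: e_Suc)
    qed (simp add: e_def)
    have "e \<longlonglongrightarrow> 0"
      by (rule Lim_null_comparison[OF _ tendsto_mult_right_zero[OF LIMSEQ_power_zero]])
        (use e_norm in \<open>auto intro!: always_eventually\<close>)
    have part: "(\<Sum>k<m. g (e k)) = x - e m" for m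
      by (induction m) (simp_all add: e_Suc, simp add: e_def)
    have f_le: "norm (f (g (e k))) \<le> C * norm x * (1/2) ^ k" for k
      using order_trans[OF g(2)[of "e k"] mult_left_mono[OF e_norm[of k] less_imp_le[OF \<open>C > 0\<close>]]]
      by (simp only: mult.assoc)
    have geo: "(\<lambda>k. C * norm x * (1/2) ^ k) sums (C * norm x * 2)"
      using sums_mult[OF geometric_sums[of "1/2 :: real"], of "C * norm x"] by simp
    have "summable (\<lambda>k. norm (f (g (e k))))"
      using f_le by (intro summable_comparison_test'[OF sums_summable[OF geo]]) simp
    then have summ: "summable (\<lambda>k. f (g (e k)))" by (rule summable_norm_cancel)
    have "(\<lambda>m. x - e m) \<longlonglongrightarrow> x - 0" by (intro tendsto_intros \<open>e \<longlonglongrightarrow> 0\<close>)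
    moreover have "(\<lambda>m. f (x - e m)) \<longlonglongrightarrow> (\<Sum>k. f (g (e k)))"
      using summable_LIMSEQ[OF summ] by (simp add: part[symmetric] sum)
    ultimately have "f x = (\<Sum>k. f (g (e k)))" using closed by fastforce
    also have "norm \<dots> \<le> (\<Sum>k. norm (f (g (e k))))"
      by (rule summable_norm[OF \<open>summable (\<lambda>k. norm (f (g (e k))))\<close>])
    also have "\<dots> \<le> (\<Sum>k. C * norm x * (1/2) ^ k)"
      by (rule suminf_le[OF f_le \<open>summable (\<lambda>k. norm (f (g (e k))))\<close> sums_summable[OF geo]])
    also have "\<dots> = norm x * (2 * C)" unfolding sums_unique[OF geo, symmetric] by simp
    finally show "norm (f x) \<le> norm x * (2 * C)" .
  qed
qed

subsection \<open>Quasimultipliers\<close>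

lemma closure_csubalgebra:
  fixes X :: "'a::complex_banach_algebra set"
  assumes "csubalgebra X"
  shows "csubalgebra (closure X)"
  unfolding csubalgebra_def
proof (intro conjI ballI allI)
  show "0 \<in> closure X" using csubalgebraD(1)[OF assms] closure_subset by blast
next
  fix x y assume "x \<in> closure X" "y \<in> closure X"
  then obtain s t where st: "\<forall>n. s n \<in> X" "s \<longlonglongrightarrow> x" "\<forall>n. t n \<in> X" "t \<longlonglongrightarrow> y"
    unfolding closure_sequential by blast
  show "x + y \<in> closure X"
    using st csubalgebraD(2)[OF assms] tendsto_add[OF st(2,4)] unfolding closure_sequential
    by (intro exI[of _ "\<lambda>n. s n + t n"]) simp
  show "x * y \<in> closure X"
    using st csubalgebraD(3)[OF assms] tendsto_mult[OF st(2,4)] unfolding closure_sequential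
    by (intro exI[of _ "\<lambda>n. s n * t n"]) simp
next
  fix c x assume "x \<in> closure X"
  then obtain s where s: "\<forall>n. s n \<in> X" "s \<longlonglongrightarrow> x"
    unfolding closure_sequential by blast
  then show "c *\<^sub>C x \<in> closure X"
    using csubalgebraD(4)[OF assms] tendsto_scaleC[OF tendsto_const s(2)] unfolding closure_sequential
    by (intro exI[of _ "\<lambda>n. c *\<^sub>C s n"]) simp
qed

lemma span_csubalgebra:
  fixes S :: "'a::complex_banach_algebra set"
  assumes S: "\<And>x y. x \<in> S \<Longrightarrow> y \<in> S \<Longrightarrow> x * y \<in> S"
  shows "csubalgebra (scaleC.span S)"
proof -
  have 1: "x * y \<in> scaleC.span S" if "x \<in> S" "y \<in> scaleC.span S" for x y
    using that(2)
  proof (induction rule: scaleC.span_induct)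
    case base
    show ?case
      by (auto simp: scaleC.subspace_def distrib_left mult_scaleC_right
          intro: scaleC.span_zero scaleC.span_add scaleC.span_scale)
  next
    case (step y)
    then show ?case using S that(1) by (blast intro: scaleC.span_base)
  qed
  have "x * y \<in> scaleC.span S" if "x \<in> scaleC.span S" "y \<in> scaleC.span S" for x y
    using that(1)
  proof (induction rule: scaleC.span_induct)
    case base
    show ?case
      by (auto simp: scaleC.subspace_def distrib_right mult_scaleC_left
          intro: scaleC.span_zero scaleC.span_add scaleC.span_scale)
  next
    case (step x)
    then show ?case using 1 that(2) by blast
  qed
  then show ?thesis
    by (auto simp: csubalgebra_def intro: scaleC.span_zero scaleC.span_add scaleC.span_scale)
qed

section \<open>Characters of closed subalgebras\<close>

text \<open>If the value exceeded the norm, \<open>y = x / \<phi> x\<close> would have norm below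
  \<open>1\<close> and value \<open>1\<close>, and the Neumann solution of
  \<open>z = y + y * z\<close> would give \<open>\<phi> z = 1 + \<phi> z\<close>.\<close>

lemma character_norm_le:
  assumes J: "csubalgebra J" "closed J" and \<phi>: "character J \<phi>" and x: "x \<in> J"
  shows "cmod (\<phi> x) \<le> norm x"
proof (rule ccontr)
  assume "\<not> ?thesis"
  then have *: "norm x < cmod (\<phi> x)" by simp
  define y where "y = inverse (\<phi> x) *\<^sub>C x"
  have "\<phi> x \<noteq> 0" using * by force
  have y: "y \<in> J" using x by (simp add: y_def csubalgebraD[OF J(1)])
  have "norm y = inverse (cmod (\<phi> x)) * norm x" unfolding y_def by (simp only: norm_scaleC norm_inverse)
  then have "norm y < 1"
    using * \<open>\<phi> x \<noteq> 0\<close> by (simp add: divide_inverse[symmetric] mult.commute)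
  obtain z where z: "z \<in> J" "z = y + y * z" by (rule Neumann_solution[OF J y y \<open>norm y < 1\<close>])
  have "\<phi> y = 1"
    using \<phi> x \<open>\<phi> x \<noteq> 0\<close> by (simp add: y_def character_def)
  moreover have "\<phi> z = \<phi> y + \<phi> y * \<phi> z"
    using \<phi> y z(1) csubalgebraD(3)[OF J(1) y z(1)] by (subst z(2)) (simp add: character_def)
  ultimately show False by simp
qed

lemma character_mult: "character J \<phi> \<Longrightarrow> x \<in> J \<Longrightarrow> y \<in> J \<Longrightarrow> \<phi> (x * y) = \<phi> x * \<phi> y"
  by (simp add: character_def)

lemma character_diff:
  assumes "csubalgebra J" "character J \<phi>" "x \<in> J" "y \<in> J"
  shows "\<phi> (x - y) = \<phi> x - \<phi> y"
proof -
  have "\<phi> x = \<phi> ((x - y) + y)" by simp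
  also have "\<dots> = \<phi> (x - y) + \<phi> y"
    using assms csubalgebraD(7)[OF assms(1,3,4)] unfolding character_def by blast
  finally show ?thesis by simp
qed

lemma character_tendsto:
  assumes J: "csubalgebra J" "closed J" and \<phi>: "character J \<phi>"
    and s: "(s \<longlongrightarrow> x) F" "eventually (\<lambda>i. s i \<in> J) F" "x \<in> J"
  shows "((\<lambda>i. \<phi> (s i)) \<longlongrightarrow> \<phi> x) F"
proof (rule Lim_null[THEN iffD2], rule Lim_null_comparison)
  show "((\<lambda>i. norm (s i - x)) \<longlongrightarrow> 0) F"
    using s(1) by (simp add: LIM_zero tendsto_norm_zero)
  show "\<forall>\<^sub>F i in F. norm (\<phi> (s i) - \<phi> x) \<le> norm (s i - x)"
    using s(2) character_norm_le[OF J \<phi> csubalgebraD(7)[OF J(1) _ s(3)]] character_diff[OF J(1) \<phi> _ s(3)]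
    by (auto elim!: eventually_mono)
qed

section \<open>Calculus of fractions\<close>

text \<open>Used three times, for A, for B and for the semigroup algebra inside M(A), so that
  fractions are handled once for all.\<close>

locale qm_algebra =
  fixes J :: "'a::complex_banach_algebra set"
  assumes csub: "csubalgebra J"
    and comm: "\<And>x y. x \<in> J \<Longrightarrow> y \<in> J \<Longrightarrow> x * y = y * x"
    and cancel: "weakly_cancellative J"
begin

lemmas J_intros [intro, simp] = csubalgebraD[OF csub]

lemma Omega_dense: "v \<in> Omega J \<Longrightarrow> J \<subseteq> closure ((*) v ` J)"
  by (simp add: Omega_def)

lemma Omega_in [simp]: "v \<in> Omega J \<Longrightarrow> v \<in> J"
  by (simp add: Omega_def)

lemma left_comm: "x \<in> J \<Longrightarrow> y \<in> J \<Longrightarrow> z \<in> J \<Longrightarrow> x * (y * z) = y * (x * z)"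
  by (metis comm mult.assoc)

lemma mult4:
  assumes "p \<in> J" "q \<in> J" "r \<in> J" "s \<in> J"
  shows "p * q * (r * s) = p * r * (q * s)" "p * q * (r * s) = p * s * (r * q)"
proof -
  show "p * q * (r * s) = p * r * (q * s)"
    using left_comm[of q r s] assms by (simp add: mult.assoc)
  show "p * q * (r * s) = p * s * (r * q)"
    using left_comm[of q s r] comm[of r s] comm[of r q] assms by (simp add: mult.assoc)
qed

text \<open>The closed annihilator of \<open>x\<close> contains all multiples of \<open>v\<close>,
  which are dense, hence all of \<open>J\<close>; weak cancellation does the rest.\<close>

lemma Omega_mult_eq_0:
  assumes v: "v \<in> Omega J" and x: "x \<in> J" "v * x = 0"
  shows "x = 0"
proof (rule ccontr)
  assume "x \<noteq> 0"
  then have "(*) x ` J \<noteq> {0}" using cancel x(1) by (auto simp: weakly_cancellative_def)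
  moreover have "0 \<in> (*) x ` J" by (auto intro!: image_eqI[of _ _ 0])
  ultimately obtain y where y: "y \<in> J" "x * y \<noteq> 0" by blast
  have "closed {z. x * z = 0}" by (intro closed_Collect_eq continuous_intros)
  moreover have "x * (v * z) = 0" if "z \<in> J" for z
    using comm[OF x(1) Omega_in[OF v]] x(2) by (simp add: mult.assoc[symmetric])
  then have "(*) v ` J \<subseteq> {z. x * z = 0}" by blast
  ultimately have "closure ((*) v ` J) \<subseteq> {z. x * z = 0}" by (simp add: closure_minimal)
  then show False using Omega_dense[OF v] y by blast
qed

lemma Omega_cancel:
  assumes "v \<in> Omega J" "x \<in> J" "y \<in> J" "v * x = v * y"
  shows "x = y"
  using Omega_mult_eq_0[OF assms(1), of "x - y"] assms by (simp add: right_diff_distrib)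

lemma Omega_mult [simp, intro]:
  assumes v: "v \<in> Omega J" and w: "w \<in> Omega J"
  shows "v * w \<in> Omega J"
proof -
  have "(*) v ` J \<subseteq> (*) v ` closure ((*) w ` J)" by (rule image_mono[OF Omega_dense[OF w]])
  also have "\<dots> \<subseteq> closure ((*) v ` (*) w ` J)"
    by (intro image_closure_subset continuous_intros closure_subset closed_closure)
  also have "(*) v ` (*) w ` J = (*) (v * w) ` J"
    by (simp add: image_image mult.assoc)
  finally have "closure ((*) v ` J) \<subseteq> closure ((*) (v * w) ` J)" by (simp add: closure_minimal)
  with Omega_dense[OF v] show ?thesis
    using J_intros(3)[OF Omega_in[OF v] Omega_in[OF w]] unfolding Omega_def by blast
qed

text \<open>The pair \<open>(v, u)\<close> lies in the graph of \<open>u / v\<close> because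
  \<open>v * u = u * v\<close>; testing it in the other graph yields the cross products. Conversely
  a factor \<open>v\<close> is cancelled. This criterion is what makes the definite descriptions of
  sum, product and scalar multiple computable.\<close>

lemma qm_quot_eq_iff:
  assumes "u \<in> J" "v \<in> Omega J" "u' \<in> J" "v' \<in> Omega J"
  shows "qm_quot J u v = qm_quot J u' v' \<longleftrightarrow> u * v' = u' * v"
proof
  assume "qm_quot J u v = qm_quot J u' v'"
  moreover have "(v, u) \<in> qm_quot J u v"
    using assms comm[of u v] by (simp add: qm_quot_def)
  ultimately have "v' * u = u' * v" by (auto simp: qm_quot_def)
  then show "u * v' = u' * v" using comm[of u v'] assms by simp
next
  have *: "v' * y = u' * x"
    if "u \<in> J" "v \<in> Omega J" "u' \<in> J" "v' \<in> Omega J" "u * v' = u' * v" "x \<in> J" "y \<in> J" "v * y = u * x"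
    for u v u' v' x y
  proof (rule Omega_cancel[of v])
    have "v * (v' * y) = v' * (v * y)" using left_comm[of v v' y] that by simp
    also have "\<dots> = (v' * u) * x" using that by (simp add: mult.assoc)
    also have "v' * u = v * u'" using comm[of v' u] comm[of v u'] that by simp
    finally show "v * (v' * y) = v * (u' * x)" by (simp add: mult.assoc)
  qed (use that in auto)
  assume "u * v' = u' * v"
  with *[OF assms this] *[OF assms(3,4,1,2) this[symmetric]]
  show "qm_quot J u v = qm_quot J u' v'"
    by (auto simp: qm_quot_def)
qed

lemma Id_on_eq_qm_quot: "v \<in> Omega J \<Longrightarrow> Id_on J = qm_quot J v v"
  by (auto simp: qm_quot_def dest: Omega_cancel)

lemma qm_mult_quot:
  assumes "u \<in> J" "v \<in> Omega J" "u' \<in> J" "v' \<in> Omega J"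
  shows "qm_mult J (qm_quot J u v) (qm_quot J u' v') = qm_quot J (u * u') (v * v')"
  unfolding qm_mult_def
proof (rule the_equality)
  show "\<exists>ua\<in>J. \<exists>va\<in>Omega J. \<exists>u''\<in>J. \<exists>v''\<in>Omega J. qm_quot J u v = qm_quot J ua va \<and>
      qm_quot J u' v' = qm_quot J u'' v'' \<and> qm_quot J (u * u') (v * v') = qm_quot J (ua * u'') (va * v'')"
    using assms by blast
next
  fix Q assume "\<exists>ua\<in>J. \<exists>va\<in>Omega J. \<exists>u''\<in>J. \<exists>v''\<in>Omega J. qm_quot J u v = qm_quot J ua va \<and>
      qm_quot J u' v' = qm_quot J u'' v'' \<and> Q = qm_quot J (ua * u'') (va * v'')"
  then obtain p q p' q' where *: "p \<in> J" "q \<in> Omega J" "p' \<in> J" "q' \<in> Omega J"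
    "u * q = p * v" "u' * q' = p' * v'" "Q = qm_quot J (p * p') (q * q')"
    using assms by (auto simp: qm_quot_eq_iff)
  have "p * p' * (v * v') = p * v * (p' * v')" using * assms by (simp add: mult4(1))
  also have "\<dots> = u * q * (u' * q')" using * by simp
  also have "\<dots> = u * u' * (q * q')" using * assms by (simp add: mult4(1))
  finally show "Q = qm_quot J (u * u') (v * v')" using * assms by (subst *(7), subst qm_quot_eq_iff) auto
qed

lemma qm_add_quot:
  assumes "u \<in> J" "v \<in> Omega J" "u' \<in> J" "v' \<in> Omega J"
  shows "qm_add J (qm_quot J u v) (qm_quot J u' v') = qm_quot J (u * v' + u' * v) (v * v')"
  unfolding qm_add_def
proof (rule the_equality)
  show "\<exists>ua\<in>J. \<exists>va\<in>Omega J. \<exists>u''\<in>J. \<exists>v''\<in>Omega J. qm_quot J u v = qm_quot J ua va \<and>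
      qm_quot J u' v' = qm_quot J u'' v'' \<and> qm_quot J (u * v' + u' * v) (v * v') = qm_quot J (ua * v'' + u'' * va) (va * v'')"
    using assms by blast
next
  fix Q assume "\<exists>ua\<in>J. \<exists>va\<in>Omega J. \<exists>u''\<in>J. \<exists>v''\<in>Omega J. qm_quot J u v = qm_quot J ua va \<and>
      qm_quot J u' v' = qm_quot J u'' v'' \<and> Q = qm_quot J (ua * v'' + u'' * va) (va * v'')"
  then obtain p q p' q' where *: "p \<in> J" "q \<in> Omega J" "p' \<in> J" "q' \<in> Omega J"
    "u * q = p * v" "u' * q' = p' * v'" "Q = qm_quot J (p * q' + p' * q) (q * q')"
    using assms by (auto simp: qm_quot_eq_iff)
  have "p * q' * (v * v') = p * v * (q' * v')" using * assms by (simp add: mult4(1))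
  also have "\<dots> = u * q * (q' * v')" using * by simp
  also have "\<dots> = u * v' * (q' * q)" using * assms by (simp add: mult4(2))
  also have "\<dots> = u * v' * (q * q')" using * comm[of q q'] by simp
  finally have 1: "p * q' * (v * v') = u * v' * (q * q')" .
  have "p' * q * (v * v') = p' * v' * (v * q)" using * assms by (simp add: mult4(2))
  also have "\<dots> = u' * q' * (v * q)" using * by simp
  also have "\<dots> = u' * v * (q' * q)" using * assms by (simp add: mult4(1))
  also have "\<dots> = u' * v * (q * q')" using * comm[of q q'] by simp
  finally have "(p * q' + p' * q) * (v * v') = (u * v' + u' * v) * (q * q')"
    using 1 by (simp add: distrib_right)
  then show "Q = qm_quot J (u * v' + u' * v) (v * v')" using * assms by (subst *(7), subst qm_quot_eq_iff) auto
qed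

lemma qm_scale_quot:
  assumes "u \<in> J" "v \<in> Omega J"
  shows "qm_scale J c (qm_quot J u v) = qm_quot J (c *\<^sub>C u) v"
  unfolding qm_scale_def
proof (rule the_equality)
  show "\<exists>ua\<in>J. \<exists>va\<in>Omega J. qm_quot J u v = qm_quot J ua va \<and> qm_quot J (c *\<^sub>C u) v = qm_quot J (c *\<^sub>C ua) va"
    using assms by blast
next
  fix Q assume "\<exists>ua\<in>J. \<exists>va\<in>Omega J. qm_quot J u v = qm_quot J ua va \<and> Q = qm_quot J (c *\<^sub>C ua) va"
  then obtain p q where *: "p \<in> J" "q \<in> Omega J" "u * q = p * v" "Q = qm_quot J (c *\<^sub>C p) q"
    using assms by (auto simp: qm_quot_eq_iff)
  then show "Q = qm_quot J (c *\<^sub>C u) v"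
    using assms by (simp add: qm_quot_eq_iff mult_scaleC_left)
qed

lemma qm_quot_in_QM: "u \<in> J \<Longrightarrow> v \<in> Omega J \<Longrightarrow> qm_quot J u v \<in> QM J"
  by (auto simp: QM_def)

text \<open>A character with \<open>\<phi> v = 0\<close> vanishes on all multiples of
  \<open>v\<close>, and by continuity on \<open>J\<close>.\<close>

lemma character_Omega_nonzero:
  assumes cl: "closed J" and \<phi>: "character J \<phi>" and v: "v \<in> Omega J"
  shows "\<phi> v \<noteq> 0"
proof
  assume 0: "\<phi> v = 0"
  obtain x where x: "x \<in> J" "\<phi> x \<noteq> 0" using \<phi> by (auto simp: character_def)
  then have "x \<in> closure ((*) v ` J)" using Omega_dense[OF v] by blast
  then obtain s where s: "\<And>n. s n \<in> (*) v ` J" "s \<longlonglongrightarrow> x" unfolding closure_sequential by blast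
  have sJ: "s n \<in> J" and s0: "\<phi> (s n) = 0" for n
    using s(1)[of n] v 0 \<phi> by (auto simp: character_def)
  show False
    using character_tendsto[OF csub cl \<phi> s(2) always_eventually x(1)] sJ x(2) by (simp add: s0 LIMSEQ_const_iff)
qed

lemma character_ext_quot:
  assumes cl: "closed J" and \<phi>: "character J \<phi>" and "u \<in> J" "v \<in> Omega J"
  shows "character_ext J \<phi> (qm_quot J u v) = \<phi> u / \<phi> v"
  unfolding character_ext_def
proof (rule the_equality)
  show "\<exists>ua\<in>J. \<exists>va\<in>Omega J. qm_quot J u v = qm_quot J ua va \<and> \<phi> u / \<phi> v = \<phi> ua / \<phi> va"
    using assms by blast
next
  fix c assume "\<exists>ua\<in>J. \<exists>va\<in>Omega J. qm_quot J u v = qm_quot J ua va \<and> c = \<phi> ua / \<phi> va"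
  then obtain p q where *: "p \<in> J" "q \<in> Omega J" "u * q = p * v" "c = \<phi> p / \<phi> q"
    using assms by (auto simp: qm_quot_eq_iff)
  have "\<phi> u * \<phi> q = \<phi> p * \<phi> v"
    using *(1-3) assms(3,4) by (metis character_mult[OF \<phi>] Omega_in)
  then show "c = \<phi> u / \<phi> v"
    using character_Omega_nonzero[OF cl \<phi>] * assms by (simp add: frac_eq_eq)
qed

end

subsection \<open>Holomorphic semigroups and their Arveson spectrum\<close>

locale hol_semigroup =
  fixes a b :: real and T :: "complex \<Rightarrow> 'a::complex_banach_algebra"
  assumes ab: "a < b" "b \<le> a + pi" and hol: "holomorphic_semigroup a b T"
begin

abbreviation "S \<equiv> sector a b"
abbreviation "T' \<equiv> cderiv T"
abbreviation "J \<equiv> semigroup_algebra a b T"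

lemma open_S: "open S"
  using hol by (simp add: holomorphic_semigroup_def vholomorphic_on_def)

lemma S_add [simp, intro]: "z \<in> S \<Longrightarrow> w \<in> S \<Longrightarrow> z + w \<in> S"
  by (rule sector_add[OF ab])

lemma T_add: "z \<in> S \<Longrightarrow> w \<in> S \<Longrightarrow> T (z + w) = T z * T w"
  using hol by (simp add: holomorphic_semigroup_def)

lemma T_deriv: "z \<in> S \<Longrightarrow> has_cderiv T (T' z) z"
  using hol cderiv_eq by (fastforce simp: holomorphic_semigroup_def vholomorphic_on_def)

lemma isCont_T: "z \<in> S \<Longrightarrow> isCont T z"
  by (rule has_cderiv_isCont[OF T_deriv])

text \<open>With the roles of \<open>z\<close> and \<open>w\<close> exchanged it gives
  \<open>T' z * T w = T' w * T z\<close>, the reason why the fraction defining the generator does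
  not depend on the point.\<close>

lemma T'_add:
  assumes z: "z \<in> S" and w: "w \<in> S"
  shows "T' (z + w) = T' z * T w"
proof -
  have "has_cderiv (\<lambda>z. T (z + w)) (T' (z + w)) z"
    by (rule has_cderiv_shift[OF T_deriv]) (use z w in simp)
  moreover have "has_cderiv (\<lambda>z. T z * T w) (T' z * T w) z"
    by (rule has_cderiv_linear[OF T_deriv[OF z] bounded_linear_mult_left mult_scaleC_left])
  then have "has_cderiv (\<lambda>z. T (z + w)) (T' z * T w) z"
    by (rule has_cderiv_transform_open[OF _ open_S z]) (simp add: T_add w)
  ultimately show ?thesis by (rule has_cderiv_unique)
qed

lemma J_closed: "closed J"
  by (simp add: semigroup_algebra_def)

lemma J_csubalgebra: "csubalgebra J"
  unfolding semigroup_algebra_def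
  by (intro closure_csubalgebra span_csubalgebra) (auto simp flip: T_add)

lemma T_in_J [simp, intro]: "z \<in> S \<Longrightarrow> T z \<in> J"
  unfolding semigroup_algebra_def using scaleC.span_base[of "T z" "T ` S"] closure_subset by blast

lemma eventually_S:
  assumes "z \<in> S"
  shows "eventually (\<lambda>h. z + h \<in> S) (at 0)"
proof -
  have "open ((\<lambda>h. z + h) -` S)" by (intro open_vimage open_S continuous_intros)
  from eventually_at_in_open'[OF this, of 0] assms show ?thesis by simp
qed

lemma quotient_in_J:
  assumes "z \<in> S"
  shows "eventually (\<lambda>h. inverse h *\<^sub>C (T (z + h) - T z) \<in> J) (at 0)"
  using eventually_S[OF assms] assms by (auto elim!: eventually_mono simp: csubalgebraD[OF J_csubalgebra])

lemma T'_in_J [simp, intro]: "z \<in> S \<Longrightarrow> T' z \<in> J"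
  by (rule Lim_in_closed_set[OF J_closed quotient_in_J _ has_cderiv_limit[OF T_deriv]]) auto

lemma J_induct [consumes 1, case_names closed T zero add scale]:
  assumes x: "x \<in> J" and closed: "closed {x. P x}"
    and T: "\<And>z. z \<in> S \<Longrightarrow> P (T z)" and "P 0" "\<And>x y. P x \<Longrightarrow> P y \<Longrightarrow> P (x + y)"
    "\<And>c x. P x \<Longrightarrow> P (c *\<^sub>C x)"
  shows "P x"
proof -
  have "P y" if "y \<in> scaleC.span (T ` S)" for y
    using that by (induction rule: scaleC.span_induct) (auto simp: scaleC.subspace_def assms)
  then have "J \<subseteq> {x. P x}"
    unfolding semigroup_algebra_def by (intro closure_minimal closed) blast
  then show ?thesis using x by blast
qed

lemma J_comm:
  assumes "x \<in> J" "y \<in> J"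
  shows "x * y = y * x"
proof -
  have 1: "x * T z = T z * x" if "x \<in> J" "z \<in> S" for x z
    using that(1)
  proof (induction rule: J_induct)
    case closed
    show ?case by (intro closed_Collect_eq continuous_intros)
  next
    case (T w)
    then show ?case using that(2) by (metis T_add add.commute)
  qed (auto simp: distrib_left distrib_right mult_scaleC_left mult_scaleC_right)
  show ?thesis
    using assms(2)
  proof (induction rule: J_induct)
    case closed
    show ?case by (intro closed_Collect_eq continuous_intros)
  next
    case (T w)
    then show ?case using 1 assms(1) by blast
  qed (auto simp: distrib_left distrib_right mult_scaleC_left mult_scaleC_right)
qed

text \<open>If \<open>T w\<close> were not in the closure \<open>K\<close> of \<open>T z J\<close>, a functional separating it from \<open>K\<close> would
  give a nonzero holomorphic function on the sector vanishing on \<open>z + S\<close>.\<close>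

lemma T_in_Omega:
  assumes z: "z \<in> S"
  shows "T z \<in> Omega J"
proof -
  define K where "K = closure ((*) (T z) ` J)"
  note alg = csubalgebraD[OF J_csubalgebra]
  have add_K: "x + y \<in> K" if xy: "x \<in> K" "y \<in> K" for x y
  proof -
    obtain s t where st: "\<forall>n. s n \<in> (*) (T z) ` J" "s \<longlonglongrightarrow> x" "\<forall>n. t n \<in> (*) (T z) ` J" "t \<longlonglongrightarrow> y"
      using xy unfolding K_def closure_sequential by blast
    have "s n + t n \<in> (*) (T z) ` J" for n
    proof -
      obtain p q where "p \<in> J" "q \<in> J" "s n = T z * p" "t n = T z * q"
        using st(1,3) by (metis imageE)
      then show ?thesis using alg(2)[of p q] by (auto simp flip: distrib_left)
    qed
    then show ?thesis using tendsto_add[OF st(2,4)] unfolding K_def closure_sequential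
      by (intro exI[of _ "\<lambda>n. s n + t n"]) simp
  qed
  have scale_K: "c *\<^sub>C x \<in> K" if x: "x \<in> K" for c x
  proof -
    obtain s where s: "\<forall>n. s n \<in> (*) (T z) ` J" "s \<longlonglongrightarrow> x"
      using x unfolding K_def closure_sequential by blast
    have "c *\<^sub>C s n \<in> (*) (T z) ` J" for n
    proof -
      obtain p where "p \<in> J" "s n = T z * p" using s(1) by (metis imageE)
      then show ?thesis using alg(4)[of p] by (auto simp flip: mult_scaleC_right)
    qed
    then show ?thesis
      using tendsto_scaleC[OF tendsto_const s(2)] unfolding K_def closure_sequential
      by (intro exI[of _ "\<lambda>n. c *\<^sub>C s n"]) simp
  qed
  have mem_K: "T z * x \<in> K" if "x \<in> J" for x
    unfolding K_def using that by (intro subsetD[OF closure_subset] imageI)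
  have zero_K: "0 \<in> K" using mem_K[OF alg(1)] by simp
  have TK: "T w \<in> K" if w: "w \<in> S" for w
  proof (rule ccontr)
    assume "T w \<notin> K"
    have "subspace K"
      using zero_K add_K scale_K by (auto simp: subspace_def simp flip: scaleC_of_real)
    have "closed K" by (simp add: K_def)
    obtain L where L: "bounded_linear L" "\<And>c y. L (c *\<^sub>C y) = c * L y"
      "\<And>y. y \<in> K \<Longrightarrow> L y = 0" "L (T w) \<noteq> 0"
      by (rule Hahn_Banach_functional[OF \<open>closed K\<close> \<open>subspace K\<close> _ \<open>T w \<notin> K\<close>]) (rule scale_K, assumption, rule that)
    have "L (T w) = 0"
    proof (rule analytic_continuation_open[of "(+) z ` S" S "\<lambda>w. L (T w)" "\<lambda>_. 0"])
      show "open ((+) z ` S)" by (rule open_translation[OF open_S])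
      show "(+) z ` S \<noteq> {}" "(+) z ` S \<subseteq> S" using z by auto
      show "connected S" by (rule convex_connected[OF sector_convex[OF ab]])
      show "(\<lambda>w. L (T w)) holomorphic_on S"
        by (subst holomorphic_on_open[OF open_S]) (use has_cderiv_functional[OF T_deriv L(1,2)] in blast)
      show "L (T u) = 0" if "u \<in> (+) z ` S" for u
        using that L(3) mem_K z by (auto simp: T_add)
    qed (use open_S w in auto)
    then show False using L(4) by simp
  qed
  have "x \<in> K" if "x \<in> J" for x
    using that
  proof (induction rule: J_induct)
    case closed
    show ?case by (simp add: K_def)
  qed (use TK zero_K add_K scale_K in auto)
  then show ?thesis using z by (auto simp: Omega_def K_def)
qed

text \<open>Pairs of a linear combination \<open>\<Sum>c T(\<zeta>)\<close> and the function \<open>\<mu> \<mapsto> \<Sum>c exp(\<mu> \<zeta>)\<close>, its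
  Gelfand transform.\<close>

inductive comb :: "'a \<Rightarrow> (complex \<Rightarrow> complex) \<Rightarrow> bool" where
  base: "z \<in> S \<Longrightarrow> comb (T z) (\<lambda>\<mu>. exp (\<mu> * z))"
| add: "comb x f \<Longrightarrow> comb y g \<Longrightarrow> comb (x + y) (\<lambda>\<mu>. f \<mu> + g \<mu>)"
| scale: "comb x f \<Longrightarrow> comb (c *\<^sub>C x) (\<lambda>\<mu>. c * f \<mu>)"

lemma comb_in_J: "comb x f \<Longrightarrow> x \<in> J"
  by (induction rule: comb.induct) (auto simp: csubalgebraD[OF J_csubalgebra])

lemma comb_continuous: "comb x f \<Longrightarrow> continuous_on UNIV f"
  by (induction rule: comb.induct) (auto intro!: continuous_intros)

lemma comb_diff:
  assumes "comb x f" "comb y g"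
  shows "comb (x - y) (\<lambda>\<mu>. f \<mu> - g \<mu>)"
  using comb.add[OF assms(1) comb.scale[OF assms(2), of "-1"]] by simp

lemma comb_mult:
  assumes "comb x f" "comb y g"
  shows "comb (x * y) (\<lambda>\<mu>. f \<mu> * g \<mu>)"
  using assms(1)
proof (induction rule: comb.induct)
  case (base z)
  show ?case
    using assms(2)
  proof (induction rule: comb.induct)
    case (base w)
    show ?case using comb.base[OF S_add[OF \<open>z \<in> S\<close> base]]
      by (simp add: T_add[OF \<open>z \<in> S\<close> base] distrib_left exp_add)
  next
    case (add x f y g)
    then show ?case using comb.add[OF add.IH] by (simp add: distrib_left)
  next
    case (scale x f c)
    then show ?case using comb.scale[OF scale.IH, of c] by (simp add: mult_scaleC_right mult_ac)
  qed
next
  case (add x f y g)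
  then show ?case using comb.add[OF add.IH] by (simp add: distrib_right)
next
  case (scale x f c)
  then show ?case using comb.scale[OF scale.IH, of c] by (simp add: mult_scaleC_left mult_ac)
qed

lemma span_comb: "x \<in> scaleC.span (T ` S) \<Longrightarrow> \<exists>f. comb x f"
proof (induction rule: scaleC.span_induct)
  case base
  obtain z where "z \<in> S" using sector_nonempty[OF ab(1)] by blast
  then have "comb (0 *\<^sub>C T z) (\<lambda>\<mu>. 0 * exp (\<mu> * z))" by (intro comb.intros)
  then show ?case by (auto simp: scaleC.subspace_def intro: comb.intros)
qed (auto intro: comb.base)

section \<open>Spectral points as contractive evaluations\<close>

text \<open>The function \<open>f\<close> belongs to a representation of \<open>x\<close> and not to
  \<open>x\<close>. Two representations give
  \<open>comb 0 (\<lambda>\<mu>. f \<mu> - g \<mu>)\<close>, and the bound by \<open>norm 0\<close>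
  forces \<open>f \<mu> = g \<mu>\<close>; contractivity thus already contains that evaluation at
  \<open>\<mu>\<close> is well defined.\<close>

definition spectral :: "complex \<Rightarrow> bool" where
  "spectral \<mu> \<longleftrightarrow> (\<forall>x f. comb x f \<longrightarrow> cmod (f \<mu>) \<le> norm x)"

lemma closed_spectral: "closed {\<mu>. spectral \<mu>}"
  unfolding spectral_def
proof (intro closed_Collect_all)
  fix x f
  show "closed {\<mu>. comb x f \<longrightarrow> cmod (f \<mu>) \<le> norm x}"
  proof (cases "comb x f")
    case True
    then show ?thesis by (auto intro!: closed_Collect_le continuous_intros comb_continuous)
  qed simp
qed

text \<open>Contractivity is applied to the difference quotients of \<open>T\<close> at
  \<open>z\<close>, whose transforms are those of the exponential, and the step size tends to
  \<open>0\<close>.\<close>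

lemma spectral_norm_le:
  assumes \<mu>: "spectral \<mu>" and z: "z \<in> S"
  shows "cmod (\<mu> * exp (\<mu> * z)) \<le> norm (T' z)"
proof (rule tendsto_le)
  have "((\<lambda>z. exp (\<mu> * z)) has_field_derivative \<mu> * exp (\<mu> * z)) (at z)"
    by (auto intro!: derivative_eq_intros)
  then show "((\<lambda>h. cmod ((exp (\<mu> * (z + h)) - exp (\<mu> * z)) / h)) \<longlongrightarrow> cmod (\<mu> * exp (\<mu> * z))) (at 0)"
    by (intro tendsto_norm) (simp add: DERIV_def)
  show "((\<lambda>h. norm (inverse h *\<^sub>C (T (z + h) - T z))) \<longlongrightarrow> norm (T' z)) (at 0)"
    by (intro tendsto_norm has_cderiv_limit T_deriv z)
  have "cmod ((exp (\<mu> * (z + h)) - exp (\<mu> * z)) / h) \<le> norm (inverse h *\<^sub>C (T (z + h) - T z))"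
    if "z + h \<in> S" for h
  proof -
    have "comb (inverse h *\<^sub>C (T (z + h) - T z)) (\<lambda>\<mu>. inverse h * (exp (\<mu> * (z + h)) - exp (\<mu> * z)))"
      by (intro comb.scale comb_diff comb.base that z)
    then have "cmod (inverse h * (exp (\<mu> * (z + h)) - exp (\<mu> * z))) \<le> norm (inverse h *\<^sub>C (T (z + h) - T z))"
      using \<mu> unfolding spectral_def by blast
    then show ?thesis by (simp only: divide_inverse mult.commute)
  qed
  then show "\<forall>\<^sub>F h in at 0. cmod ((exp (\<mu> * (z + h)) - exp (\<mu> * z)) / h) \<le> norm (inverse h *\<^sub>C (T (z + h) - T z))"
    using eventually_S[OF z] by (auto elim!: eventually_mono)
qed simp

lemma compact_spectral:
  assumes z: "z \<in> S"
  shows "compact {\<mu>. spectral \<mu> \<and> Re (\<mu> * z) \<ge> t}"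
proof -
  have "closed {\<mu>. spectral \<mu> \<and> t \<le> Re (\<mu> * z)}"
    by (intro closed_Collect_conj closed_spectral closed_Collect_le continuous_intros)
  moreover have "bounded {\<mu>. spectral \<mu> \<and> t \<le> Re (\<mu> * z)}"
  proof (rule boundedI)
    fix \<mu> assume "\<mu> \<in> {\<mu>. spectral \<mu> \<and> t \<le> Re (\<mu> * z)}"
    then have *: "spectral \<mu>" "t \<le> Re (\<mu> * z)" by auto
    have "cmod \<mu> * exp t \<le> cmod \<mu> * exp (Re (\<mu> * z))"
      by (intro mult_left_mono) (use * in auto)
    also have "\<dots> \<le> norm (T' z)" using spectral_norm_le[OF *(1) z] by (simp only: norm_mult norm_exp_eq_Re)
    finally show "norm \<mu> \<le> norm (T' z) / exp t" by (simp add: field_simps)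
  qed
  ultimately show ?thesis by (simp add: compact_eq_bounded_closed)
qed

text \<open>Evaluation at \<open>\<mu>\<close> is a contraction on combinations, so the closure of
  its graph \<open>G\<close> is again a graph, now over the whole algebra. Additivity,
  multiplicativity and homogeneity pass to the closure by sequences.\<close>

lemma spectral_character:
  assumes \<mu>: "spectral \<mu>"
  shows "\<exists>\<phi>. character J \<phi> \<and> (\<forall>z\<in>S. \<phi> (T z) = exp (\<mu> * z))"
proof -
  define G where "G = {(x, f \<mu>) | x f. comb x f}"
  have bound: "norm w \<le> norm x" if "(x, w) \<in> closure G" for x w
  proof -
    have "closure G \<subseteq> {p. norm (snd p) \<le> norm (fst p)}"
      using \<mu> by (intro closure_minimal closed_Collect_le continuous_intros) (auto simp: G_def spectral_def)
    then show ?thesis using that by auto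
  qed
  have seq: "\<exists>s t. (\<forall>n. (s n, t n) \<in> G) \<and> s \<longlonglongrightarrow> x \<and> t \<longlonglongrightarrow> w" if "(x, w) \<in> closure G" for x w
  proof -
    obtain p where p: "\<forall>n. p n \<in> G" "p \<longlonglongrightarrow> (x, w)" using \<open>(x, w) \<in> closure G\<close> unfolding closure_sequential by blast
    then show ?thesis
      using tendsto_fst[OF p(2)] tendsto_snd[OF p(2)]
      by (intro exI[of _ "\<lambda>n. fst (p n)"] exI[of _ "\<lambda>n. snd (p n)"]) simp
  qed
  have seqI: "(x, w) \<in> closure G" if "\<And>n. (s n, t n) \<in> G" "s \<longlonglongrightarrow> x" "t \<longlonglongrightarrow> w" for s t x w
    unfolding closure_sequential using that tendsto_Pair[OF that(2,3)]
    by (intro exI[of _ "\<lambda>n. (s n, t n)"]) simp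
  have add: "(x + y, v + w) \<in> closure G" if xy: "(x, v) \<in> closure G" "(y, w) \<in> closure G" for x y v w
  proof -
    obtain s t s' t' where *: "\<forall>n. (s n, t n) \<in> G" "s \<longlonglongrightarrow> x" "t \<longlonglongrightarrow> v"
      "\<forall>n. (s' n, t' n) \<in> G" "s' \<longlonglongrightarrow> y" "t' \<longlonglongrightarrow> w"
      using seq[OF xy(1)] seq[OF xy(2)] by blast
    have "(s n + s' n, t n + t' n) \<in> G" for n
      using *(1)[rule_format, of n] *(4)[rule_format, of n] unfolding G_def by (fastforce dest: comb.add)
    then show ?thesis by (rule seqI[OF _ tendsto_add[OF *(2,5)] tendsto_add[OF *(3,6)]])
  qed
  have mult: "(x * y, v * w) \<in> closure G" if xy: "(x, v) \<in> closure G" "(y, w) \<in> closure G" for x y v w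
  proof -
    obtain s t s' t' where *: "\<forall>n. (s n, t n) \<in> G" "s \<longlonglongrightarrow> x" "t \<longlonglongrightarrow> v"
      "\<forall>n. (s' n, t' n) \<in> G" "s' \<longlonglongrightarrow> y" "t' \<longlonglongrightarrow> w"
      using seq[OF xy(1)] seq[OF xy(2)] by blast
    have "(s n * s' n, t n * t' n) \<in> G" for n
      using *(1)[rule_format, of n] *(4)[rule_format, of n] unfolding G_def by (fastforce dest: comb_mult)
    then show ?thesis by (rule seqI[OF _ tendsto_mult[OF *(2,5)] tendsto_mult[OF *(3,6)]])
  qed
  have scale: "(c *\<^sub>C x, c * v) \<in> closure G" if x: "(x, v) \<in> closure G" for c x v
  proof -
    obtain s t where *: "\<forall>n. (s n, t n) \<in> G" "s \<longlonglongrightarrow> x" "t \<longlonglongrightarrow> v"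
      using seq[OF x] by blast
    have "(c *\<^sub>C s n, c * t n) \<in> G" for n
    proof -
      obtain f where "comb (s n) f" "t n = f \<mu>" using *(1) by (auto simp: G_def)
      then show ?thesis
        using comb.scale[of "s n" f c] unfolding G_def
        by (intro CollectI exI[of _ "c *\<^sub>C s n"] exI[of _ "\<lambda>\<mu>. c * f \<mu>"]) simp
    qed
    then show ?thesis
      by (rule seqI[OF _ tendsto_scaleC[OF tendsto_const *(2)] tendsto_mult[OF tendsto_const *(3)]])
  qed
  \<comment> \<open>The difference \<open>(0, v - w)\<close> lies in the closure, where the second
    entry is bounded by the norm of the first.\<close>
  have uniq: "v = w" if "(x, v) \<in> closure G" "(x, w) \<in> closure G" for x v w
    using bound[OF add[OF that(1) scale[OF that(2), of "-1"]]] by simp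
  have ex: "\<exists>w. (x, w) \<in> closure G" if "x \<in> J" for x
  proof -
    obtain s where s: "\<And>n. s n \<in> scaleC.span (T ` S)" "s \<longlonglongrightarrow> x"
      using \<open>x \<in> J\<close> unfolding semigroup_algebra_def closure_sequential by blast
    obtain f where f: "\<And>n. comb (s n) (f n)" using span_comb[OF s(1)] by metis
    have "Cauchy (\<lambda>n. f n \<mu>)"
    proof (rule metric_CauchyI)
      fix e :: real assume "e > 0"
      then obtain M where "\<And>m n. m \<ge> M \<Longrightarrow> n \<ge> M \<Longrightarrow> dist (s m) (s n) < e"
        using metric_CauchyD[OF LIMSEQ_imp_Cauchy[OF s(2)]] by blast
      moreover have "dist (f m \<mu>) (f n \<mu>) \<le> dist (s m) (s n)" for m n
        using \<mu> comb_diff[OF f[of m] f[of n]] unfolding spectral_def dist_norm by blast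
      ultimately show "\<exists>M. \<forall>m\<ge>M. \<forall>n\<ge>M. dist (f m \<mu>) (f n \<mu>) < e" by (meson le_less_trans)
    qed
    then obtain w where w: "(\<lambda>n. f n \<mu>) \<longlonglongrightarrow> w" by (auto simp: Cauchy_convergent_iff convergent_def)
    have "(s n, f n \<mu>) \<in> G" for n using f by (auto simp: G_def)
    from seqI[OF this s(2) w] show ?thesis by blast
  qed
  define \<phi> where "\<phi> x = (THE w. (x, w) \<in> closure G)" for x
  have \<phi>_eq: "\<phi> x = w" if "(x, w) \<in> closure G" for x w
    unfolding \<phi>_def using uniq that by blast
  have \<phi>: "(x, \<phi> x) \<in> closure G" if "x \<in> J" for x
    using ex[OF that] \<phi>_eq by auto
  have T: "\<phi> (T z) = exp (\<mu> * z)" if "z \<in> S" for z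
    using comb.base[OF that] closure_subset[of G] by (intro \<phi>_eq) (auto simp: G_def)
  obtain z where "z \<in> S" using sector_nonempty[OF ab(1)] by blast
  then have "\<exists>x\<in>J. \<phi> x \<noteq> 0" using T by (auto intro!: bexI[of _ "T z"])
  then have "character J \<phi>"
    using \<phi>_eq[OF add[OF \<phi> \<phi>]] \<phi>_eq[OF mult[OF \<phi> \<phi>]] \<phi>_eq[OF scale[OF \<phi>]]
    by (simp add: character_def)
  with T show ?thesis by blast
qed

end

section \<open>Characters and the spectrum of the generator\<close>

locale cancellative_hol_semigroup = hol_semigroup +
  assumes J_cancel: "weakly_cancellative J"

sublocale cancellative_hol_semigroup \<subseteq> qm_algebra J
  by unfold_locales (auto intro: J_csubalgebra J_comm J_cancel)

context cancellative_hol_semigroup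
begin

lemma generator_quot_eq:
  assumes "z \<in> S" "w \<in> S" "u \<in> Omega J" "v \<in> Omega J"
  shows "qm_quot J (T' z * u) (T z * u) = qm_quot J (T' w * v) (T w * v)"
proof -
  have "T' z * T w = T' w * T z" using assms T'_add by (metis add.commute)
  then have "T' z * u * (T w * v) = T' w * T z * (v * u)"
    using mult4(1)[of "T' z" u "T w" v] assms comm[of u v] by simp
  also have "\<dots> = T' w * v * (T z * u)" using mult4(1)[of "T' w" "T z" v u] assms by simp
  finally have "T' z * u * (T w * v) = T' w * v * (T z * u)" .
  then show ?thesis using assms by (subst qm_quot_eq_iff) (auto simp: T_in_Omega)
qed

lemma character_ext_generator:
  assumes \<phi>: "character J \<phi>" and z: "z \<in> S" and u: "u \<in> Omega J"
  shows "character_ext J \<phi> (qm_quot J (T' z * u) (T z * u)) = \<phi> (T' z) / \<phi> (T z)"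
  using character_ext_quot[OF J_closed \<phi>, of "T' z * u" "T z * u"] assms
    character_Omega_nonzero[OF J_closed \<phi> u]
  by (simp add: T_in_Omega character_mult[OF \<phi>])

text \<open>The quotient \<open>\<phi> (T' z) / \<phi> (T z)\<close> is a constant
  \<open>\<mu>\<close>, so \<open>\<phi> (T z)\<close> solves \<open>f' = \<mu> f\<close> on the
  convex sector and equals \<open>c * exp (\<mu> * z)\<close>. The semigroup law leaves
  \<open>c = c * c\<close>, and \<open>c\<close> is nonzero because each \<open>T z\<close> has
  dense multiples.\<close>

lemma character_T:
  assumes \<phi>: "character J \<phi>"
  obtains \<mu> where "\<And>z. z \<in> S \<Longrightarrow> \<phi> (T z) = exp (\<mu> * z)" "\<And>z. z \<in> S \<Longrightarrow> \<phi> (T' z) = \<mu> * exp (\<mu> * z)"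
proof -
  note nz = character_Omega_nonzero[OF J_closed \<phi> T_in_Omega]
  obtain z0 where z0: "z0 \<in> S" using sector_nonempty[OF ab(1)] by blast
  define \<mu> where "\<mu> = \<phi> (T' z0) / \<phi> (T z0)"
  have \<phi>T': "\<phi> (T' z) = \<mu> * \<phi> (T z)" if z: "z \<in> S" for z
  proof -
    have "T' z * T z0 = T' z0 * T z" using z z0 T'_add by (metis add.commute)
    from arg_cong[OF this, of \<phi>] have "\<phi> (T' z) * \<phi> (T z0) = \<phi> (T' z0) * \<phi> (T z)"
      using z z0 by (simp only: character_mult[OF \<phi>] T_in_J T'_in_J)
    then show ?thesis using nz[OF z0] by (simp add: \<mu>_def field_simps)
  qed
  have deriv: "((\<lambda>z. \<phi> (T z)) has_field_derivative \<mu> * \<phi> (T z)) (at z)" if z: "z \<in> S" for z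
  proof -
    have 1: "((\<lambda>h. \<phi> (inverse h *\<^sub>C (T (z + h) - T z))) \<longlongrightarrow> \<phi> (T' z)) (at 0)"
      using z by (intro character_tendsto[OF csub J_closed \<phi>] has_cderiv_limit T_deriv quotient_in_J) auto
    have 2: "\<phi> (inverse h *\<^sub>C (T (z + h) - T z)) = (\<phi> (T (z + h)) - \<phi> (T z)) / h" if "z + h \<in> S" for h
    proof -
      have "\<phi> (inverse h *\<^sub>C (T (z + h) - T z)) = inverse h * \<phi> (T (z + h) - T z)"
        using \<phi> z that unfolding character_def by blast
      then show ?thesis
        using z that by (simp add: character_diff[OF csub \<phi>] field_simps)
    qed
    have "((\<lambda>h. (\<phi> (T (z + h)) - \<phi> (T z)) / h) \<longlongrightarrow> \<phi> (T' z)) (at 0)"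
      by (rule Lim_transform_eventually[OF 1 eventually_mono[OF eventually_S[OF z] 2]])
    then show ?thesis by (simp add: DERIV_def \<phi>T'[OF z])
  qed
  have "\<exists>c. \<forall>z\<in>S. \<phi> (T z) * exp (- \<mu> * z) = c"
  proof (rule has_field_derivative_zero_constant[OF sector_convex[OF ab]])
    fix z assume z: "z \<in> S"
    have "((\<lambda>z. \<phi> (T z) * exp (- \<mu> * z)) has_field_derivative 0) (at z)"
      by (rule derivative_eq_intros deriv[OF z] refl | simp)+
    then show "((\<lambda>z. \<phi> (T z) * exp (- \<mu> * z)) has_field_derivative 0) (at z within S)"
      by (rule has_field_derivative_at_within)
  qed
  then obtain c where "\<And>z. z \<in> S \<Longrightarrow> \<phi> (T z) * exp (- \<mu> * z) = c" by blast
  then have c: "\<phi> (T z) = c * exp (\<mu> * z)" if "z \<in> S" for z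
    using that by (fastforce simp: exp_minus field_simps)
  have "c \<noteq> 0" using c[OF z0] nz[OF z0] by auto
  have "c * exp (\<mu> * (z0 + z0)) = c * exp (\<mu> * z0) * (c * exp (\<mu> * z0))"
    using c z0 by (metis T_add S_add character_mult[OF \<phi>] T_in_J)
  moreover have "exp (\<mu> * (z0 + z0)) = exp (\<mu> * z0) * exp (\<mu> * z0)"
    by (simp only: distrib_left exp_add)
  ultimately have "c = 1" using \<open>c \<noteq> 0\<close> by simp
  then show ?thesis using that[of \<mu>] c \<phi>T' by simp
qed

lemma character_spectral:
  assumes \<phi>: "character J \<phi>" and T: "\<And>z. z \<in> S \<Longrightarrow> \<phi> (T z) = exp (\<mu> * z)"
  shows "spectral \<mu>"
  unfolding spectral_def
proof (intro allI impI)
  fix x f assume x: "comb x f"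
  then have "\<phi> x = f \<mu>"
  proof (induction rule: comb.induct)
    case (add x f y g)
    then show ?case using \<phi> comb_in_J by (simp add: character_def)
  next
    case (scale x f c)
    then show ?case using \<phi> comb_in_J by (simp add: character_def)
  qed (rule T)
  then show "cmod (f \<mu>) \<le> norm x"
    using character_norm_le[OF csub J_closed \<phi> comb_in_J[OF x]] by simp
qed

lemma spectrum_eq:
  assumes z: "z \<in> S" and u: "u \<in> Omega J"
  shows "{character_ext J \<phi> (qm_quot J (T' z * u) (T z * u)) | \<phi>. character J \<phi>} = {\<mu>. spectral \<mu>}"
proof safe
  fix \<phi> assume \<phi>: "character J \<phi>"
  obtain \<mu> where *: "\<And>z. z \<in> S \<Longrightarrow> \<phi> (T z) = exp (\<mu> * z)" "\<And>z. z \<in> S \<Longrightarrow> \<phi> (T' z) = \<mu> * exp (\<mu> * z)"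
    using character_T[OF \<phi>] by blast
  then show "spectral (character_ext J \<phi> (qm_quot J (T' z * u) (T z * u)))"
    using character_spectral[OF \<phi> *(1)] z by (simp add: character_ext_generator[OF \<phi> z u])
next
  fix \<mu> assume "spectral \<mu>"
  then obtain \<phi> where \<phi>: "character J \<phi>" and T: "\<And>z. z \<in> S \<Longrightarrow> \<phi> (T z) = exp (\<mu> * z)"
    using spectral_character by blast
  obtain \<nu> where \<nu>: "\<And>z. z \<in> S \<Longrightarrow> \<phi> (T z) = exp (\<nu> * z)" "\<And>z. z \<in> S \<Longrightarrow> \<phi> (T' z) = \<nu> * exp (\<nu> * z)"
    using character_T[OF \<phi>] by blast
  \<comment> \<open>Equal exponentials at one point determine the exponent only up to a period;
    since they agree on the open sector, their derivatives can be compared too.\<close>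
  have "((\<lambda>z. exp (\<mu> * z)) has_field_derivative \<mu> * exp (\<mu> * z)) (at z)"
    by (auto intro!: derivative_eq_intros)
  moreover have "((\<lambda>z. exp (\<nu> * z)) has_field_derivative \<nu> * exp (\<nu> * z)) (at z)"
    by (auto intro!: derivative_eq_intros)
  then have "((\<lambda>z. exp (\<mu> * z)) has_field_derivative \<nu> * exp (\<nu> * z)) (at z)"
    by (rule has_field_derivative_transform_within_open[OF _ open_S z]) (simp add: T flip: \<nu>(1))
  ultimately have "\<mu> * exp (\<mu> * z) = \<nu> * exp (\<nu> * z)" by (rule DERIV_unique)
  moreover have "exp (\<mu> * z) = exp (\<nu> * z)" using T \<nu>(1) z by metis
  ultimately have "\<mu> = \<nu>" by simp
  then have "character_ext J \<phi> (qm_quot J (T' z * u) (T z * u)) = \<mu>"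
    using \<nu> z by (simp add: character_ext_generator[OF \<phi> z u])
  then show "\<exists>\<phi>. \<mu> = character_ext J \<phi> (qm_quot J (T' z * u) (T z * u)) \<and> character J \<phi>"
    using \<phi> by blast
qed

end

subsection \<open>Subadditive functions\<close>

text \<open>Fekete's argument in a real variable. The limit lives in \<open>ereal\<close> because it
  can be \<open>- \<infinity>\<close>, as for quasinilpotent semigroups.\<close>

lemma subadditive_limit:
  fixes \<phi> :: "real \<Rightarrow> real"
  assumes sub: "\<And>s t. s > 0 \<Longrightarrow> t > 0 \<Longrightarrow> \<phi> (s + t) \<le> \<phi> s + \<phi> t"
    and cont: "continuous_on {0<..} \<phi>"
  shows "((\<lambda>t. ereal (\<phi> t / t)) \<longlongrightarrow> (INF t\<in>{0<..}. ereal (\<phi> t / t))) at_top"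
proof (rule order_tendstoI)
  fix c assume c: "c < (INF t\<in>{0<..}. ereal (\<phi> t / t))"
  have "c < ereal (\<phi> t / t)" if "t > 0" for t
    by (rule less_le_trans[OF c INF_lower]) (use that in simp)
  then show "\<forall>\<^sub>F t in at_top. c < ereal (\<phi> t / t)"
    using eventually_gt_at_top[of 0] by (rule eventually_mono[rotated])
next
  fix c assume "(INF t\<in>{0<..}. ereal (\<phi> t / t)) < c"
  then obtain s where s: "s > 0" "ereal (\<phi> s / s) < c" by (auto simp: INF_less_iff)
  then obtain c' where c': "\<phi> s / s < c'" "ereal c' < c" using ereal_dense2[OF s(2)] by auto
  have "compact (\<phi> ` {s..2 * s})"
    using s by (intro compact_continuous_image continuous_on_subset[OF cont]) auto
  then obtain M where M: "\<And>r. r \<in> {s..2 * s} \<Longrightarrow> norm (\<phi> r) \<le> M"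
    using compact_imp_bounded bounded_iff by (metis imageI)
  have multi: "\<phi> (real n * s + r) \<le> real n * \<phi> s + \<phi> r" if "r > 0" for n r
  proof (induction n)
    case (Suc n)
    have "\<phi> (s + (real n * s + r)) \<le> \<phi> s + \<phi> (real n * s + r)"
      using s that by (intro sub) (auto intro: add_nonneg_pos)
    with Suc show ?case by (simp add: algebra_simps)
  qed simp
  \<comment> \<open>Bounds the share of the remainder \<open>r\<close>, for which
    \<open>r / s \<le> 2\<close> and \<open>\<phi> r \<le> M\<close>.\<close>
  define C where "C = 2 * \<bar>\<phi> s\<bar> + M"
  have bound: "\<phi> t / t \<le> \<phi> s / s + C / t" if t: "t \<ge> s" for t
  proof -
    \<comment> \<open>The integer quotient is lowered by one, so that the remainder falls into
      \<open>{s..2 * s}\<close>, away from \<open>0\<close>, near which \<open>\<phi>\<close> may be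
      unbounded.\<close>
    define n where "n = nat \<lfloor>t / s\<rfloor> - 1"
    define r where "r = t - real n * s"
    have ts: "1 \<le> t / s" using t s by simp
    then have n: "real n = of_int \<lfloor>t / s\<rfloor> - 1"
      unfolding n_def by (simp add: of_nat_diff le_nat_iff nat_le_iff)
    have "t / s - 1 < of_int \<lfloor>t / s\<rfloor>" "of_int \<lfloor>t / s\<rfloor> \<le> t / s" by linarith+
    then have "real n \<le> t / s - 1" "t / s - 2 \<le> real n" using n by linarith+
    then have "real n * s \<le> (t / s - 1) * s" "(t / s - 2) * s \<le> real n * s"
      using s by (intro mult_right_mono; simp)+
    then have "real n * s \<le> t - s" "t - 2 * s \<le> real n * s"
      using s by (simp_all add: left_diff_distrib)
    then have r: "r \<in> {s..2 * s}" by (simp add: r_def)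
    have "\<phi> t \<le> real n * \<phi> s + \<phi> r" using multi[of r n] r s by (simp add: r_def)
    also have "real n * \<phi> s = t * (\<phi> s / s) - (r / s) * \<phi> s"
      using s by (simp add: r_def field_simps)
    also have "(r / s) * (- \<phi> s) \<le> (r / s) * \<bar>\<phi> s\<bar>"
      using r s by (intro mult_left_mono) auto
    then have "t * (\<phi> s / s) - (r / s) * \<phi> s + \<phi> r \<le> t * (\<phi> s / s) + (r / s) * \<bar>\<phi> s\<bar> + \<phi> r" by simp
    also have "\<dots> \<le> t * (\<phi> s / s) + C"
    proof -
      have "(r / s) * \<bar>\<phi> s\<bar> \<le> 2 * \<bar>\<phi> s\<bar>"
        using r s by (intro mult_right_mono) (auto simp: divide_le_eq)
      then show ?thesis using M[OF r] unfolding C_def real_norm_def by linarith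
    qed
    finally show ?thesis using s t by (simp add: field_simps)
  qed
  have "((\<lambda>t. \<phi> s / s + C / t) \<longlongrightarrow> \<phi> s / s + 0) at_top"
    by (intro tendsto_intros tendsto_divide_0[OF tendsto_const] filterlim_at_top_imp_at_infinity filterlim_ident)
  then have "\<forall>\<^sub>F t in at_top. \<phi> s / s + C / t < c'" using c'(1) by (auto dest: order_tendstoD(2))
  then show "\<forall>\<^sub>F t in at_top. ereal (\<phi> t / t) < c"
    using eventually_ge_at_top[of s]
  proof eventually_elim
    case (elim t)
    then have "ereal (\<phi> t / t) < ereal c'" using bound[of t] by simp
    then show ?case using c'(2) by (rule less_trans)
  qed
qed

subsection \<open>Integrals over the half line\<close>

text \<open>Every nonzero value is taken on a set of finite measure, so the sum over level sets is a
  gauge integral as well. Simple Bochner integrals thereby become comparable with integrals over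
  compact intervals.\<close>

lemma simple_bochner_has_integral:
  fixes s :: "real \<Rightarrow> 'a::banach"
  assumes s: "Bochner_Integration.simple_bochner_integrable (restrict_space lborel {0<..}) s"
  shows "(s has_integral Bochner_Integration.simple_bochner_integral (restrict_space lborel {0<..}) s) {0<..}"
proof -
  let ?M = "restrict_space lborel {0<..} :: real measure"
  have sf: "simple_function ?M s" and fin: "emeasure ?M {x \<in> space ?M. s x \<noteq> 0} \<noteq> \<infinity>"
    using s by (auto elim: Bochner_Integration.simple_bochner_integrable.cases)
  have space: "space ?M = {0<..}" by (simp add: space_restrict_space)
  define A where "A y = {x \<in> {0<..}. s x = y}" for y
  have A_M: "A y \<in> sets ?M" for y
    using simple_functionD(2)[OF sf, of "{y}"] by (simp add: A_def space vimage_def Int_def conj_commute)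
  have A_sets: "A y \<in> sets borel" for y
    using A_M[of y] by (simp add: sets_restrict_space_iff)
  have piece: "((\<lambda>x. if x \<in> A y then y else 0) has_integral measure ?M (A y) *\<^sub>R y) {0<..}" for y
  proof (cases "y = 0")
    case True
    then show ?thesis by (simp add: if_distrib cong: if_cong)
  next
    case False
    have m: "emeasure ?M (A y) = emeasure lborel (A y)" "measure ?M (A y) = measure lborel (A y)"
      by (intro emeasure_restrict_space measure_restrict_space; auto simp: A_def)+
    have "{x \<in> space ?M. s x \<noteq> 0} \<in> sets ?M"
      using simple_functionD(2)[OF sf, of "- {0}"] by (simp add: vimage_def Int_def conj_commute)
    then have "emeasure ?M (A y) \<le> emeasure ?M {x \<in> space ?M. s x \<noteq> 0}"
      using False by (intro emeasure_mono) (auto simp: A_def space)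
    then have "emeasure lborel (A y) < \<infinity>" using fin m by (simp add: less_top order_le_less_trans)
    then have "((\<lambda>x. 1 :: real) has_integral measure ?M (A y)) (A y)"
      unfolding m(2) by (intro has_integral_measure_lborel A_sets)
    then have "((\<lambda>x. 1 *\<^sub>R y) has_integral measure ?M (A y) *\<^sub>R y) (A y)"
      by (rule has_integral_scaleR_left)
    then have "((\<lambda>x. y) has_integral measure ?M (A y) *\<^sub>R y) (A y)" by simp
    moreover have "A y \<subseteq> {0<..}" by (auto simp: A_def)
    ultimately show ?thesis by (simp add: has_integral_restrict)
  qed
  have finite: "finite (s ` {0<..})" using simple_functionD(1)[OF sf] by (simp add: space)
  have 1: "((\<lambda>x. \<Sum>y\<in>s ` {0<..}. if x \<in> A y then y else 0) has_integral (\<Sum>y\<in>s ` {0<..}. measure ?M (A y) *\<^sub>R y)) {0<..}"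
    by (intro has_integral_sum finite piece)
  have 2: "(\<Sum>y\<in>s ` {0<..}. measure ?M (A y) *\<^sub>R y) = Bochner_Integration.simple_bochner_integral ?M s"
    by (simp add: Bochner_Integration.simple_bochner_integral_def space A_def)
  have "(\<Sum>y\<in>s ` {0<..}. if x \<in> A y then y else 0) = s x" if "x \<in> {0<..}" for x
    using that finite by (simp add: A_def sum.delta')
  from has_integral_eq[OF this 1] 2 show ?thesis by simp
qed

lemma set_integrable_exp:
  assumes "d > (0::real)"
  shows "set_integrable lborel {0<..} (\<lambda>t. K * exp (- d * t))"
proof -
  have "((\<lambda>x. exp (- d * x)) has_integral exp (- d * 0) / d) {0..}"
    by (rule has_integral_exp_minus_to_infinity[OF assms])
  then have "(\<lambda>x. exp (- d * x)) absolutely_integrable_on {0..}"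
    by (intro nonnegative_absolutely_integrable_1) auto
  then have "(\<lambda>x. exp (- d * x)) absolutely_integrable_on {0<..}"
    by (rule set_integrable_subset) auto
  then have "set_integrable lborel {0<..} (\<lambda>t. exp (- d * t))"
    unfolding set_integrable_def by (subst (asm) integrable_completion) auto
  then show ?thesis by (rule set_integrable_mult_right)
qed

lemma ceiling_dyadic_tendsto: "(\<lambda>n. of_int \<lceil>t * 2 ^ n\<rceil> / 2 ^ n) \<longlonglongrightarrow> (t :: real)"
proof (rule Lim_null[THEN iffD2], rule Lim_null_comparison)
  show "(\<lambda>n. (1 / 2 :: real) ^ n) \<longlonglongrightarrow> 0" by (rule LIMSEQ_power_zero) simp
  have "norm (of_int \<lceil>t * 2 ^ n\<rceil> / 2 ^ n - t) \<le> (1 / 2) ^ n" for n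
  proof -
    have "\<bar>of_int \<lceil>t * 2 ^ n\<rceil> - t * 2 ^ n\<bar> \<le> 1" by linarith
    moreover have "of_int \<lceil>t * 2 ^ n\<rceil> / 2 ^ n - t = (of_int \<lceil>t * 2 ^ n\<rceil> - t * 2 ^ n) / 2 ^ n"
      by (simp add: field_simps)
    ultimately show ?thesis by (simp add: power_one_over divide_right_mono)
  qed
  then show "\<forall>\<^sub>F n in sequentially. norm (of_int \<lceil>t * 2 ^ n\<rceil> / 2 ^ n - t) \<le> (1 / 2) ^ n" by simp
qed

text \<open>The same \<open>y\<close> is reached in two ways: by integrals of step functions, which
  is the Bochner integral, and by integrals over compact intervals, to which the fundamental theorem
  of calculus applies. The norms of both errors are real functions dominated by a multiple of
  \<open>exp (- d * t)\<close>, so real dominated convergence suffices.\<close>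

proposition exp_dominated_integral:
  fixes f :: "real \<Rightarrow> 'a::banach"
  assumes cont: "continuous_on {0<..} f"
    and bound: "\<And>t. t > 0 \<Longrightarrow> norm (f t) \<le> K * exp (- d * t)" and d: "d > 0"
  obtains y where "bochner_integral_eq (restrict_space lborel {0<..}) f y"
    "(\<lambda>n. integral {inverse (real (Suc n))..real (Suc n)} f) \<longlonglongrightarrow> y"
    "\<And>X. closed X \<Longrightarrow> subspace X \<Longrightarrow> (\<And>t. t > 0 \<Longrightarrow> f t \<in> X) \<Longrightarrow> y \<in> X"
    "set_integrable lborel {0<..} (\<lambda>t. norm (f t))"
    "norm y \<le> (LINT t:{0<..}|lborel. norm (f t))"
proof -
  let ?M = "restrict_space lborel {0<..} :: real measure"
  have space: "space ?M = {0<..}" by (simp add: space_restrict_space)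
  have sets: "sets ?M = sets (restrict_space borel {0<..})" by (rule sets_restrict_space_cong) simp
  have meas_cont: "g \<in> borel_measurable ?M" if "continuous_on {0<..} g" for g :: "real \<Rightarrow> 'c::topological_space"
    using borel_measurable_continuous_on_restrict[OF that] by (simp add: measurable_cong_sets[OF sets refl])
  have set_integrable_iff: "set_integrable lborel {0<..} g \<longleftrightarrow> integrable ?M g" for g :: "real \<Rightarrow> real"
    by (simp add: set_integrable_def integrable_restrict_space)
  have integral_eq: "(LINT t:{0<..}|lborel. g t) = integral\<^sup>L ?M g" for g :: "real \<Rightarrow> real"
    by (simp add: set_lebesgue_integral_def integral_restrict_space)
  have has_int: "(g has_integral integral\<^sup>L ?M g) {0<..}" if "integrable ?M g" for g :: "real \<Rightarrow> real"
    using set_borel_integral_eq_integral[of "{0<..}" g] that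
    by (simp add: set_integrable_iff integral_eq has_integral_iff)
  have exp_int: "integrable ?M (\<lambda>t. C * exp (- d * t))" for C
    using set_integrable_exp[OF d, of C] by (simp add: set_integrable_iff)
  have "K \<ge> 0" using bound[of 1] norm_ge_zero[of "f 1"] by (smt (verit) exp_gt_zero mult_neg_pos)
  \<comment> \<open>An integer index, with \<open>- 1\<close> marking the region beyond
    \<open>n\<close> on which the step function is \<open>0\<close>. Measurability of the
    approximation error then reduces to countably many continuous functions.\<close>
  define q where "q n t = (if t \<le> real n then \<lceil>t * 2 ^ n\<rceil> else - 1)" for n :: nat and t :: real
  define h where "h n k = (if k < 0 then 0 else f (of_int k / 2 ^ n))" for n :: nat and k :: int
  define g where "g n t = h n (q n t)" for n t
  have g_eq: "g n t = (if t \<le> real n then f (of_int \<lceil>t * 2 ^ n\<rceil> / 2 ^ n) else 0)" if "t > 0" for n t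
  proof -
    have "t * 2 ^ n > 0" using that by simp
    then have "\<lceil>t * 2 ^ n\<rceil> > 0" by (simp only: zero_less_ceiling)
    then show ?thesis by (simp add: g_def h_def q_def)
  qed
  \<comment> \<open>Sample points are rounded up: they stay positive, where \<open>f\<close> is
    controlled, and the exponential bound at a point to the right of \<open>t\<close> is at most the
    bound at \<open>t\<close>.\<close>
  have dy: "t \<le> of_int \<lceil>t * 2 ^ n\<rceil> / 2 ^ n" for t :: real and n
    by (simp add: field_simps)
  have g_bound: "norm (g n t) \<le> K * exp (- d * t)" if "t > 0" for n t
  proof (cases "t \<le> real n")
    case True
    have "norm (g n t) \<le> K * exp (- d * (of_int \<lceil>t * 2 ^ n\<rceil> / 2 ^ n))"
      using True that dy[of t n] by (simp add: g_eq) (use bound[of "of_int \<lceil>t * 2 ^ n\<rceil> / 2 ^ n"] in simp)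
    also have "\<dots> \<le> K * exp (- d * t)"
      using mult_left_mono[OF dy[of t n], of d] d \<open>K \<ge> 0\<close> by (intro mult_left_mono) auto
    finally show ?thesis .
  next
    case False
    then show ?thesis using that \<open>K \<ge> 0\<close> by (simp add: g_eq)
  qed
  have g_lim: "(\<lambda>n. g n t) \<longlonglongrightarrow> f t" if "t > 0" for t
  proof (rule Lim_transform_eventually)
    have "isCont f t" using cont that by (simp add: continuous_on_eq_continuous_at)
    then show "(\<lambda>n. f (of_int \<lceil>t * 2 ^ n\<rceil> / 2 ^ n)) \<longlonglongrightarrow> f t"
      by (rule isCont_tendsto_compose[OF _ ceiling_dyadic_tendsto])
    have "eventually (\<lambda>n. t \<le> real n) sequentially"
      using filterlim_real_sequentially by (simp add: filterlim_at_top)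
    then show "\<forall>\<^sub>F n in sequentially. f (of_int \<lceil>t * 2 ^ n\<rceil> / 2 ^ n) = g n t"
      by (rule eventually_mono) (use that in \<open>simp add: g_eq\<close>)
  qed
  have q_meas: "q n \<in> measurable ?M (count_space UNIV)" for n
    unfolding q_def by (rule measurable_restrict_space1) measurable
  have g_simple: "Bochner_Integration.simple_bochner_integrable ?M (g n)" for n
  proof (rule Bochner_Integration.simple_bochner_integrable.intros)
    have "q n t \<in> {- 1..int n * 2 ^ n}" if "t > 0" for t
    proof (cases "t \<le> real n")
      case True
      then have "t * 2 ^ n \<le> of_int (int n * 2 ^ n)" by simp
      then have "\<lceil>t * 2 ^ n\<rceil> \<le> int n * 2 ^ n" by (simp only: ceiling_le_iff)
      moreover have "t * 2 ^ n > 0" using that by simp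
      then have "\<lceil>t * 2 ^ n\<rceil> > 0" by (simp only: zero_less_ceiling)
      then have "- 1 \<le> \<lceil>t * 2 ^ n\<rceil>" by linarith
      ultimately show ?thesis using True by (simp add: q_def)
    qed (simp add: q_def order_trans[of "- 1" 0])
    then have "finite (q n ` space ?M)" unfolding space by (intro finite_subset[OF _ finite_atLeastAtMost_int]) blast
    then have "simple_function ?M (q n)" using q_meas[of n] by (simp add: simple_function_eq_measurable)
    moreover have "g n = h n \<circ> q n" by (auto simp: g_def)
    ultimately show "simple_function ?M (g n)" by (simp only: simple_function_compose)
    have "{t \<in> space ?M. g n t \<noteq> 0} \<subseteq> {0<..real n}" by (auto simp: space g_eq split: if_splits)
    then have "emeasure ?M {t \<in> space ?M. g n t \<noteq> 0} \<le> emeasure ?M {0<..real n}"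
      by (intro emeasure_mono) (auto simp: sets_restrict_space intro!: image_eqI[of _ _ "{0<..real n}"])
    also have "\<dots> = emeasure lborel {0<..real n}" by (intro emeasure_restrict_space) auto
    also have "\<dots> < \<infinity>" by simp
    finally show "emeasure ?M {t \<in> space ?M. g n t \<noteq> 0} \<noteq> \<infinity>" by simp
  qed
  define u where "u n t = norm (f t - g n t)" for n t
  define c where "c n = {inverse (real (Suc n))..real (Suc n)}" for n
  define r where "r n t = (if t \<in> c n then 0 else norm (f t))" for n t
  have u_meas: "u n \<in> borel_measurable ?M" for n
    unfolding u_def g_def
    by (rule measurable_compose_countable[where g = "q n" and f = "\<lambda>k t. norm (f t - h n k)"])
      (auto intro!: meas_cont continuous_intros cont q_meas)
  have f_meas: "(\<lambda>t. norm (f t)) \<in> borel_measurable ?M" by (intro meas_cont continuous_intros cont)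
  have r_meas: "r n \<in> borel_measurable ?M" for n
  proof -
    have "r n = (\<lambda>t. norm (f t) * indicator (- c n) t)" by (auto simp: r_def indicator_def)
    moreover have "(\<lambda>t. norm (f t) * indicator (- c n) t) \<in> borel_measurable ?M"
      by (intro borel_measurable_times f_meas measurable_restrict_space1 borel_measurable_indicator)
        (simp add: c_def)
    ultimately show ?thesis by simp
  qed
  have f_int: "integrable ?M (\<lambda>t. norm (f t))"
    by (rule Bochner_Integration.integrable_bound[OF exp_int[of K] f_meas]) (use bound \<open>K \<ge> 0\<close> in \<open>auto simp: space\<close>)
  have u_le: "norm (u n t) \<le> 2 * K * exp (- d * t)" if "t > 0" for n t
    using norm_triangle_ineq4[of "f t" "g n t"] bound[OF that] g_bound[OF that, of n] by (simp add: u_def)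
  have r_le: "norm (r n t) \<le> K * exp (- d * t)" if "t > 0" for n t
    using bound[OF that] \<open>K \<ge> 0\<close> by (simp add: r_def)
  have u_int: "integrable ?M (u n)" and r_int: "integrable ?M (r n)" for n
    using u_le r_le \<open>K \<ge> 0\<close>
    by (auto intro!: Bochner_Integration.integrable_bound[OF exp_int[of "2 * K"] u_meas]
        Bochner_Integration.integrable_bound[OF exp_int[of K] r_meas] simp: space)
  have u_lim: "(\<lambda>n. integral\<^sup>L ?M (u n)) \<longlonglongrightarrow> 0"
  proof -
    have "(\<lambda>n. integral\<^sup>L ?M (u n)) \<longlonglongrightarrow> integral\<^sup>L ?M (\<lambda>_. 0 :: real)"
    proof (rule integral_dominated_convergence[OF _ u_meas exp_int[of "2 * K"]])
      have "(\<lambda>n. u n t) \<longlonglongrightarrow> 0" if "t > 0" for t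
        unfolding u_def using tendsto_norm[OF tendsto_diff[OF tendsto_const[of "f t"] g_lim[OF that]]] by simp
      then show "AE t in ?M. (\<lambda>n. u n t) \<longlonglongrightarrow> 0" by (auto simp: space)
    qed (use u_le in \<open>auto simp: space\<close>)
    then show ?thesis by simp
  qed
  have r_lim: "(\<lambda>n. integral\<^sup>L ?M (r n)) \<longlonglongrightarrow> 0"
  proof -
    have "(\<lambda>n. integral\<^sup>L ?M (r n)) \<longlonglongrightarrow> integral\<^sup>L ?M (\<lambda>_. 0 :: real)"
    proof (rule integral_dominated_convergence[OF _ r_meas exp_int[of K]])
      have "(\<lambda>n. r n t) \<longlonglongrightarrow> 0" if "t > 0" for t
      proof (rule tendsto_eventually)
        have "eventually (\<lambda>n. inverse (real (Suc n)) < t) sequentially"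
          using order_tendstoD(2)[OF LIMSEQ_inverse_real_of_nat that] .
        moreover have "eventually (\<lambda>n. t \<le> real n) sequentially"
          using filterlim_real_sequentially by (simp add: filterlim_at_top)
        ultimately show "\<forall>\<^sub>F n in sequentially. r n t = 0"
          by eventually_elim (auto simp: r_def c_def)
      qed
      then show "AE t in ?M. (\<lambda>n. r n t) \<longlonglongrightarrow> 0" by (auto simp: space)
    qed (use r_le in \<open>auto simp: space\<close>)
    then show ?thesis by simp
  qed
  define I where "I n = integral (c n) f" for n
  define s where "s n = Bochner_Integration.simple_bochner_integral ?M (g n)" for n
  have c_pos: "c n \<subseteq> {0<..}" for n
    by (auto simp: c_def intro: less_le_trans[of 0 "inverse (real (Suc n))"])
  have I_has: "((\<lambda>t. if t \<in> c n then f t else 0) has_integral I n) {0<..}" for n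
  proof -
    have "f integrable_on c n"
      unfolding c_def by (rule integrable_continuous_real)
        (use continuous_on_subset[OF cont c_pos] in \<open>simp add: c_def\<close>)
    then have "(f has_integral I n) (c n)" unfolding I_def by (rule integrable_integral)
    then show ?thesis by (simp add: has_integral_restrict[OF c_pos])
  qed
  have s_has: "(g n has_integral s n) {0<..}" for n
    unfolding s_def by (rule simple_bochner_has_integral[OF g_simple])
  have norm_le: "norm x \<le> integral\<^sup>L ?M w"
    if "(v has_integral x) {0<..}" "integrable ?M w" "\<And>t. t > 0 \<Longrightarrow> norm (v t) \<le> w t"
    for v :: "real \<Rightarrow> 'a" and x w
  proof -
    have "norm (integral {0<..} v) \<le> integral {0<..} w"
      using that has_int[OF that(2)] by (intro integral_norm_bound_integral) (auto simp: has_integral_iff)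
    then show ?thesis using that(1) has_int[OF that(2)] by (simp add: has_integral_iff)
  qed
  \<comment> \<open>Inside \<open>c n\<close> the integrands differ by \<open>u n\<close>; outside,
    \<open>g n\<close> is bounded by \<open>u n\<close> plus the norm of \<open>f\<close>, which is
    \<open>r n\<close> there.\<close>
  have sI: "norm (s n - I n) \<le> integral\<^sup>L ?M (u n) + integral\<^sup>L ?M (r n)" for n
  proof -
    have "norm (s n - I n) \<le> integral\<^sup>L ?M (\<lambda>t. u n t + r n t)"
    proof (rule norm_le[OF has_integral_diff[OF s_has I_has]])
      show "norm (g n t - (if t \<in> c n then f t else 0)) \<le> u n t + r n t" for t
        using norm_triangle_ineq2[of "g n t" "f t"] norm_minus_commute[of "g n t" "f t"] by (auto simp: u_def r_def)
    qed (intro Bochner_Integration.integrable_add u_int r_int)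
    then show ?thesis by (simp add: u_int r_int)
  qed
  have II: "norm (I m - I n) \<le> integral\<^sup>L ?M (r m) + integral\<^sup>L ?M (r n)" for m n
  proof -
    have "norm (I m - I n) \<le> integral\<^sup>L ?M (\<lambda>t. r m t + r n t)"
    proof (rule norm_le[OF has_integral_diff[OF I_has I_has]])
      show "norm ((if t \<in> c m then f t else 0) - (if t \<in> c n then f t else 0)) \<le> r m t + r n t" for t
        by (auto simp: r_def)
    qed (intro Bochner_Integration.integrable_add r_int)
    then show ?thesis by (simp add: r_int)
  qed
  have "Cauchy I"
  proof (rule metric_CauchyI)
    fix e :: real assume "e > 0"
    then have "eventually (\<lambda>n. integral\<^sup>L ?M (r n) < e / 2) sequentially"
      using order_tendstoD(2)[OF r_lim, of "e / 2"] by simp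
    then obtain N where N: "\<And>n. n \<ge> N \<Longrightarrow> integral\<^sup>L ?M (r n) < e / 2" by (auto simp: eventually_sequentially)
    have "dist (I m) (I n) < e" if "m \<ge> N" "n \<ge> N" for m n
      using II[of m n] N[OF that(1)] N[OF that(2)] by (simp add: dist_norm)
    then show "\<exists>M. \<forall>m\<ge>M. \<forall>n\<ge>M. dist (I m) (I n) < e" by blast
  qed
  then obtain y where y: "I \<longlonglongrightarrow> y" by (auto simp: Cauchy_convergent_iff convergent_def)
  have "(\<lambda>n. s n - I n) \<longlonglongrightarrow> 0"
    by (rule Lim_null_comparison[OF _ tendsto_add_zero[OF u_lim r_lim]]) (simp add: sI)
  from tendsto_add[OF this y] have s_lim: "s \<longlonglongrightarrow> y" by simp
  show ?thesis
  proof
    have "(\<lambda>n. \<integral>\<^sup>+t. ennreal (norm (f t - g n t)) \<partial>?M) = (\<lambda>n. ennreal (integral\<^sup>L ?M (u n)))"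
      using nn_integral_eq_integral[OF u_int] by (simp add: u_def)
    moreover have "(\<lambda>n. ennreal (integral\<^sup>L ?M (u n))) \<longlonglongrightarrow> ennreal 0"
      by (rule tendsto_ennrealI[OF u_lim])
    moreover have "s = (\<lambda>n. Bochner_Integration.simple_bochner_integral ?M (g n))"
      by (auto simp: s_def)
    then have "(\<lambda>n. Bochner_Integration.simple_bochner_integral ?M (g n)) \<longlonglongrightarrow> y"
      using s_lim by simp
    ultimately show "bochner_integral_eq ?M f y"
      unfolding bochner_integral_eq_def
      using meas_cont[OF cont] g_simple by (auto intro!: exI[of _ g])
    have "I = (\<lambda>n. integral {inverse (real (Suc n))..real (Suc n)} f)"
      by (auto simp: I_def c_def)
    then show "(\<lambda>n. integral {inverse (real (Suc n))..real (Suc n)} f) \<longlonglongrightarrow> y"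
      using y by simp
    show "set_integrable lborel {0<..} (\<lambda>t. norm (f t))" using f_int by (simp add: set_integrable_iff)
    show "norm y \<le> (LINT t:{0<..}|lborel. norm (f t))"
    proof (rule LIMSEQ_le_const2[OF tendsto_norm[OF y]])
      have "norm (I n) \<le> integral\<^sup>L ?M (\<lambda>t. norm (f t))" for n
        by (rule norm_le[OF I_has f_int]) auto
      then show "\<exists>N. \<forall>n\<ge>N. norm (I n) \<le> (LINT t:{0<..}|lborel. norm (f t))" by (simp add: integral_eq)
    qed
    show "y \<in> X" if X: "closed X" "subspace X" "\<And>t. t > 0 \<Longrightarrow> f t \<in> X" for X
    proof (rule closed_sequentially[OF X(1) _ s_lim])
      have "h n k \<in> X" if "k \<noteq> 0" for n k
        using that X(3) subspace_0[OF X(2)] by (auto simp: h_def)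
      then have "g n t \<in> X" if "t > 0" for n t
        using that X(3) subspace_0[OF X(2)] dy[of t n] by (auto simp: g_eq)
      then show "s n \<in> X" for n
        unfolding s_def Bochner_Integration.simple_bochner_integral_def
        by (intro subspace_sum[OF X(2)] subspace_scale[OF X(2)]) (auto simp: space)
    qed
  qed
qed

text \<open>\<open>H\<close> is an antiderivative of \<open>Q (f t)\<close> and not of
  \<open>f\<close>. In the applications \<open>Q\<close> multiplies by a bounded form of the
  generator, which turns the integrand into an exact derivative.\<close>

lemma improper_integral_FTC:
  fixes f :: "real \<Rightarrow> 'a::banach" and H :: "real \<Rightarrow> 'b::banach"
  assumes cont: "continuous_on {0<..} f"
    and y: "(\<lambda>n. integral {inverse (real (Suc n))..real (Suc n)} f) \<longlonglongrightarrow> y"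
    and Q: "bounded_linear Q"
    and H: "\<And>t. t > 0 \<Longrightarrow> (H has_vector_derivative Q (f t)) (at t)"
    and lims: "(H \<longlongrightarrow> h0) (at_right 0)" "(H \<longlongrightarrow> h1) at_top"
  shows "Q y = h1 - h0"
proof (rule LIMSEQ_unique)
  let ?I = "\<lambda>n. integral {inverse (real (Suc n))..real (Suc n)} f"
  show "(\<lambda>n. Q (?I n)) \<longlonglongrightarrow> Q y" by (rule bounded_linear.tendsto[OF Q y])
  have "Q (?I n) = H (real (Suc n)) - H (inverse (real (Suc n)))" for n
  proof -
    have "1 \<le> real (Suc n) * real (Suc n)"
      using mult_mono[of 1 "real (Suc n)" 1 "real (Suc n)"] by simp
    then have le: "inverse (real (Suc n)) \<le> real (Suc n)" "0 < inverse (real (Suc n))"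
      by (simp_all add: inverse_eq_divide divide_le_eq del: of_nat_Suc)
    then have pos: "t > 0" if "t \<in> {inverse (real (Suc n))..real (Suc n)}" for t
      using that le(2) by (meson atLeastAtMost_iff less_le_trans)
    have int: "f integrable_on {inverse (real (Suc n))..real (Suc n)}"
      by (intro integrable_continuous_real continuous_on_subset[OF cont]) (use pos in auto)
    have "Q (?I n) = integral {inverse (real (Suc n))..real (Suc n)} (\<lambda>t. Q (f t))"
      by (rule integral_linear[OF int Q, unfolded o_def, symmetric])
    moreover have "((\<lambda>t. Q (f t)) has_integral H (real (Suc n)) - H (inverse (real (Suc n))))
        {inverse (real (Suc n))..real (Suc n)}"
      by (rule fundamental_theorem_of_calculus[OF le(1)])
        (use pos H has_vector_derivative_at_within in blast)
    ultimately show ?thesis by (simp add: integral_unique)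
  qed
  moreover have "(\<lambda>n. H (real (Suc n))) \<longlonglongrightarrow> h1"
    by (rule filterlim_compose[OF lims(2)])
      (rule filterlim_compose[OF filterlim_real_sequentially filterlim_Suc])
  moreover have "(\<lambda>n. H (inverse (real (Suc n)))) \<longlonglongrightarrow> h0"
  proof (rule filterlim_compose[OF lims(1)])
    show "filterlim (\<lambda>n. inverse (real (Suc n))) (at_right 0) sequentially"
      using LIMSEQ_inverse_real_of_nat by (auto simp: filterlim_at intro!: always_eventually)
  qed
  ultimately show "(\<lambda>n. Q (?I n)) \<longlonglongrightarrow> h1 - h0" by (simp add: tendsto_diff)
qed

subsection \<open>Multipliers\<close>

lemma multiplier_mult: "multiplier_apply R (u * v) = multiplier_apply R u * v"
  using blinfun_of_multiplier[of R] by (simp add: multiplier_apply.rep_eq)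

lemma bounded_linear_multiplier_apply: "bounded_linear (multiplier_apply R)"
  by (simp add: multiplier_apply.rep_eq blinfun.bounded_linear_right)

lemma multiplier_eqI:
  assumes "\<And>x. multiplier_apply R x = multiplier_apply R' x"
  shows "R = R'"
  using assms by transfer (auto intro: blinfun_eqI)

lemma multiplier_apply_simps [simp]:
  "multiplier_apply (R + R') x = multiplier_apply R x + multiplier_apply R' x"
  "multiplier_apply (R - R') x = multiplier_apply R x - multiplier_apply R' x"
  "multiplier_apply (R * R') x = multiplier_apply R (multiplier_apply R' x)"
  "multiplier_apply (c *\<^sub>C R) x = c *\<^sub>C multiplier_apply R x"
  "multiplier_apply (r *\<^sub>R R) x = r *\<^sub>R multiplier_apply R x"
  "multiplier_apply 0 x = 0"
  by (transfer; simp add: blinfun.bilinear_simps bounded_linear_Blinfun_apply bounded_linear_scaleC)+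

lemma norm_multiplier_apply: "norm (multiplier_apply R x) \<le> norm R * norm x"
  by transfer (rule norm_blinfun)

lemma bounded_linear_multiplier_eval: "bounded_linear (\<lambda>R. multiplier_apply R x)"
  by (rule bounded_linear_intro[where K = "norm x"]) (auto intro: norm_multiplier_apply)

lemma multiplier_mult_right:
  assumes "\<And>x y :: 'a::complex_banach_algebra. x * y = y * x"
  shows "multiplier_apply R (u * (v::'a)) = u * multiplier_apply R v"
  by (metis assms multiplier_mult)

text \<open>In both \<open>R (R' x) * y\<close> and \<open>R' (R x) * y\<close> the two multipliers
  can be distributed over the two factors, with the same product as a result; weak cancellation then
  removes \<open>y\<close>.\<close>

lemma multiplier_commute:
  assumes comm: "\<And>x y :: 'a::complex_banach_algebra. x * y = y * x"
    and wc: "weakly_cancellative (UNIV :: 'a set)"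
  shows "R * R' = R' * (R :: 'a multiplier)"
proof (rule multiplier_eqI)
  fix x :: 'a
  let ?d = "multiplier_apply (R * R') x - multiplier_apply (R' * R) x"
  have "multiplier_apply R (multiplier_apply R' x) * y = multiplier_apply R' (multiplier_apply R x) * y" for y
    by (metis multiplier_mult multiplier_mult_right[OF comm])
  then have "?d * y = 0" for y by (simp add: left_diff_distrib)
  then have "(*) ?d ` UNIV = {0}" by auto
  then have "?d = 0" using wc unfolding weakly_cancellative_def by blast
  then show "multiplier_apply (R * R') x = multiplier_apply (R' * R) x" by simp
qed

lemma dense_extension_eq:
  fixes f g :: "'a::metric_space \<Rightarrow> 'b::real_normed_vector"
  assumes "closure D = UNIV" "continuous_on UNIV f" "continuous_on UNIV g" "\<And>x. x \<in> D \<Longrightarrow> f x = g x"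
  shows "f x = g x"
proof -
  have "closed {x. f x = g x}" using assms(2,3) by (rule closed_Collect_eq)
  then have "closure D \<subseteq> {x. f x = g x}" using assms(4) by (intro closure_minimal) auto
  then show ?thesis using assms(1) by blast
qed

lemma qm_of_multiplier_inj: "qm_of_multiplier R = qm_of_multiplier R' \<Longrightarrow> R = R'"
  by (rule multiplier_eqI) (auto simp: qm_of_multiplier_def set_eq_iff)

lemma qm_of_multiplier_eq_quot:
  assumes "qm_algebra (UNIV :: 'a::complex_banach_algebra set)" "v \<in> Omega UNIV"
  shows "qm_of_multiplier R = qm_quot UNIV (multiplier_apply R v) (v :: 'a)"
proof -
  interpret qm_algebra "UNIV :: 'a set" by (rule assms)
  have "multiplier_apply R v * x = v * multiplier_apply R x" for x
    by (metis comm UNIV_I multiplier_mult)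
  then show ?thesis using Omega_cancel[OF assms(2)] by (auto simp: qm_of_multiplier_def qm_quot_def)
qed

section \<open>Semigroups of multipliers with dense range\<close>

locale dense_semigroup = hol_semigroup a b T
  for a b and T :: "complex \<Rightarrow> 'a::{complex_banach_algebra, comm_ring} multiplier" +
  assumes nontrivial: "\<exists>x::'a. x \<noteq> 0"
    and A_cancel: "weakly_cancellative (UNIV :: 'a set)"
    and A_dpi: "dense_principal_ideals (UNIV :: 'a set)"
    and T_dense: "\<And>z. z \<in> sector a b \<Longrightarrow> closure (range (multiplier_apply (T z))) = UNIV"

sublocale dense_semigroup \<subseteq> A: qm_algebra "UNIV :: 'a set"
  by unfold_locales (auto intro: csubalgebra_UNIV A_cancel mult.commute)

context dense_semigroup
begin

lemma T_right_cancel: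
  assumes "z \<in> S" "x * T z = y * T z"
  shows "x = y"
proof (rule multiplier_eqI, rule dense_extension_eq[OF T_dense[OF assms(1)], of "multiplier_apply x" "multiplier_apply y"])
  show "multiplier_apply x v = multiplier_apply y v" if "v \<in> range (multiplier_apply (T z))" for v
    using that assms(2) by (metis imageE multiplier_apply_simps(3))
qed (intro linear_continuous_on bounded_linear_multiplier_apply)+

lemma T_nonzero: "z \<in> S \<Longrightarrow> T z \<noteq> 0"
proof
  assume "z \<in> S" "T z = 0"
  then have "(UNIV :: 'a set) = closure (range (\<lambda>_. 0))" using T_dense[of z] by simp
  then have "(UNIV :: 'a set) = {0}" by simp
  then show False using nontrivial by blast
qed

lemma T_apply_Omega:
  assumes z: "z \<in> S" and u: "u \<in> Omega UNIV"
  shows "multiplier_apply (T z) u \<in> Omega UNIV"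
proof -
  have "range (multiplier_apply (T z)) = multiplier_apply (T z) ` closure (range ((*) u))"
    using A.Omega_dense[OF u] by (simp add: top.extremum_unique)
  also have "\<dots> \<subseteq> closure (multiplier_apply (T z) ` range ((*) u))"
    by (intro image_closure_subset linear_continuous_on bounded_linear_multiplier_apply closed_closure closure_subset)
  also have "multiplier_apply (T z) ` range ((*) u) = range ((*) (multiplier_apply (T z) u))"
    by (auto simp: image_image multiplier_mult)
  finally have "closure (range (multiplier_apply (T z))) \<subseteq> closure (range ((*) (multiplier_apply (T z) u)))"
    by (simp add: closure_minimal)
  then show ?thesis using T_dense[OF z] by (auto simp: Omega_def)
qed

end

text \<open>For \<open>u \<noteq> 0\<close> the product \<open>u * T z\<close> is nonzero, since
  otherwise \<open>u\<close> would vanish on the dense range of \<open>T z\<close>.\<close>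

sublocale dense_semigroup \<subseteq> cancellative_hol_semigroup a b T
proof
  obtain z where z: "z \<in> S" using sector_nonempty[OF ab(1)] by blast
  show "weakly_cancellative J"
    unfolding weakly_cancellative_def
  proof
    fix u assume "u \<in> J - {0}"
    then have "u * T z \<noteq> 0" using T_right_cancel[OF z, of u 0] by auto
    then show "(*) u ` J \<noteq> {0}" using z by blast
  qed
qed

context dense_semigroup
begin

lemma arveson_spectrum_eq: "arveson_spectrum a b T = {\<mu>. spectral \<mu>}"
proof -
  obtain z where z: "z \<in> S" using sector_nonempty[OF ab(1)] by blast
  \<comment> \<open>\<open>T z\<close> itself serves as the auxiliary element of
    \<open>Omega J\<close>.\<close>
  have "generator_on_algebra a b T = qm_quot J (T' z * T z) (T z * T z)"
    unfolding generator_on_algebra_def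
  proof (rule the_equality)
    fix D assume "\<exists>w\<in>S. \<exists>u\<in>Omega J. D = qm_quot J (T' w * u) (T w * u)"
    then show "D = qm_quot J (T' z * T z) (T z * T z)"
      using generator_quot_eq[OF _ z _ T_in_Omega[OF z]] by auto
  qed (use z T_in_Omega[OF z] in blast)
  then show ?thesis
    unfolding arveson_spectrum_def using spectrum_eq[OF z T_in_Omega[OF z]] by simp
qed

lemma generator_eq:
  assumes z: "z \<in> S" and u: "u \<in> Omega UNIV"
  shows "generator a b T = qm_quot UNIV (multiplier_apply (T' z) u) (multiplier_apply (T z) u)"
  unfolding generator_def
proof (rule the_equality)
  fix D assume "\<exists>w\<in>S. \<exists>v\<in>Omega UNIV. D = qm_quot UNIV (multiplier_apply (T' w) v) (multiplier_apply (T w) v)"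
  then obtain w v where w: "w \<in> S" and v: "v \<in> Omega UNIV"
    and D: "D = qm_quot UNIV (multiplier_apply (T' w) v) (multiplier_apply (T w) v)" by blast
  have prod: "multiplier_apply R x * multiplier_apply R' y = multiplier_apply (R * R') (x * y)" for R R' and x y :: 'a
    by (metis multiplier_apply_simps(3) multiplier_mult mult.commute)
  have "T' w * T z = T' z * T w" using z w T'_add by (metis add.commute)
  then have "multiplier_apply (T' w) v * multiplier_apply (T z) u = multiplier_apply (T' z) u * multiplier_apply (T w) v"
    by (simp only: prod mult.commute[of v u])
  then show "D = qm_quot UNIV (multiplier_apply (T' z) u) (multiplier_apply (T z) u)"
    unfolding D using T_apply_Omega z w u v
    by (subst A.qm_quot_eq_iff) auto
qed (use z u in blast)

end

subsection \<open>Normalizations\<close>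

locale normalized_semigroup = dense_semigroup a b T
  for a b and T :: "complex \<Rightarrow> 'a::{complex_banach_algebra, comm_ring} multiplier" +
  fixes \<iota> :: "'b::complex_banach_algebra \<Rightarrow> 'a rel" and j :: "'a \<Rightarrow> 'b"
  assumes normalization: "normalization a b T \<iota> j"
begin

lemma iota: "inj \<iota>" "range \<iota> \<subseteq> QM UNIV" "\<iota> (x * y) = qm_mult UNIV (\<iota> x) (\<iota> y)"
  "\<iota> (j v) = qm_of_elem v"
  using normalization unfolding normalization_def by auto

lemma ex_QM_homomorphism: "\<exists>p. QM_homomorphism j p"
proof -
  obtain z where "z \<in> S" using sector_nonempty[OF ab(1)] by blast
  then show ?thesis using normalization unfolding normalization_def by blast
qed

lemma j_hom: "j (x + y) = j x + j y" "j (x * y) = j x * j y" "j (c *\<^sub>C x) = c *\<^sub>C j x"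
  "inj j" "closure (range j) = UNIV"
  using ex_QM_homomorphism unfolding QM_homomorphism_def by auto

lemma j_norm: "norm (j x) \<le> norm x"
  using normalization unfolding normalization_def by auto

lemma bounded_linear_j: "bounded_linear j"
  by (rule bounded_linear_intro[where K = 1])
    (auto simp: j_hom j_norm simp flip: scaleC_of_real)

lemma j_0: "j 0 = 0"
  using bounded_linear_j by (simp add: bounded_linear.linear linear_0)

lemma j_eq_iff: "j x = j y \<longleftrightarrow> x = y"
  using j_hom(4) by (auto dest: injD)

lemma B_comm: "x * y = y * (x :: 'b)"
proof -
  have 1: "x * j v = j v * x" for x v
  proof (rule dense_extension_eq[OF j_hom(5), of "\<lambda>x. x * j v" "\<lambda>x. j v * x"])
    show "x * j v = j v * x" if "x \<in> range j" for x
      using that by (auto simp: mult.commute simp flip: j_hom(2))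
  qed (intro continuous_intros)+
  show ?thesis
    by (rule dense_extension_eq[OF j_hom(5), of "\<lambda>y. x * y" "\<lambda>y. y * x"]) (auto intro!: continuous_intros simp: 1)
qed

lemma B_left_comm: "x * (y * z) = y * (x * (z :: 'b))"
  by (metis mult.assoc B_comm)

lemma j_Omega:
  assumes v: "v \<in> Omega UNIV"
  shows "j v \<in> Omega UNIV"
proof -
  have "range j = j ` closure (range ((*) v))"
    using A.Omega_dense[OF v] by (simp add: top.extremum_unique)
  also have "\<dots> \<subseteq> closure (j ` range ((*) v))"
    by (intro image_closure_subset linear_continuous_on bounded_linear_j closed_closure closure_subset)
  also have "\<dots> \<subseteq> closure (range ((*) (j v)))"
    by (intro closure_mono) (auto simp: j_hom)
  finally have "closure (range j) \<subseteq> closure (range ((*) (j v)))" by (simp add: closure_minimal)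
  then show ?thesis by (auto simp: Omega_def j_hom)
qed

text \<open>Cancellation in B comes from \<open>\<iota>\<close>: among the quasimultipliers of A the
  product \<open>j v * x\<close> is a fraction with numerator \<open>v * v * q\<close>, and if it is
  \<open>0\<close>, cancelling \<open>v\<close> in A leaves \<open>q = 0\<close>.\<close>

lemma j_cancel:
  assumes v: "v \<in> Omega UNIV" and x: "j v * x = 0"
  shows "x = 0"
proof -
  obtain q w where w: "w \<in> Omega UNIV" and q: "\<iota> x = qm_quot UNIV q w"
  proof -
    have "\<iota> x \<in> QM UNIV" using iota(2) by blast
    then show ?thesis using that unfolding QM_def by blast
  qed
  have elem: "qm_of_elem y = qm_quot UNIV (y * v) v" for y
    using A.Omega_cancel[OF v] by (auto simp: qm_of_elem_def qm_quot_def mult.assoc mult.left_commute)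
  have "\<iota> (j v * x) = qm_quot UNIV (v * v * q) (v * w)"
    unfolding iota(3,4) elem q using v w by (simp add: A.qm_mult_quot)
  moreover have "\<iota> 0 = qm_quot UNIV 0 v"
    using iota(4)[of 0] elem[of 0] by (simp add: j_0)
  ultimately have "v * v * q * v = 0"
    using x v w A.qm_quot_eq_iff[of "v * v * q" "v * w" 0 v] A.Omega_mult[of v w] by simp
  then have "v * (v * (v * q)) = 0" by (simp add: mult_ac)
  then have "q = 0" using A.Omega_mult_eq_0[OF v] by simp
  then have "\<iota> x = \<iota> 0"
    using q \<open>\<iota> 0 = qm_quot UNIV 0 v\<close> v w by (simp add: A.qm_quot_eq_iff)
  then show "x = 0" using iota(1) by (auto dest: injD)
qed

lemma B_cancel: "weakly_cancellative (UNIV :: 'b set)"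
  unfolding weakly_cancellative_def
proof
  fix x :: 'b assume "x \<in> UNIV - {0}"
  obtain v :: 'a where "v \<in> Omega UNIV" using A_dpi by (auto simp: dense_principal_ideals_def)
  then have "x * j v \<noteq> 0" using j_cancel[of v x] \<open>x \<in> UNIV - {0}\<close> by (auto simp: B_comm)
  then show "range ((*) x) \<noteq> {0}" by blast
qed

end

sublocale normalized_semigroup \<subseteq> B: qm_algebra "UNIV :: 'b set"
  by unfold_locales (auto intro: csubalgebra_UNIV B_cancel B_comm)

section \<open>Transfer of multipliers between A and B\<close>

context normalized_semigroup
begin

lemma qm_lift_quot:
  assumes v: "v \<in> Omega UNIV"
  shows "qm_lift j (qm_quot UNIV u v) = qm_quot UNIV (j u) (j v)"
  unfolding qm_lift_def
proof (rule the_equality)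
  show "\<exists>u'. \<exists>v'\<in>Omega UNIV. qm_quot UNIV u v = qm_quot UNIV u' v' \<and> qm_quot UNIV (j u) (j v) = qm_quot UNIV (j u') (j v')"
    using v by blast
next
  fix Q assume "\<exists>u'. \<exists>v'\<in>Omega UNIV. qm_quot UNIV u v = qm_quot UNIV u' v' \<and> Q = qm_quot UNIV (j u') (j v')"
  then obtain u' v' where *: "v' \<in> Omega UNIV" "u * v' = u' * v" "Q = qm_quot UNIV (j u') (j v')"
    using v by (auto simp: A.qm_quot_eq_iff)
  have "j u * j v' = j u' * j v" using arg_cong[OF *(2), of j] by (simp add: j_hom)
  then show "Q = qm_quot UNIV (j u) (j v)"
    unfolding *(3) using v *(1) by (simp add: B.qm_quot_eq_iff j_Omega)
qed

abbreviation lift :: "'a multiplier \<Rightarrow> 'b multiplier" where "lift \<equiv> multiplier_lift j"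

lemma lift_spec: "qm_of_multiplier (lift R) = qm_lift j (qm_of_multiplier R)" "norm (lift R) \<le> norm R"
proof -
  obtain R' where R': "qm_of_multiplier R' = qm_lift j (qm_of_multiplier R)" "norm R' \<le> norm R"
    using normalization unfolding normalization_def by blast
  then have "lift R = R'"
    unfolding multiplier_lift_def by (intro the_equality qm_of_multiplier_inj) auto
  with R' show "qm_of_multiplier (lift R) = qm_lift j (qm_of_multiplier R)" "norm (lift R) \<le> norm R"
    by auto
qed

text \<open>The definite description behind \<open>lift\<close> is evaluated at the fraction
  \<open>R v / v\<close>, and \<open>j v\<close> is cancelled. The resulting intertwining relation
  replaces graphs from here on: algebraic laws of \<open>lift\<close> are checked on the dense range
  of \<open>j\<close>.\<close>

lemma lift_j: "multiplier_apply (lift R) (j x) = j (multiplier_apply R x)"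
proof -
  obtain v :: 'a where v: "v \<in> Omega UNIV" using A_dpi by (auto simp: dense_principal_ideals_def)
  have "qm_of_multiplier (lift R) = qm_quot UNIV (j (multiplier_apply R v)) (j v)"
    by (simp add: lift_spec qm_of_multiplier_eq_quot[OF A.qm_algebra_axioms v] qm_lift_quot v)
  moreover have "(j x, multiplier_apply (lift R) (j x)) \<in> qm_of_multiplier (lift R)"
    by (auto simp: qm_of_multiplier_def)
  ultimately have "j v * multiplier_apply (lift R) (j x) = j (multiplier_apply R v) * j x"
    by (simp add: qm_quot_def)
  also have "\<dots> = j v * j (multiplier_apply R x)"
    by (metis j_hom(2) multiplier_mult mult.commute)
  finally show ?thesis using B.Omega_cancel[OF j_Omega[OF v]] by simp
qed

lemma multiplier_eqI_j:
  assumes "\<And>x. multiplier_apply R (j x) = multiplier_apply R' (j x)"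
  shows "R = R'"
proof (rule multiplier_eqI, rule dense_extension_eq[OF j_hom(5), of "multiplier_apply R" "multiplier_apply R'"])
qed (use assms in \<open>auto intro: linear_continuous_on bounded_linear_multiplier_apply\<close>)

lemma lift_hom: "lift (R + R') = lift R + lift R'" "lift (R - R') = lift R - lift R'"
  "lift (R * R') = lift R * lift R'" "lift (c *\<^sub>C R) = c *\<^sub>C lift R"
proof -
  have diff: "j (x - y) = j x - j y" for x y
    by (rule linear_diff[OF bounded_linear.linear[OF bounded_linear_j]])
  show "lift (R + R') = lift R + lift R'" "lift (R - R') = lift R - lift R'"
    "lift (R * R') = lift R * lift R'" "lift (c *\<^sub>C R) = c *\<^sub>C lift R"
    by (rule multiplier_eqI_j; simp add: lift_j j_hom diff)+
qed

lemma bounded_linear_lift: "bounded_linear lift"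
  by (rule bounded_linear_intro[where K = 1])
    (auto simp: lift_hom lift_spec simp flip: scaleC_of_real)

lemma B_multiplier_comm: "R * R' = R' * (R :: 'b multiplier)"
  by (rule multiplier_commute[OF B_comm B_cancel])

text \<open>For a map \<open>F\<close> with \<open>F (x y) = F x y\<close> this is the quasimultiplier of \<open>\<A>\<close> which \<open>F\<close>
  extends to \<open>\<B>\<close>.\<close>

definition pullback :: "('b \<Rightarrow> 'b) \<Rightarrow> 'a rel" where
  "pullback F = {(x, y). j y = F (j x)}"

text \<open>A common denominator: multiplication by its image carries B into the range of
  \<open>j\<close>, so every map of B that commutes with multiplication turns into a fraction over
  A.\<close>

definition regulator :: 'a where
  "regulator = (SOME p. QM_homomorphism j p)"

lemma regulator: "regulator \<in> Omega UNIV" "\<exists>y. j regulator * x = j y"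
proof -
  have "QM_homomorphism j regulator"
    unfolding regulator_def by (rule someI_ex[OF ex_QM_homomorphism])
  then have "regulator \<in> Omega UNIV" "j regulator * x \<in> range j"
    unfolding QM_homomorphism_def by blast+
  then show "regulator \<in> Omega UNIV" "\<exists>y. j regulator * x = j y" by auto
qed

text \<open>One factor of the denominator brings \<open>F (j regulator)\<close> back into the range
  of \<open>j\<close>; the other comes from
  \<open>F (j regulator) * j x = j regulator * F (j x)\<close>.\<close>

lemma pullback_eq_quot:
  assumes F: "\<And>x y. F (x * y) = F x * y"
  obtains q where "j q = j regulator * F (j regulator)"
    "pullback F = qm_quot UNIV q (regulator * regulator)"
proof -
  let ?p = regulator
  obtain q where q: "j q = j ?p * F (j ?p)" using regulator(2) by metis
  have pp: "j ?p * j ?p \<in> Omega UNIV" using regulator(1) by (intro B.Omega_mult j_Omega)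
  have "(x, y) \<in> pullback F \<longleftrightarrow> (x, y) \<in> qm_quot UNIV q (?p * ?p)" for x y
  proof -
    have "F (j ?p) * j x = j ?p * F (j x)" by (metis F B_comm)
    then have "j q * j x = j ?p * j ?p * F (j x)"
      by (simp add: q mult.assoc)
    then have "(x, y) \<in> qm_quot UNIV q (?p * ?p) \<longleftrightarrow> j ?p * j ?p * j y = j ?p * j ?p * F (j x)"
      by (simp add: qm_quot_def j_hom flip: j_eq_iff)
    then show ?thesis using B.Omega_cancel[OF pp] by (auto simp: pullback_def)
  qed
  then have "pullback F = qm_quot UNIV q (?p * ?p)" by auto
  with q show ?thesis by (rule that)
qed

lemma pullback_in_QM:
  assumes "\<And>x y. F (x * y) = F x * y"
  shows "pullback F \<in> QM UNIV"
  using pullback_eq_quot[OF assms] regulator(1) by (metis A.qm_quot_in_QM A.Omega_mult UNIV_I)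

text \<open>The relational composition of the two pullbacks may have a smaller domain than
  \<open>pullback (F \<circ> G)\<close>, whereas the product of quasimultipliers is taken on
  fractions. Hence the comparison by cross multiplication over the common denominator.\<close>

lemma pullback_mult:
  assumes F: "\<And>x y. F (x * y) = F x * y" and G: "\<And>x y. G (x * y) = G x * y"
  shows "qm_mult UNIV (pullback F) (pullback G) = pullback (F \<circ> G)"
proof -
  let ?p = regulator
  have FG: "(F \<circ> G) (x * y) = (F \<circ> G) x * y" for x y by (simp add: F G)
  obtain q where q: "j q = j ?p * F (j ?p)" "pullback F = qm_quot UNIV q (?p * ?p)"
    by (rule pullback_eq_quot[OF F])
  obtain r where r: "j r = j ?p * G (j ?p)" "pullback G = qm_quot UNIV r (?p * ?p)"
    by (rule pullback_eq_quot[OF G])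
  obtain s where s: "j s = j ?p * (F \<circ> G) (j ?p)" "pullback (F \<circ> G) = qm_quot UNIV s (?p * ?p)"
    by (rule pullback_eq_quot[OF FG])
  have "j q * j r = j ?p * j ?p * (F (j ?p) * G (j ?p))"
    by (simp add: q r mult.assoc B_left_comm[of "F (j ?p)"])
  also have "F (j ?p) * G (j ?p) = F (G (j ?p)) * j ?p" by (metis F B_comm)
  also have "j ?p * j ?p * \<dots> = j s * (j ?p * j ?p)"
    by (simp add: s mult.assoc B_left_comm[of "F (G (j ?p))"])
  finally have "j (q * r * (?p * ?p)) = j (s * (?p * ?p * (?p * ?p)))"
    by (simp add: j_hom flip: mult.assoc)
  then have "q * r * (?p * ?p) = s * (?p * ?p * (?p * ?p))" by (simp only: j_eq_iff)
  then show ?thesis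
    unfolding q(2) r(2) s(2) using regulator(1) by (simp add: A.qm_mult_quot A.qm_quot_eq_iff)
qed

lemma pullback_scale:
  assumes F: "\<And>x y. F (x * y) = F x * y"
  shows "qm_scale UNIV c (pullback F) = pullback (\<lambda>x. c *\<^sub>C F x)"
proof -
  let ?p = regulator
  have cF: "c *\<^sub>C F (x * y) = c *\<^sub>C F x * y" for x y by (simp add: F mult_scaleC_left)
  obtain q where q: "j q = j ?p * F (j ?p)" "pullback F = qm_quot UNIV q (?p * ?p)"
    by (rule pullback_eq_quot[OF F])
  obtain s where s: "j s = j ?p * (c *\<^sub>C F (j ?p))" "pullback (\<lambda>x. c *\<^sub>C F x) = qm_quot UNIV s (?p * ?p)"
    by (rule pullback_eq_quot[OF cF])
  have "j s = j (c *\<^sub>C q)" by (simp add: s q j_hom mult_scaleC_right)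
  then have "s = c *\<^sub>C q" by (simp only: j_eq_iff)
  then show ?thesis
    unfolding q(2) s(2) using regulator(1) by (simp add: A.qm_scale_quot)
qed

lemma pullback_id: "pullback (\<lambda>x. x) = Id_on UNIV"
  by (auto simp: pullback_def j_eq_iff)

lemma funpow_multiplier: "(multiplier_apply R ^^ n) (x * y) = (multiplier_apply R ^^ n) x * y"
  by (induction n) (auto simp: multiplier_mult)

lemma pullback_power:
  "qm_power UNIV (pullback (multiplier_apply R)) n = pullback (multiplier_apply R ^^ n)"
proof (induction n)
  case 0
  then show ?case by (simp add: pullback_id id_def)
next
  case (Suc n)
  then show ?case by (simp add: pullback_mult multiplier_mult funpow_multiplier comp_def)
qed

text \<open>Makes \<open>pullback\<close> the inclusion of M(B) in QM(A) under the identification by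
  \<open>qm_lift j\<close>.\<close>

lemma lift_pullback: "qm_lift j (pullback (multiplier_apply R)) = qm_of_multiplier R"
proof -
  let ?p = regulator
  have pp: "?p * ?p \<in> Omega UNIV" using regulator(1) by simp
  obtain q where q: "j q = j ?p * multiplier_apply R (j ?p)" "pullback (multiplier_apply R) = qm_quot UNIV q (?p * ?p)"
    by (rule pullback_eq_quot[OF multiplier_mult])
  have "j q = multiplier_apply R (j (?p * ?p))"
    by (metis q(1) j_hom(2) multiplier_mult B_comm)
  then show ?thesis
    using pp by (simp add: q(2) qm_lift_quot qm_of_multiplier_eq_quot[OF B.qm_algebra_axioms j_Omega[OF pp]])
qed

text \<open>Inverting \<open>j\<close> gives no evident bound in the norm of A. The map from
  \<open>x\<close> to the preimage of \<open>j regulator * x\<close> is however defined on all of B,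
  and its graph is closed because \<open>j\<close> is continuous and injective.\<close>

lemma regulator_bounded: "\<exists>C. \<forall>x y. j y = j regulator * x \<longrightarrow> norm y \<le> C * norm x"
proof -
  let ?p = regulator
  obtain L where L: "\<And>x. j ?p * x = j (L x)" using regulator(2) by metis
  have "bounded_linear L"
  proof (rule closed_graph_theorem)
    show "linear L"
    proof (rule linearI)
      have "j (L (x + y)) = j (L x + L y)" for x y by (simp add: j_hom(1) distrib_left flip: L)
      then show "L (x + y) = L x + L y" for x y by (simp only: j_eq_iff)
      have "j (L (r *\<^sub>R x)) = j (r *\<^sub>R L x)" for r x
        by (simp add: linear_scale[OF bounded_linear.linear[OF bounded_linear_j]] flip: L)
      then show "L (r *\<^sub>R x) = r *\<^sub>R L x" for r x by (simp only: j_eq_iff)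
    qed
    fix s x y assume s: "s \<longlonglongrightarrow> x" "(\<lambda>n. L (s n)) \<longlonglongrightarrow> y"
    have "(\<lambda>n. j (L (s n))) \<longlonglongrightarrow> j y" by (rule bounded_linear.tendsto[OF bounded_linear_j s(2)])
    moreover have "(\<lambda>n. j (L (s n))) \<longlonglongrightarrow> j (L x)"
      unfolding L[symmetric] by (intro tendsto_intros s)
    ultimately have "j y = j (L x)" by (rule LIMSEQ_unique)
    then show "y = L x" by (simp only: j_eq_iff)
  qed
  then obtain C where C: "\<And>x. norm (L x) \<le> norm x * C" using bounded_linear.bounded by blast
  have "norm y \<le> C * norm x" if "j y = j ?p * x" for x y
    using that C[of x] by (simp add: L j_eq_iff mult.commute)
  then show ?thesis by blast
qed

lemma norm_funpow_multiplier: "norm ((multiplier_apply R ^^ n) x) \<le> norm R ^ n * norm x"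
proof (induction n)
  case (Suc n)
  have "norm ((multiplier_apply R ^^ Suc n) x) \<le> norm R * norm ((multiplier_apply R ^^ n) x)"
    by (simp add: norm_multiplier_apply)
  also have "\<dots> \<le> norm R * (norm R ^ n * norm x)" by (intro mult_left_mono Suc) simp
  finally show ?case by (simp add: mult_ac)
qed simp

lemma pullback_regular: "pullback (multiplier_apply R) \<in> QM_reg UNIV"
proof -
  let ?p = regulator
  \<comment> \<open>Chosen so that \<open>r ^ n * norm R ^ n\<close> is at most \<open>1\<close>;
    the summand \<open>1\<close> admits \<open>R = 0\<close>.\<close>
  define r where "r = 1 / (norm R + 1)"
  have r: "r > 0" "r * norm R \<le> 1" by (auto simp: r_def add_nonneg_pos divide_le_eq)
  obtain C where C: "\<And>x y. j y = j ?p * x \<Longrightarrow> norm y \<le> C * norm x" using regulator_bounded by blast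
  define F where "F n x = of_real (r ^ n) *\<^sub>C (multiplier_apply R ^^ n) x" for n x
  have F_mult: "F n (x * y) = F n x * y" for n x y
    by (simp add: F_def funpow_multiplier mult_scaleC_left)
  have F_le: "norm (F n x) \<le> norm x" for n x
  proof -
    have "norm (F n x) = r ^ n * norm ((multiplier_apply R ^^ n) x)"
      using r by (simp add: F_def norm_scaleC norm_power)
    also have "\<dots> \<le> r ^ n * (norm R ^ n * norm x)"
      using r by (intro mult_left_mono norm_funpow_multiplier) auto
    also have "\<dots> = (r * norm R) ^ n * norm x" by (simp add: power_mult_distrib)
    also have "\<dots> \<le> 1 * norm x"
      using r by (intro mult_right_mono power_le_one) auto
    finally show ?thesis by simp
  qed
  have eq: "qm_scale UNIV (of_real (r ^ n)) (qm_power UNIV (pullback (multiplier_apply R)) n) = pullback (F n)" for n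
    unfolding pullback_power F_def by (rule pullback_scale[OF funpow_multiplier])
  \<comment> \<open>The square of the regulator lies in all domains at once: one factor supplies a
    preimage under \<open>j\<close>, and the norm of that preimage in A is controlled by the norm of
    \<open>F n (j ?p)\<close> in B.\<close>
  have bdd: "?p * ?p \<in> Domain (pullback (F n)) \<and> norm (qm_apply (pullback (F n)) (?p * ?p)) \<le> \<bar>C\<bar> * norm (j ?p)" for n
  proof -
    obtain y where y: "j y = j ?p * F n (j ?p)" using regulator(2) by metis
    have "j y = F n (j (?p * ?p))" unfolding y by (metis F_mult B_comm j_hom(2))
    then have mem: "(?p * ?p, y) \<in> pullback (F n)" by (simp add: pullback_def)
    have "qm_apply (pullback (F n)) (?p * ?p) = y"
      unfolding qm_apply_def using mem by (intro the_equality) (auto simp: pullback_def j_eq_iff simp flip: \<open>j y = F n (j (?p * ?p))\<close>)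
    moreover have "norm y \<le> \<bar>C\<bar> * norm (j ?p)"
      using C[OF y] mult_mono[OF abs_ge_self[of C] F_le[of n "j ?p"]] by simp
    ultimately show ?thesis using mem by blast
  qed
  have "pseudobounded UNIV {pullback (F n) | n. n \<ge> 1}"
    unfolding pseudobounded_def
  proof
    show "{pullback (F n) | n. n \<ge> 1} \<subseteq> QM UNIV" using pullback_in_QM[of "F n" for n, OF F_mult] by auto
    show "\<exists>u\<in>Omega UNIV. (\<forall>S\<in>{pullback (F n) | n. n \<ge> 1}. u \<in> Domain S) \<and>
        (\<exists>M. \<forall>S\<in>{pullback (F n) | n. n \<ge> 1}. norm (qm_apply S u) \<le> M)"
      using bdd regulator(1) by (intro bexI[of _ "?p * ?p"]) auto
  qed
  then have "pseudobounded UNIV {qm_scale UNIV (of_real (r ^ n)) (qm_power UNIV (pullback (multiplier_apply R)) n) | n. n \<ge> 1}"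
    by (simp only: eq)
  then show ?thesis
    unfolding QM_reg_def using pullback_in_QM[of "multiplier_apply R", OF multiplier_mult] r(1) by blast
qed

end

subsection \<open>The resolvent\<close>

context normalized_semigroup
begin

abbreviation U :: "complex \<Rightarrow> 'b multiplier" where "U z \<equiv> lift (T z)"
abbreviation U' :: "complex \<Rightarrow> 'b multiplier" where "U' z \<equiv> lift (T' z)"

lemma U_add: "z \<in> S \<Longrightarrow> w \<in> S \<Longrightarrow> U (z + w) = U z * U w"
  and U'_add: "z \<in> S \<Longrightarrow> w \<in> S \<Longrightarrow> U' (z + w) = U' z * U w"
  by (simp_all add: T_add T'_add lift_hom)

lemma U_deriv: "z \<in> S \<Longrightarrow> has_cderiv U (U' z) z"
  by (rule has_cderiv_linear[OF T_deriv bounded_linear_lift lift_hom(4)])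

lemma isCont_U: "z \<in> S \<Longrightarrow> isCont U z"
  by (rule has_cderiv_isCont[OF U_deriv])

lemma U_right_cancel:
  assumes z: "z \<in> S" and eq: "x * U z = y * U z"
  shows "x = y"
proof (rule multiplier_eqI_j)
  fix v
  show "multiplier_apply x (j v) = multiplier_apply y (j v)"
  proof (rule dense_extension_eq[OF T_dense[OF z], of "\<lambda>v. multiplier_apply x (j v)" "\<lambda>v. multiplier_apply y (j v)"])
    fix v assume "v \<in> range (multiplier_apply (T z))"
    then obtain w where "j v = multiplier_apply (U z) (j w)" by (auto simp: lift_j)
    then show "multiplier_apply x (j v) = multiplier_apply y (j v)"
      using eq by (metis multiplier_apply_simps(3))
  qed (intro linear_continuous_on bounded_linear_compose[OF bounded_linear_multiplier_apply bounded_linear_j])+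
qed

lemma U_ray_continuous:
  assumes "z \<in> S"
  shows "continuous_on {0<..} (\<lambda>t. U (of_real t * z))"
proof (rule continuous_at_imp_continuous_on, rule ballI)
  fix t :: real assume "t \<in> {0<..}"
  then have "isCont U (of_real t * z)" using assms by (intro isCont_U sector_scale) auto
  moreover have "isCont (\<lambda>t. of_real t * z) t" by (intro continuous_intros)
  ultimately show "isCont (\<lambda>t. U (of_real t * z)) t" by (rule isCont_o2[rotated])
qed

text \<open>Here the boundedness of a normalization at \<open>0\<close> enters: a smaller sector
  around the ray gives the bound for small \<open>t\<close>, compactness gives it on the
  rest.\<close>

lemma U_bounded:
  assumes z: "z \<in> S"
  obtains C where "C \<ge> 0" "\<And>t. 0 < t \<Longrightarrow> t \<le> N \<Longrightarrow> norm (U (of_real t * z)) \<le> C"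
proof -
  obtain \<alpha> \<beta> where *: "a < \<alpha>" "\<alpha> < \<beta>" "\<beta> < b" "z \<in> sector \<alpha> \<beta>" by (rule sector_ray[OF z])
  have "z \<noteq> 0" using z by (simp add: sector_def)
  have "Limsup (at 0 within sector \<alpha> \<beta>) (\<lambda>\<zeta>. ereal (norm (U \<zeta>))) < \<infinity>"
    using normalization * unfolding normalization_def by blast
  then obtain n :: nat where "Limsup (at 0 within sector \<alpha> \<beta>) (\<lambda>\<zeta>. ereal (norm (U \<zeta>))) < ereal (real n)"
    using less_PInf_Ex_of_nat by (metis less_irrefl)
  from Limsup_lessD[OF this] obtain d where d: "d > 0"
    "\<And>x. x \<in> sector \<alpha> \<beta> \<Longrightarrow> x \<noteq> 0 \<Longrightarrow> dist x 0 < d \<Longrightarrow> norm (U x) < real n"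
    unfolding eventually_at by auto
  have near: "norm (U (of_real t * z)) \<le> real n" if "0 < t" "t < d / norm z" for t
    using d(2)[OF sector_scale[OF *(4) that(1)]] that \<open>z \<noteq> 0\<close> by (simp add: norm_mult field_simps)
  have "compact ((\<lambda>t. U (of_real t * z)) ` {d / norm z..N})"
    using d(1) \<open>z \<noteq> 0\<close>
    by (intro compact_continuous_image continuous_on_subset[OF U_ray_continuous[OF z]])
      (auto intro: less_le_trans[of 0 "d / norm z"])
  from compact_imp_bounded[OF this]
  obtain M where "\<forall>y\<in>(\<lambda>t. U (of_real t * z)) ` {d / norm z..N}. norm y \<le> M"
    unfolding bounded_iff by blast
  then have M: "norm (U (of_real t * z)) \<le> M" if "t \<in> {d / norm z..N}" for t
    using that by blast
  have "norm (U (of_real t * z)) \<le> max M (real n)" if "0 < t" "t \<le> N" for t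
    using near[OF that(1)] M[of t] that(2) by (cases "t < d / norm z") (auto simp: le_max_iff_disj)
  then show ?thesis using that[of "max M (real n)"] by (simp add: le_max_iff_disj)
qed

lemma exp_minus_of_real: "exp (- of_real t) = (of_real (exp (- t)) :: complex)"
  by (simp flip: exp_of_real)

lemma exp_minus_in_S: "z \<in> S \<Longrightarrow> exp (- of_real t) * z \<in> S"
  unfolding exp_minus_of_real by (rule sector_scale) auto

lemma U_resolvent_shift:
  assumes "w \<in> S" "z \<in> S"
  shows "U w * (U' z - \<mu> *\<^sub>C U z) = U' (w + z) - \<mu> *\<^sub>C U (w + z)"
proof -
  have "U w * U' z = U' (w + z)"
    using U'_add[OF assms(2,1)] by (simp add: B_multiplier_comm add.commute)
  then show ?thesis by (simp add: right_diff_distrib mult_scaleC_right U_add assms)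
qed

text \<open>Up to a constant, \<open>c\<close> is the integrating factor
  \<open>exp (- \<mu> * g)\<close>. The derivative is then \<open>g' * c\<close> times the value of
  \<open>U' - \<mu> U\<close> at \<open>g + z\<close>, from which \<open>U g\<close> splits off. It
  serves both the segment from \<open>\<zeta>\<close> to \<open>0\<close> and the ray to
  infinity.\<close>

lemma resolvent_ray_deriv:
  assumes z: "z \<in> S" and w: "g (of_real t) \<in> S"
    and g: "(g has_field_derivative g') (at (of_real t))"
    and c: "(c has_field_derivative - \<mu> * g' * c (of_real t)) (at (of_real t))"
  shows "((\<lambda>t. c (of_real t) *\<^sub>C U (g (of_real t) + z)) has_vector_derivative
      ((g' * c (of_real t)) *\<^sub>C U (g (of_real t))) * (U' z - \<mu> *\<^sub>C U z)) (at t)"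
proof -
  have gz: "((\<lambda>t. g (of_real t) + z) has_vector_derivative g') (at t)"
    using has_vector_derivative_add[OF has_vector_derivative_real_field[OF g] has_vector_derivative_const[of z]] by simp
  have "((\<lambda>t. U (g (of_real t) + z)) has_vector_derivative g' *\<^sub>C U' (g (of_real t) + z)) (at t)"
    by (rule has_cderiv_chain_real[OF U_deriv gz]) (use w z in simp)
  from has_vector_derivative_scaleC[OF has_vector_derivative_real_field[OF c] this]
  show ?thesis
    by (rule has_vector_derivative_eq_rhs)
      (simp add: mult_scaleC_left U_resolvent_shift[OF w z] scaleC.scale_right_diff_distrib mult_ac)
qed

text \<open>This is \<open>V (\<Delta> - \<mu>) = x - v\<close>, tested on every \<open>U z\<close>.
  Lying in the generated algebra is phrased as lying in every candidate \<open>X\<close>, which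
  passes directly through the induction on combinations.\<close>

definition comb_quotient :: "complex \<Rightarrow> 'a multiplier \<Rightarrow> complex \<Rightarrow> 'b multiplier \<Rightarrow> bool" where
  "comb_quotient \<mu> x v V \<longleftrightarrow>
    (\<forall>X. closed X \<longrightarrow> csubalgebra X \<longrightarrow> U ` S \<subseteq> X \<longrightarrow> V \<in> X) \<and>
    (\<forall>z\<in>S. V * (U' z - \<mu> *\<^sub>C U z) = lift x * U z - v *\<^sub>C U z)"

text \<open>The witness is \<open>V = \<Sum>c \<integral>\<^sub>0\<^sup>\<zeta> exp(\<mu> (\<zeta> - s)) U(s) ds\<close>; for a single \<open>\<zeta>\<close>, the substitution
  \<open>s = exp(-t) \<zeta>\<close> turns it into an integral over the half line.\<close>

lemma comb_factorization:
  assumes "comb x f"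
  shows "\<exists>V. comb_quotient \<mu> x (f \<mu>) V"
  using assms
proof (induction rule: comb.induct)
  case (base \<zeta>)
  \<comment> \<open>With \<open>s = g t\<close> the factor \<open>c\<close> is
    \<open>exp (\<mu> * (\<zeta> - s))\<close> and \<open>\<zeta> * e t\<close> is
    \<open>- ds/dt\<close>. This Jacobian supplies the exponential decay, since \<open>U\<close> is
    merely bounded as \<open>s\<close> tends to \<open>0\<close>.\<close>
  define e where "e w = exp (- w)" for w :: complex
  define g where "g w = e w * \<zeta>" for w
  define c where "c w = exp (\<mu> * \<zeta> * (1 - e w))" for w
  define G where "G t = (\<zeta> * e (of_real t) * c (of_real t)) *\<^sub>C U (g (of_real t))" for t :: real
  have e_eq: "e (of_real t) = of_real (exp (- t))" for t by (simp add: e_def exp_minus_of_real)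
  have gS: "g (of_real t) \<in> S" for t unfolding g_def e_def by (rule exp_minus_in_S[OF base])
  have g': "(g has_field_derivative - (\<zeta> * e w)) (at w)" for w
    unfolding g_def e_def by (auto intro!: derivative_eq_intros)
  have c': "(c has_field_derivative - \<mu> * - (\<zeta> * e w) * c w) (at w)" for w
    unfolding c_def e_def by (auto intro!: derivative_eq_intros)
  obtain C where C: "C \<ge> 0" "\<And>t. 0 < t \<Longrightarrow> t \<le> 1 \<Longrightarrow> norm (U (of_real t * \<zeta>)) \<le> C"
    by (rule U_bounded[OF base, of 1]) blast
  have cont: "continuous_on {0<..} G"
  proof -
    have "continuous_on {0<..} (\<lambda>t. U (of_real (exp (- t)) * \<zeta>))"
      by (rule continuous_on_compose2[OF U_ray_continuous[OF base]]) (auto intro!: continuous_intros)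
    then show ?thesis
      unfolding G_def g_def c_def e_eq by (intro continuous_intros)
  qed
  have bound: "norm (G t) \<le> (cmod \<zeta> * exp (cmod (\<mu> * \<zeta>)) * C) * exp (- 1 * t)" if "t > 0" for t
  proof -
    have "cmod (c (of_real t)) \<le> exp (cmod (\<mu> * \<zeta> * (1 - e (of_real t))))"
      unfolding c_def by (rule norm_exp)
    also have "1 - e (of_real t) = of_real (1 - exp (- t))" by (simp add: e_eq)
    also have "cmod (\<mu> * \<zeta> * of_real (1 - exp (- t))) = cmod (\<mu> * \<zeta>) * (1 - exp (- t))"
      using that by (simp only: norm_mult norm_of_real) simp
    also have "\<dots> \<le> cmod (\<mu> * \<zeta>) * 1" by (intro mult_left_mono) auto
    finally have 1: "cmod (c (of_real t)) \<le> exp (cmod (\<mu> * \<zeta>))" by simp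
    have "norm (G t) = cmod \<zeta> * exp (- t) * cmod (c (of_real t)) * norm (U (of_real (exp (- t)) * \<zeta>))"
      by (simp add: G_def norm_scaleC norm_mult e_eq g_def)
    also have "\<dots> \<le> cmod \<zeta> * exp (- t) * exp (cmod (\<mu> * \<zeta>)) * C"
      using that C 1 by (intro mult_mono) auto
    finally show ?thesis by (simp add: mult_ac)
  qed
  obtain V where V: "(\<lambda>n. integral {inverse (real (Suc n))..real (Suc n)} G) \<longlonglongrightarrow> V"
    "\<And>X. closed X \<Longrightarrow> subspace X \<Longrightarrow> (\<And>t. t > 0 \<Longrightarrow> G t \<in> X) \<Longrightarrow> V \<in> X"
    by (rule exp_dominated_integral[OF cont bound]) auto
  have "V \<in> X" if X: "closed X" "csubalgebra X" "U ` S \<subseteq> X" for X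
  proof (rule V(2)[OF X(1)])
    show "subspace X" using csubalgebraD[OF X(2)] by (auto simp: subspace_def)
    show "G t \<in> X" for t
      unfolding G_def using X(3) gS by (intro csubalgebraD(4)[OF X(2)]) auto
  qed
  moreover have "V * (U' z - \<mu> *\<^sub>C U z) = U \<zeta> * U z - exp (\<mu> * \<zeta>) *\<^sub>C U z" if z: "z \<in> S" for z
  proof -
    let ?D = "U' z - \<mu> *\<^sub>C U z"
    let ?H = "\<lambda>t::real. c (of_real t) *\<^sub>C U (g (of_real t) + z)"
    have H: "(?H has_vector_derivative - (G t * ?D)) (at t)" for t
      using resolvent_ray_deriv[OF z gS g' c'] by (simp add: G_def)
    \<comment> \<open>The sign is that of \<open>ds/dt\<close>: while \<open>t\<close> runs from
      \<open>0\<close> to infinity, \<open>s\<close> runs from \<open>\<zeta>\<close> down to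
      \<open>0\<close>.\<close>
    have Q: "bounded_linear (\<lambda>x. - (x * ?D))"
      by (intro bounded_linear_minus bounded_linear_mult_left)
    have g_lim: "((\<lambda>t. U (g (of_real t) + z)) \<longlongrightarrow> U (w + z)) F"
      if "((\<lambda>t. g (of_real t)) \<longlongrightarrow> w) F" "w + z \<in> S" for w F
      by (rule isCont_tendsto_compose[OF isCont_U[OF that(2)]]) (intro tendsto_intros that)
    have e0: "((\<lambda>t::real. e (of_real t)) \<longlongrightarrow> 1) (at_right 0)"
    proof -
      have "isCont (\<lambda>t::real. e (of_real t)) 0" unfolding e_def by (intro continuous_intros)
      then show ?thesis by (auto simp: isCont_def e_def intro: tendsto_within_subset)
    qed
    have e1: "((\<lambda>t::real. e (of_real t)) \<longlongrightarrow> 0) at_top"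
    proof -
      have "((\<lambda>t::real. exp (- t)) \<longlongrightarrow> 0) at_top"
        by (rule filterlim_compose[OF exp_at_bot filterlim_uminus_at_bot_at_top])
      then have "((\<lambda>t::real. complex_of_real (exp (- t))) \<longlongrightarrow> of_real 0) at_top" by (intro tendsto_of_real)
      then show ?thesis by (simp only: e_eq of_real_0)
    qed
    have "((\<lambda>t. g (of_real t)) \<longlongrightarrow> 1 * \<zeta>) (at_right 0)" unfolding g_def by (intro tendsto_intros e0)
    from g_lim[OF this] have g0: "((\<lambda>t. U (g (of_real t) + z)) \<longlongrightarrow> U (\<zeta> + z)) (at_right 0)"
      using base z by simp
    have "((\<lambda>t. g (of_real t)) \<longlongrightarrow> 0 * \<zeta>) at_top" unfolding g_def by (intro tendsto_intros e1)
    from g_lim[OF this] have g1: "((\<lambda>t. U (g (of_real t) + z)) \<longlongrightarrow> U z) at_top"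
      using z by simp
    have "(?H \<longlongrightarrow> exp (\<mu> * \<zeta> * (1 - 1)) *\<^sub>C U (\<zeta> + z)) (at_right 0)"
      unfolding c_def by (intro tendsto_intros e0 g0)
    moreover have "(?H \<longlongrightarrow> exp (\<mu> * \<zeta> * (1 - 0)) *\<^sub>C U z) at_top"
      unfolding c_def by (intro tendsto_intros e1 g1)
    ultimately have "- (V * ?D) = exp (\<mu> * \<zeta> * (1 - 0)) *\<^sub>C U z - exp (\<mu> * \<zeta> * (1 - 1)) *\<^sub>C U (\<zeta> + z)"
      by (rule improper_integral_FTC[OF cont V(1) Q H])
    then have "- (V * ?D) = exp (\<mu> * \<zeta>) *\<^sub>C U z - U \<zeta> * U z"
      by (simp add: U_add[OF base z])
    then show ?thesis by (metis minus_diff_eq minus_minus)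
  qed
  ultimately show ?case unfolding comb_quotient_def by blast
next
  case (add x f y g)
  from add.IH obtain V W where V: "comb_quotient \<mu> x (f \<mu>) V" and W: "comb_quotient \<mu> y (g \<mu>) W"
    by blast
  have "(V + W) * (U' z - \<mu> *\<^sub>C U z) = lift (x + y) * U z - (f \<mu> + g \<mu>) *\<^sub>C U z" if "z \<in> S" for z
    using V W that by (simp add: comb_quotient_def lift_hom distrib_right scaleC.scale_left_distrib)
  moreover have "V + W \<in> X" if "closed X" "csubalgebra X" "U ` S \<subseteq> X" for X
    using V W that by (simp add: comb_quotient_def csubalgebraD(2))
  ultimately show ?case unfolding comb_quotient_def by blast
next
  case (scale x f c)
  from scale.IH obtain V where V: "comb_quotient \<mu> x (f \<mu>) V" by blast
  have "(c *\<^sub>C V) * (U' z - \<mu> *\<^sub>C U z) = lift (c *\<^sub>C x) * U z - (c * f \<mu>) *\<^sub>C U z" if "z \<in> S" for z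
    using V that by (simp add: comb_quotient_def lift_hom mult_scaleC_left scaleC.scale_right_diff_distrib)
  moreover have "c *\<^sub>C V \<in> X" if "closed X" "csubalgebra X" "U ` S \<subseteq> X" for X
    using V that by (simp add: comb_quotient_def csubalgebraD(4))
  ultimately show ?case unfolding comb_quotient_def by blast
qed

section \<open>The resolvent among the multipliers of B\<close>

text \<open>The equation \<open>R (\<mu> - \<Delta>) = 1\<close> multiplied by \<open>U z\<close>,
  so that only bounded multipliers occur.\<close>

definition is_resolvent :: "complex \<Rightarrow> 'b multiplier \<Rightarrow> bool" where
  "is_resolvent \<mu> R \<longleftrightarrow> (\<forall>z\<in>S. R * (\<mu> *\<^sub>C U z - U' z) = U z)"

text \<open>Multipliers of B commute, so \<open>R'\<close> times \<open>R\<close> times the common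
  factor equals both \<open>R' * U z\<close> and \<open>R * U z\<close>. For \<open>R'\<close> a
  single \<open>z\<close> suffices, so a candidate needs to be checked at one point only.\<close>

lemma is_resolvent_unique:
  assumes R: "is_resolvent \<mu> R" and z: "z \<in> S" and R': "R' * (\<mu> *\<^sub>C U z - U' z) = U z"
  shows "R' = R"
proof (rule U_right_cancel[OF z])
  let ?D = "\<mu> *\<^sub>C U z - U' z"
  have "R' * U z = R' * (R * ?D)" using R z by (simp add: is_resolvent_def)
  also have "\<dots> = R * (R' * ?D)" by (metis B_multiplier_comm mult.assoc)
  finally show "R' * U z = R * U z" by (simp add: R')
qed

text \<open>If \<open>x\<close>, \<open>f\<close> witness that \<open>\<mu>\<close> is not in the spectrum, then \<open>f \<mu> - x\<close> is invertible in the
  unitization by a Neumann series, and \<open>V\<close> divided by it is the resolvent.\<close>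

lemma resolvent_exists:
  assumes \<mu>: "\<not> spectral \<mu>"
  obtains R where "is_resolvent \<mu> R"
    "\<And>X. closed X \<Longrightarrow> csubalgebra X \<Longrightarrow> U ` S \<subseteq> X \<Longrightarrow> R \<in> X"
proof -
  obtain x f where x: "comb x f" "norm x < cmod (f \<mu>)"
    using \<mu> by (auto simp: spectral_def not_le)
  obtain V where "comb_quotient \<mu> x (f \<mu>) V" using comb_factorization[OF x(1)] by blast
  then have V: "\<And>X. closed X \<Longrightarrow> csubalgebra X \<Longrightarrow> U ` S \<subseteq> X \<Longrightarrow> V \<in> X"
    and VD: "\<And>z. z \<in> S \<Longrightarrow> V * (U' z - \<mu> *\<^sub>C U z) = lift x * U z - f \<mu> *\<^sub>C U z"
    unfolding comb_quotient_def by blast+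
  have "f \<mu> \<noteq> 0" using x(2) by force
  define i where "i = inverse (f \<mu>)"
  define y where "y = i *\<^sub>C lift x"
  have "norm y = inverse (cmod (f \<mu>)) * norm (lift x)"
    unfolding y_def i_def by (simp only: norm_scaleC norm_inverse)
  also have "norm (lift x) < cmod (f \<mu>)" using x(2) lift_spec(2)[of x] by linarith
  then have "inverse (cmod (f \<mu>)) * norm (lift x) < 1"
    using mult_strict_left_mono[of "norm (lift x)" "cmod (f \<mu>)" "inverse (cmod (f \<mu>))"] \<open>f \<mu> \<noteq> 0\<close> by simp
  finally have y: "norm y < 1" .
  have lift_in: "lift x \<in> X" if "csubalgebra X" "U ` S \<subseteq> X" for X
    using x(1)
    by (induction rule: comb.induct) (use that csubalgebraD[OF that(1)] in \<open>auto simp: lift_hom\<close>)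
  \<comment> \<open>The hypothesis is \<open>(f \<mu> - x) R = V\<close> divided by
    \<open>f \<mu>\<close>, written without a unit.\<close>
  have solves: "is_resolvent \<mu> R" if R: "R = i *\<^sub>C V + y * R" for R
    unfolding is_resolvent_def
  proof
    fix z assume z: "z \<in> S"
    let ?D = "\<mu> *\<^sub>C U z - U' z"
    have "V * ?D = f \<mu> *\<^sub>C U z - lift x * U z"
      using VD[OF z] by (metis minus_diff_eq mult_minus_right)
    then have iVD: "(i *\<^sub>C V) * ?D = U z - y * U z"
      using \<open>f \<mu> \<noteq> 0\<close> by (simp add: mult_scaleC_left scaleC.scale_right_diff_distrib y_def i_def)
    have "R * ?D = (i *\<^sub>C V + y * R) * ?D" using R by simp
    also have "\<dots> = U z - y * U z + y * (R * ?D)"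
      by (simp only: distrib_right iVD mult.assoc)
    \<comment> \<open>The error \<open>R * ?D - U z\<close> is reproduced by multiplication with
      \<open>y\<close>, whose norm is below \<open>1\<close>, and must be \<open>0\<close>.\<close>
    finally have "R * ?D - U z = U z - y * U z + y * (R * ?D) - U z" by (rule arg_cong)
    also have "\<dots> = y * (R * ?D - U z)"
      unfolding right_diff_distrib[of y "R * ?D"] by simp
    finally have "R * ?D - U z = y * (R * ?D - U z)" .
    then have "norm (R * ?D - U z) \<le> norm y * norm (R * ?D - U z)"
      by (metis norm_mult_ineq)
    then have "(1 - norm y) * norm (R * ?D - U z) \<le> 0" by (simp add: left_diff_distrib)
    then show "R * ?D = U z" using y by (simp add: mult_le_0_iff)
  qed
  have in_X: "\<exists>R\<in>X. is_resolvent \<mu> R" if X: "closed X" "csubalgebra X" "U ` S \<subseteq> X" for X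
  proof -
    have "y \<in> X" "i *\<^sub>C V \<in> X"
      using lift_in[OF X(2,3)] V[OF X] by (auto simp: y_def csubalgebraD[OF X(2)])
    then obtain R where "R \<in> X" "R = i *\<^sub>C V + y * R" by (rule Neumann_solution[OF X(2,1) _ _ y])
    then show ?thesis using solves by blast
  qed
  obtain z where z: "z \<in> S" using sector_nonempty[OF ab(1)] by blast
  \<comment> \<open>The equation is solved in the full algebra and again in each \<open>X\<close>;
    uniqueness identifies the solutions, so one \<open>R\<close> lies in all of them.\<close>
  obtain R where R: "is_resolvent \<mu> R" using in_X[of UNIV] csubalgebra_UNIV by auto
  have "R \<in> X" if X: "closed X" "csubalgebra X" "U ` S \<subseteq> X" for X
    using in_X[OF X] is_resolvent_unique[OF R z] z by (metis is_resolvent_def)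
  with R show ?thesis by (rule that)
qed

definition resolvent :: "complex \<Rightarrow> 'b multiplier" where
  "resolvent \<mu> = (SOME R. is_resolvent \<mu> R)"

lemma resolvent: "\<not> spectral \<mu> \<Longrightarrow> is_resolvent \<mu> (resolvent \<mu>)"
  unfolding resolvent_def by (metis resolvent_exists someI_ex)

lemma resolvent_eqI:
  assumes "\<not> spectral \<mu>" "z \<in> S" "R * (\<mu> *\<^sub>C U z - U' z) = U z"
  shows "resolvent \<mu> = R"
  using is_resolvent_unique[OF resolvent] assms by metis

lemma resolvent_in_generated:
  assumes "\<not> spectral \<mu>"
  shows "resolvent \<mu> \<in> closed_subalgebra_generated (U ` S)"
proof -
  obtain R where R: "is_resolvent \<mu> R" "\<And>X. closed X \<Longrightarrow> csubalgebra X \<Longrightarrow> U ` S \<subseteq> X \<Longrightarrow> R \<in> X"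
    by (rule resolvent_exists[OF assms]) blast
  obtain z where z: "z \<in> S" using sector_nonempty[OF ab(1)] by blast
  have "resolvent \<mu> = R" using resolvent_eqI[OF assms z] R(1) z by (simp add: is_resolvent_def)
  then show ?thesis using R(2) by (auto simp: closed_subalgebra_generated_def hull_def)
qed

text \<open>Multiplied by \<open>U z\<close>, both sides become the product of the two resolvents
  with \<open>?D \<mu> - ?D \<nu>\<close>, in which \<open>U' z\<close> drops out.\<close>

lemma resolvent_identity:
  assumes "\<not> spectral \<mu>" "\<not> spectral \<nu>"
  shows "resolvent \<nu> - resolvent \<mu> = (\<mu> - \<nu>) *\<^sub>C (resolvent \<nu> * resolvent \<mu>)"
proof -
  obtain z where z: "z \<in> S" using sector_nonempty[OF ab(1)] by blast
  let ?R = "resolvent \<mu>" and ?N = "resolvent \<nu>"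
  let ?D = "\<lambda>\<mu>. \<mu> *\<^sub>C U z - U' z"
  have R: "?R * ?D \<mu> = U z" and N: "?N * ?D \<nu> = U z"
    using resolvent assms z by (auto simp: is_resolvent_def)
  have D: "?D \<mu> - ?D \<nu> = (\<mu> - \<nu>) *\<^sub>C U z" by (simp add: scaleC.scale_left_diff_distrib)
  have "(?N - ?R) * U z = ?N * (?R * ?D \<mu>) - ?R * (?N * ?D \<nu>)"
    by (simp only: R N left_diff_distrib)
  also have "?R * (?N * ?D \<nu>) = ?N * (?R * ?D \<nu>)" by (metis B_multiplier_comm mult.assoc)
  also have "?N * (?R * ?D \<mu>) - ?N * (?R * ?D \<nu>) = ?N * (?R * (?D \<mu> - ?D \<nu>))"
    by (simp only: right_diff_distrib)
  also have "\<dots> = ((\<mu> - \<nu>) *\<^sub>C (?N * ?R)) * U z"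
    by (simp only: D mult_scaleC_right mult_scaleC_left mult.assoc)
  finally show ?thesis by (rule U_right_cancel[OF z])
qed

text \<open>No bound for the resolvent near \<open>\<mu>\<close> is known beforehand. It is
  extracted from the resolvent identity, which for small \<open>h\<close> lets half of the norm of
  the shifted resolvent be absorbed; a second use of the identity makes the remainder quadratic in
  \<open>h\<close>.\<close>

lemma resolvent_deriv:
  assumes \<mu>: "\<not> spectral \<mu>"
  shows "has_cderiv resolvent (- (resolvent \<mu> * resolvent \<mu>)) \<mu>"
proof -
  let ?R = "resolvent \<mu>"
  define M where "M = norm ?R + 1"
  have M: "M > 0" "norm ?R \<le> M" by (auto simp: M_def add_nonneg_pos)
  have key: "norm (resolvent (\<mu> + h) - ?R - h *\<^sub>C (- (?R * ?R))) / norm h \<le> norm h * (2 * M * M * M)"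
    if h: "\<not> spectral (\<mu> + h)" "norm h < 1 / (2 * M)" for h
  proof -
    let ?N = "resolvent (\<mu> + h)"
    have id: "?N - ?R = (- h) *\<^sub>C (?N * ?R)" using resolvent_identity[OF \<mu> h(1)] by simp
    have hM: "norm h * M \<le> 1 / 2" using h(2) M by (simp add: field_simps)
    have diff: "norm (?N - ?R) \<le> norm h * (norm ?N * M)"
      unfolding id using order_trans[OF norm_mult_ineq[of ?N ?R] mult_left_mono[OF M(2)]]
      by (simp only: norm_scaleC norm_minus_cancel) (intro mult_left_mono, auto)
    have "norm ?N \<le> norm ?R + norm (?N - ?R)" by (metis norm_triangle_sub)
    also have "norm (?N - ?R) \<le> norm ?N * (norm h * M)" using diff by (simp add: mult_ac)
    also have "\<dots> \<le> norm ?N * (1 / 2)" by (intro mult_left_mono hM) simp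
    finally have "norm ?N \<le> 2 * M" using M by simp
    then have "norm h * (norm ?N * M) \<le> norm h * (2 * M * M)"
      using M by (intro mult_left_mono mult_right_mono) auto
    with diff have diff': "norm (?N - ?R) \<le> norm h * (2 * M * M)" by linarith
    have "?N - ?R - h *\<^sub>C (- (?R * ?R)) = (- h) *\<^sub>C ((?N - ?R) * ?R)"
      unfolding left_diff_distrib scaleC.scale_right_diff_distrib id[symmetric] by simp
    then have "norm (?N - ?R - h *\<^sub>C (- (?R * ?R))) = norm h * norm ((?N - ?R) * ?R)"
      by (simp only: norm_scaleC norm_minus_cancel)
    also have "\<dots> \<le> norm h * (norm (?N - ?R) * norm ?R)"
      by (intro mult_left_mono norm_mult_ineq) simp
    also have "\<dots> \<le> norm h * (norm h * (2 * M * M) * M)"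
      using M by (intro mult_left_mono mult_mono diff') auto
    finally show ?thesis by (cases "h = 0") (simp_all add: divide_le_eq mult_ac)
  qed
  have "open {\<mu>. \<not> spectral \<mu>}" using closed_spectral by (simp add: closed_open Compl_eq)
  then have "open ((\<lambda>h. \<mu> + h) -` {\<mu>. \<not> spectral \<mu>})" by (intro open_vimage continuous_intros)
  from eventually_at_in_open'[OF this, of 0] \<mu> have "\<forall>\<^sub>F h in at 0. \<not> spectral (\<mu> + h)" by simp
  moreover have "\<forall>\<^sub>F h in at (0::complex). norm h < 1 / (2 * M)"
    using M(1) by (auto simp: eventually_at intro!: exI[of _ "1 / (2 * M)"])
  ultimately have ev: "\<forall>\<^sub>F h in at 0. norm (norm (resolvent (\<mu> + h) - ?R - h *\<^sub>C (- (?R * ?R))) / norm h)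
      \<le> norm h * (2 * M * M * M)"
    by eventually_elim (use key in simp)
  have "((\<lambda>h::complex. norm h * (2 * M * M * M)) \<longlongrightarrow> 0) (at 0)"
    by (intro tendsto_mult_left_zero tendsto_norm_zero tendsto_ident_at)
  from Lim_null_comparison[OF ev this]
  have lim: "((\<lambda>h. norm (resolvent (\<mu> + h) - ?R - h *\<^sub>C (- (?R * ?R))) / norm h) \<longlongrightarrow> 0) (at 0)" .
  have "bounded_linear (\<lambda>h. h *\<^sub>C (- (?R * ?R)))"
    by (rule bounded_bilinear.bounded_linear_left[OF bounded_bilinear_scaleC])
  then show ?thesis
    unfolding has_cderiv_def has_derivative_at using lim by blast
qed

text \<open>Without denominators the claim is
  \<open>(\<mu> *\<^sub>C c - d) * q = c * (?p * ?p)\<close> in A. It is verified after applying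
  \<open>j\<close>: in B the resolvent can be moved from the factor \<open>j ?p\<close> to the other
  one, where the resolvent equation applies.\<close>

lemma resolvent_inverts_generator:
  assumes \<mu>: "\<not> spectral \<mu>"
  shows "qm_mult UNIV (qm_shift UNIV \<mu> (generator a b T)) (pullback (multiplier_apply (resolvent \<mu>))) = Id_on UNIV"
proof -
  let ?p = regulator
  obtain z where z: "z \<in> S" using sector_nonempty[OF ab(1)] by blast
  obtain u :: 'a where u: "u \<in> Omega UNIV" using A_dpi by (auto simp: dense_principal_ideals_def)
  define c where "c = multiplier_apply (T z) u"
  define d where "d = multiplier_apply (T' z) u"
  have c: "c \<in> Omega UNIV" unfolding c_def by (rule T_apply_Omega[OF z u])
  obtain q where q: "j q = j ?p * multiplier_apply (resolvent \<mu>) (j ?p)"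
    "pullback (multiplier_apply (resolvent \<mu>)) = qm_quot UNIV q (?p * ?p)"
    by (rule pullback_eq_quot[OF multiplier_mult])
  have Id: "Id_on UNIV = qm_quot UNIV u u" by (rule A.Id_on_eq_qm_quot[OF u])
  have "qm_shift UNIV \<mu> (generator a b T) = qm_quot UNIV (\<mu> *\<^sub>C u * c + (- 1) *\<^sub>C d * u) (u * c)"
    unfolding qm_shift_def generator_eq[OF z u] Id c_def[symmetric] d_def[symmetric]
    using u c by (simp add: A.qm_scale_quot A.qm_add_quot del: scaleC.scale_minus_left)
  then have prod: "qm_mult UNIV (qm_shift UNIV \<mu> (generator a b T)) (pullback (multiplier_apply (resolvent \<mu>)))
      = qm_quot UNIV ((\<mu> *\<^sub>C u * c + (- 1) *\<^sub>C d * u) * q) (u * c * (?p * ?p))"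
    unfolding q(2) using u c regulator(1) by (simp add: A.qm_mult_quot del: scaleC.scale_minus_left)
  let ?D = "\<mu> *\<^sub>C U z - U' z"
  have j_diff: "j (x - y) = j x - j y" for x y
    by (rule linear_diff[OF bounded_linear.linear[OF bounded_linear_j]])
  have jD: "j (\<mu> *\<^sub>C c - d) = multiplier_apply ?D (j u)"
    by (simp add: c_def d_def j_hom j_diff lift_j)
  have "resolvent \<mu> * ?D = U z" using resolvent[OF \<mu>] z by (simp add: is_resolvent_def)
  then have RD: "multiplier_apply (resolvent \<mu>) (multiplier_apply ?D (j u)) = j c"
    by (metis multiplier_apply_simps(3) lift_j c_def)
  have "j ((\<mu> *\<^sub>C c - d) * q) = multiplier_apply ?D (j u) * (j ?p * multiplier_apply (resolvent \<mu>) (j ?p))"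
    by (simp only: j_hom(2) jD q(1))
  also have "\<dots> = j ?p * (multiplier_apply ?D (j u) * multiplier_apply (resolvent \<mu>) (j ?p))"
    by (rule B_left_comm)
  also have "multiplier_apply ?D (j u) * multiplier_apply (resolvent \<mu>) (j ?p)
      = multiplier_apply (resolvent \<mu>) (multiplier_apply ?D (j u) * j ?p)"
    by (rule multiplier_mult_right[OF B_comm, symmetric])
  also have "\<dots> = j c * j ?p" by (simp only: multiplier_mult RD)
  also have "j ?p * (j c * j ?p) = j (c * (?p * ?p))" by (simp only: j_hom(2) B_left_comm[of "j ?p" "j c"])
  finally have "(\<mu> *\<^sub>C c - d) * q = c * (?p * ?p)" by (simp only: j_eq_iff)
  \<comment> \<open>Both factors \<open>u\<close> stem from writing the identity as
    \<open>u / u\<close>, once in the shift and once on the right-hand side.\<close>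
  then have "u * ((\<mu> *\<^sub>C c - d) * q) * u = u * (c * (?p * ?p)) * u" by simp
  moreover have "(\<mu> *\<^sub>C u * c + (- 1) *\<^sub>C d * u) * q * u = u * ((\<mu> *\<^sub>C c - d) * q) * u"
    by (simp add: mult_scaleC_left mult_scaleC_right algebra_simps)
  ultimately have "(\<mu> *\<^sub>C u * c + (- 1) *\<^sub>C d * u) * q * u = u * (u * c * (?p * ?p))"
    by (simp add: mult_ac)
  then show ?thesis
    unfolding prod Id using u c regulator(1) by (subst A.qm_quot_eq_iff) (auto simp del: scaleC.scale_minus_left)
qed

section \<open>Growth bound and Laplace transform\<close>

lemma growth_limit:
  assumes z: "z \<in> S"
  obtains L where "((\<lambda>t::real. ereal (ln (norm (T (of_real t * z))) / t)) \<longlongrightarrow> L) at_top"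
proof -
  define \<phi> where "\<phi> t = ln (norm (T (of_real t * z)))" for t :: real
  \<comment> \<open>A dense range in a nonzero algebra excludes
    \<open>T (of_real t * z) = 0\<close>, so the logarithm is never taken at
    \<open>0\<close>.\<close>
  have pos: "norm (T (of_real t * z)) > 0" if "t > 0" for t
    using T_nonzero[OF sector_scale[OF z that]] by simp
  have sub: "\<phi> (s + t) \<le> \<phi> s + \<phi> t" if "s > 0" "t > 0" for s t
  proof -
    have "T (of_real (s + t) * z) = T (of_real s * z) * T (of_real t * z)"
      using T_add[OF sector_scale[OF z that(1)] sector_scale[OF z that(2)]] by (simp add: distrib_right)
    then have "norm (T (of_real (s + t) * z)) \<le> norm (T (of_real s * z)) * norm (T (of_real t * z))"
      by (simp only: norm_mult_ineq)
    then have "\<phi> (s + t) \<le> ln (norm (T (of_real s * z)) * norm (T (of_real t * z)))"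
      unfolding \<phi>_def using pos[of "s + t"] pos that by (intro ln_mono) auto
    also have "\<dots> = \<phi> s + \<phi> t"
      unfolding \<phi>_def using pos[OF that(1)] pos[OF that(2)] by (rule ln_mult_pos)
    finally show ?thesis .
  qed
  have cont: "continuous_on {0<..} \<phi>"
  proof (rule continuous_at_imp_continuous_on, rule ballI)
    fix t :: real assume t: "t \<in> {0<..}"
    have "isCont T (of_real t * z)" using t z by (intro isCont_T sector_scale) auto
    moreover have "isCont (\<lambda>t. of_real t * z) t" by (intro continuous_intros)
    ultimately have "isCont (\<lambda>t. T (of_real t * z)) t" by (rule isCont_o2[rotated])
    then show "isCont \<phi> t"
      unfolding \<phi>_def using pos[of t] t by (intro continuous_intros) auto
  qed
  have "((\<lambda>t. ereal (\<phi> t / t)) \<longlongrightarrow> (INF t\<in>{0<..}. ereal (\<phi> t / t))) at_top"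
    using sub cont by (rule subadditive_limit)
  then show ?thesis unfolding \<phi>_def by (rule that)
qed

text \<open>An exponent \<open>k\<close> below \<open>Re (\<mu> * z)\<close> controls
  \<open>T\<close> for large \<open>t\<close>, the normalization controls \<open>U\<close> on
  bounded intervals. Glued together they bound \<open>U\<close> by \<open>K * exp (k * t)\<close> on
  the whole ray, and the integrand decays at the rate \<open>d = Re (\<mu> * z) - k\<close>.\<close>

lemma resolvent_half_plane:
  assumes z: "z \<in> S" and L: "((\<lambda>t::real. ereal (ln (norm (T (of_real t * z))) / t)) \<longlongrightarrow> L) at_top"
    and \<mu>: "ereal (Re (\<mu> * z)) > L"
  shows "\<not> spectral \<mu>"
    and "bochner_integral_eq (restrict_space lborel {0<..})
      (\<lambda>t. z *\<^sub>C (exp (- (of_real t * z * \<mu>)) *\<^sub>C multiplier_apply (U (of_real t * z)) x))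
      (multiplier_apply (resolvent \<mu>) x)"
    and "set_integrable lborel {0<..} (\<lambda>t. exp (- t * Re (\<mu> * z)) * norm (U (of_real t * z)))"
    and "norm (resolvent \<mu>) \<le> cmod z *
      (LINT t:{0<..}|lborel. exp (- t * Re (\<mu> * z)) * norm (U (of_real t * z)))"
proof -
  have "z \<noteq> 0" using z by (simp add: sector_def)
  obtain k where k: "L < ereal k" "k < Re (\<mu> * z)" using ereal_dense2[OF \<mu>] by auto
  have Re_mult_real: "Re (of_real r * w) = r * Re w" for r w by simp
  have "\<forall>\<^sub>F t in at_top. ln (norm (T (of_real t * z))) / t < k"
    using order_tendstoD(2)[OF L k(1)] by simp
  then obtain t0 where "\<And>t. t \<ge> t0 \<Longrightarrow> ln (norm (T (of_real t * z))) / t < k"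
    by (auto simp: eventually_at_top_linorder)
  then have T_le: "norm (T (of_real t * z)) \<le> exp (k * t)" if "t \<ge> max t0 1" for t
  proof -
    have t: "t > 0" using that by auto
    have "ln (norm (T (of_real t * z))) \<le> k * t"
      using \<open>\<And>t. t \<ge> t0 \<Longrightarrow> ln (norm (T (of_real t * z))) / t < k\<close>[of t] that t by (simp add: divide_less_eq)
    then have "exp (ln (norm (T (of_real t * z)))) \<le> exp (k * t)" by simp
    then show ?thesis using T_nonzero[OF sector_scale[OF z t]] by simp
  qed
  define t1 where "t1 = max t0 1"
  have t1: "t1 > 0" by (simp add: t1_def)
  show nspec: "\<not> spectral \<mu>"
  proof
    assume "spectral \<mu>"
    then have "cmod (exp (\<mu> * (of_real t1 * z))) \<le> norm (T (of_real t1 * z))"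
      using comb.base[OF sector_scale[OF z t1]] unfolding spectral_def by blast
    also have "\<dots> \<le> exp (k * t1)" by (rule T_le) (simp add: t1_def)
    finally have "Re (\<mu> * (of_real t1 * z)) \<le> k * t1" by (simp only: norm_exp_eq_Re exp_le_cancel_iff)
    moreover have "\<mu> * (of_real t1 * z) = of_real t1 * (\<mu> * z)" by (simp add: mult_ac)
    then have "Re (\<mu> * (of_real t1 * z)) = t1 * Re (\<mu> * z)" by (simp only: Re_mult_real)
    ultimately show False using k(2) t1 by (simp add: mult.commute)
  qed
  obtain C where C: "C \<ge> 0" "\<And>t. 0 < t \<Longrightarrow> t \<le> t1 \<Longrightarrow> norm (U (of_real t * z)) \<le> C"
    by (rule U_bounded[OF z, of t1]) blast
  \<comment> \<open>On \<open>{0<..t1}\<close> the factor \<open>exp (\<bar>k\<bar> * t1)\<close>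
    compensates \<open>exp (k * t)\<close> for either sign of \<open>k\<close>; the lower bound
    \<open>1\<close> serves the larger \<open>t\<close>.\<close>
  define K where "K = max 1 (C * exp (\<bar>k\<bar> * t1))"
  have U_le: "norm (U (of_real t * z)) \<le> K * exp (k * t)" if t: "t > 0" for t
  proof (cases "t \<le> t1")
    case True
    have "- (\<bar>k\<bar> * t1) \<le> k * t"
    proof -
      have "\<bar>k * t\<bar> \<le> \<bar>k\<bar> * t1" using t True by (simp add: abs_mult mult_left_mono)
      then show ?thesis by linarith
    qed
    then have "1 \<le> exp (\<bar>k\<bar> * t1) * exp (k * t)" by (simp flip: exp_add)
    then have "C * 1 \<le> C * (exp (\<bar>k\<bar> * t1) * exp (k * t))" using C(1) by (intro mult_left_mono)
    also have "\<dots> \<le> K * exp (k * t)" by (simp add: K_def mult.assoc[symmetric])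
    finally show ?thesis using C(2)[OF t True] by simp
  next
    case False
    have "norm (U (of_real t * z)) \<le> norm (T (of_real t * z))" by (rule lift_spec(2))
    also have "\<dots> \<le> 1 * exp (k * t)" using T_le[of t] False unfolding t1_def by linarith
    also have "\<dots> \<le> K * exp (k * t)" by (intro mult_right_mono) (auto simp: K_def)
    finally show ?thesis .
  qed
  define c where "c w = exp (- (w * z * \<mu>))" for w
  define G where "G t = (z * c (of_real t)) *\<^sub>C U (of_real t * z)" for t :: real
  define d where "d = Re (\<mu> * z) - k"
  have d: "d > 0" using k by (simp add: d_def)
  have norm_c: "cmod (c (of_real t)) = exp (- t * Re (\<mu> * z))" for t :: real
  proof -
    have "- (of_real t * z * \<mu>) = of_real (- t) * (\<mu> * z)" by (simp add: mult_ac)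
    then show ?thesis unfolding c_def by (simp only: norm_exp_eq_Re Re_mult_real)
  qed
  have norm_G: "norm (G t) = cmod z * (exp (- t * Re (\<mu> * z)) * norm (U (of_real t * z)))" for t
    by (simp add: G_def norm_scaleC norm_mult norm_c mult.assoc)
  have cont: "continuous_on {0<..} G"
    unfolding G_def c_def by (intro continuous_intros U_ray_continuous[OF z])
  have bound: "norm (G t) \<le> cmod z * K * exp (- d * t)" if "t > 0" for t
  proof -
    have "norm (G t) \<le> cmod z * (exp (- t * Re (\<mu> * z)) * (K * exp (k * t)))"
      unfolding norm_G by (intro mult_left_mono U_le that) auto
    also have "exp (- t * Re (\<mu> * z)) * (K * exp (k * t)) = K * exp (- d * t)"
      by (simp add: d_def algebra_simps flip: exp_add)
    finally show ?thesis by (simp add: mult.assoc)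
  qed
  obtain V where V: "(\<lambda>n. integral {inverse (real (Suc n))..real (Suc n)} G) \<longlonglongrightarrow> V"
    "set_integrable lborel {0<..} (\<lambda>t. norm (G t))"
    "norm V \<le> (LINT t:{0<..}|lborel. norm (G t))"
    by (rule exp_dominated_integral[OF cont bound d]) blast
  have V_eq: "resolvent \<mu> = V"
  proof (rule resolvent_eqI[OF nspec z])
    let ?D = "U' z - \<mu> *\<^sub>C U z"
    let ?H = "\<lambda>t::real. c (of_real t) *\<^sub>C U (of_real t * z + z)"
    have H: "(?H has_vector_derivative G t * ?D) (at t)" if "t > 0" for t
    proof -
      have g: "((\<lambda>w. w * z) has_field_derivative z) (at (of_real t))"
        by (auto intro!: derivative_eq_intros)
      have c: "(c has_field_derivative - \<mu> * z * c (of_real t)) (at (of_real t))"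
        unfolding c_def by (auto intro!: derivative_eq_intros)
      show ?thesis
        using resolvent_ray_deriv[where g = "\<lambda>w. w * z", OF z sector_scale[OF z that] g c] by (simp add: G_def)
    qed
    have "((\<lambda>t::real. of_real t * z + z) \<longlongrightarrow> of_real 0 * z + z) (at_right 0)"
      by (intro tendsto_intros)
    then have "((\<lambda>t::real. U (of_real t * z + z)) \<longlongrightarrow> U z) (at_right 0)"
      using z by (intro isCont_tendsto_compose[OF isCont_U]) auto
    moreover have "((\<lambda>t::real. c (of_real t)) \<longlongrightarrow> exp (- (of_real 0 * z * \<mu>))) (at_right 0)"
      unfolding c_def by (intro tendsto_intros)
    ultimately have h0: "(?H \<longlongrightarrow> exp (- (of_real 0 * z * \<mu>)) *\<^sub>C U z) (at_right 0)"
      by (intro tendsto_scaleC)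
    have h1: "(?H \<longlongrightarrow> 0) at_top"
    proof (rule Lim_null_comparison)
      have "((\<lambda>t::real. exp (- d * t)) \<longlongrightarrow> 0) at_top"
        using d by (intro filterlim_compose[OF exp_at_bot] filterlim_tendsto_neg_mult_at_bot[OF tendsto_const] filterlim_ident) auto
      then show "((\<lambda>t::real. K * norm (U z) * exp (- d * t)) \<longlongrightarrow> 0) at_top"
        by (intro tendsto_mult_right_zero)
      have "norm (?H t) \<le> K * norm (U z) * exp (- d * t)" if t: "t > 0" for t
      proof -
        have "norm (U (of_real t * z + z)) \<le> norm (U (of_real t * z)) * norm (U z)"
          unfolding U_add[OF sector_scale[OF z t] z] by (rule norm_mult_ineq)
        also have "\<dots> \<le> K * exp (k * t) * norm (U z)"
          by (intro mult_right_mono U_le t) auto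
        finally have "norm (?H t) \<le> exp (- t * Re (\<mu> * z)) * (K * exp (k * t) * norm (U z))"
          by (simp only: norm_scaleC norm_c) (intro mult_left_mono, auto)
        also have "\<dots> = K * norm (U z) * (exp (- t * Re (\<mu> * z)) * exp (k * t))" by (simp add: mult_ac)
        also have "exp (- t * Re (\<mu> * z)) * exp (k * t) = exp (- d * t)"
          by (simp add: d_def algebra_simps flip: exp_add)
        finally show ?thesis .
      qed
      then show "\<forall>\<^sub>F t in at_top. norm (?H t) \<le> K * norm (U z) * exp (- d * t)"
        using eventually_gt_at_top[of 0] by (rule eventually_mono[rotated])
    qed
    \<comment> \<open>At \<open>0\<close> the boundary term is \<open>U z\<close>, as
      \<open>c\<close> is \<open>1\<close> there, and at infinity it vanishes.\<close>
    have "V * ?D = 0 - exp (- (of_real 0 * z * \<mu>)) *\<^sub>C U z"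
      by (rule improper_integral_FTC[OF cont V(1) bounded_linear_mult_left H h0 h1])
    then have "V * ?D = - U z" by simp
    then show "V * (\<mu> *\<^sub>C U z - U' z) = U z" by (metis minus_diff_eq mult_minus_right minus_minus)
  qed
  have "set_integrable lborel {0<..} (\<lambda>t. inverse (cmod z) * norm (G t))"
    by (rule set_integrable_mult_right[OF V(2)])
  moreover have "inverse (cmod z) * norm (G t) = exp (- t * Re (\<mu> * z)) * norm (U (of_real t * z))" for t
    using \<open>z \<noteq> 0\<close> by (simp add: norm_G)
  ultimately show "set_integrable lborel {0<..} (\<lambda>t. exp (- t * Re (\<mu> * z)) * norm (U (of_real t * z)))"
    by simp
  show "norm (resolvent \<mu>) \<le> cmod z *
      (LINT t:{0<..}|lborel. exp (- t * Re (\<mu> * z)) * norm (U (of_real t * z)))"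
    using V(3) unfolding V_eq norm_G by simp
  \<comment> \<open>\<open>V\<close> is a limit of integrals in the operator norm, the strong
    integral is that of \<open>G t\<close> evaluated at \<open>x\<close>. Evaluation commutes with
    the integrals over compact intervals, so the limits agree.\<close>
  define f where "f t = multiplier_apply (G t) x" for t
  have f_eq: "f t = z *\<^sub>C (exp (- (of_real t * z * \<mu>)) *\<^sub>C multiplier_apply (U (of_real t * z)) x)" for t
    by (simp add: f_def G_def c_def)
  have f_cont: "continuous_on {0<..} f"
    unfolding f_def by (rule bounded_linear.continuous_on[OF bounded_linear_multiplier_eval cont])
  have f_bound: "norm (f t) \<le> (cmod z * K * norm x) * exp (- d * t)" if "t > 0" for t
  proof -
    have "norm (f t) \<le> norm (G t) * norm x" unfolding f_def by (rule norm_multiplier_apply)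
    also have "\<dots> \<le> cmod z * K * exp (- d * t) * norm x" by (intro mult_right_mono bound that) simp
    finally show ?thesis by (simp add: mult_ac)
  qed
  obtain y where y: "bochner_integral_eq (restrict_space lborel {0<..}) f y"
    "(\<lambda>n. integral {inverse (real (Suc n))..real (Suc n)} f) \<longlonglongrightarrow> y"
    by (rule exp_dominated_integral[OF f_cont f_bound d]) blast
  have "integral {inverse (real (Suc n))..real (Suc n)} f
      = multiplier_apply (integral {inverse (real (Suc n))..real (Suc n)} G) x" for n
  proof -
    have "0 < inverse (real (Suc n))" by simp
    then have "{inverse (real (Suc n))..real (Suc n)} \<subseteq> {0<..}"
      by (meson atLeastAtMost_iff greaterThan_iff less_le_trans subsetI)
    then have "G integrable_on {inverse (real (Suc n))..real (Suc n)}"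
      by (intro integrable_continuous_real continuous_on_subset[OF cont])
    from integral_linear[OF this bounded_linear_multiplier_eval[of x]]
    show ?thesis by (simp only: o_def f_def[abs_def])
  qed
  then have "y = multiplier_apply V x"
    using LIMSEQ_unique[OF y(2)] bounded_linear.tendsto[OF bounded_linear_multiplier_eval V(1), of x] by simp
  moreover have "f = (\<lambda>t. z *\<^sub>C (exp (- (of_real t * z * \<mu>)) *\<^sub>C multiplier_apply (U (of_real t * z)) x))"
    using f_eq by blast
  ultimately show "bochner_integral_eq (restrict_space lborel {0<..})
      (\<lambda>t. z *\<^sub>C (exp (- (of_real t * z * \<mu>)) *\<^sub>C multiplier_apply (U (of_real t * z)) x))
      (multiplier_apply (resolvent \<mu>) x)"
    using y(1) V_eq by simp
qed

end

text \<open>The identification of QM(A) with QM(B) is spelled out: the inverse is a quasimultiplier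
  \<open>S\<close> of A that \<open>qm_lift j\<close> carries to the multiplier
  \<open>Rs \<mu>\<close>, and the pullback of the resolvent is such an \<open>S\<close>.\<close>

theorem proposition7p4:
  fixes a b :: real
    and T :: "complex \<Rightarrow> 'a::{complex_banach_algebra, comm_ring} multiplier"
    and \<iota> :: "'b::complex_banach_algebra \<Rightarrow> 'a rel"
    and j :: "'a \<Rightarrow> 'b"
  assumes "a < b" and "b \<le> a + pi"
    and "\<exists>x::'a. x \<noteq> 0"
    and "weakly_cancellative (UNIV :: 'a set)"
    and "dense_principal_ideals (UNIV :: 'a set)"
    and "holomorphic_semigroup a b T"
    and "\<And>\<zeta>. \<zeta> \<in> sector a b \<Longrightarrow> closure (range (multiplier_apply (T \<zeta>))) = UNIV"
    and "normalization a b T \<iota> j"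
  shows "(\<forall>\<zeta>\<in>sector a b. \<forall>t::real. compact {\<mu> \<in> arveson_spectrum a b T. Re (\<mu> * \<zeta>) \<ge> t})
    \<and> (\<exists>Rs :: complex \<Rightarrow> 'b multiplier.
        (\<forall>\<mu>\<in>arveson_resolvent a b T.
            Rs \<mu> \<in> closed_subalgebra_generated ((\<lambda>\<zeta>. multiplier_lift j (T \<zeta>)) ` sector a b) \<and>
            (\<exists>S\<in>QM UNIV. qm_mult UNIV (qm_shift UNIV \<mu> (generator a b T)) S = Id_on UNIV \<and>
                qm_lift j S = qm_of_multiplier (Rs \<mu>)))
      \<and> (\<forall>R :: 'b multiplier. \<exists>S\<in>QM_reg UNIV. qm_lift j S = qm_of_multiplier R)
      \<and> vholomorphic_on Rs (arveson_resolvent a b T)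
      \<and> (\<forall>\<zeta>\<in>sector a b.
          \<exists>L::ereal. ((\<lambda>t::real. ereal (ln (norm (T (of_real t * \<zeta>))) / t)) \<longlongrightarrow> L) at_top \<and>
            (\<forall>\<mu>. ereal (Re (\<mu> * \<zeta>)) > L \<longrightarrow>
              \<mu> \<in> arveson_resolvent a b T \<and>
              (\<forall>x. bochner_integral_eq (restrict_space lborel {0<..})
                 (\<lambda>t. \<zeta> *\<^sub>C (exp (- (of_real t * \<zeta> * \<mu>)) *\<^sub>C
                        multiplier_apply (multiplier_lift j (T (of_real t * \<zeta>))) x))
                 (multiplier_apply (Rs \<mu>) x)) \<and>
              set_integrable lborel {0<..}
                 (\<lambda>t. exp (- t * Re (\<mu> * \<zeta>)) * norm (multiplier_lift j (T (of_real t * \<zeta>)))) \<and>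
              norm (Rs \<mu>) \<le> cmod \<zeta> *
                 (LINT t:{0<..}|lborel.
                    exp (- t * Re (\<mu> * \<zeta>)) * norm (multiplier_lift j (T (of_real t * \<zeta>)))))))"
proof -
  interpret normalized_semigroup a b T \<iota> j
    by unfold_locales (use assms in auto)
  have resolvent_set: "arveson_resolvent a b T = {\<mu>. \<not> spectral \<mu>}"
    by (auto simp: arveson_resolvent_def arveson_spectrum_eq)
  have "open {\<mu>. \<not> spectral \<mu>}" using closed_spectral by (simp add: closed_open Compl_eq)
  then have h1: "vholomorphic_on resolvent (arveson_resolvent a b T)"
    unfolding vholomorphic_on_def resolvent_set using resolvent_deriv by blast
  have h2: "resolvent \<mu> \<in> closed_subalgebra_generated (U ` S) \<and>
      (\<exists>Q\<in>QM UNIV. qm_mult UNIV (qm_shift UNIV \<mu> (generator a b T)) Q = Id_on UNIV \<and>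
        qm_lift j Q = qm_of_multiplier (resolvent \<mu>))" if "\<mu> \<in> arveson_resolvent a b T" for \<mu>
  proof -
    have \<mu>: "\<not> spectral \<mu>" using that by (simp add: resolvent_set)
    have "pullback (multiplier_apply (resolvent \<mu>)) \<in> QM UNIV"
      by (rule pullback_in_QM) (rule multiplier_mult)
    with resolvent_in_generated[OF \<mu>] resolvent_inverts_generator[OF \<mu>] show ?thesis
      by (intro conjI bexI[of _ "pullback (multiplier_apply (resolvent \<mu>))"] lift_pullback)
  qed
  have h3: "\<exists>Q\<in>QM_reg UNIV. qm_lift j Q = qm_of_multiplier R" for R :: "'b multiplier"
    using pullback_regular lift_pullback by blast
  have h4: "\<exists>L::ereal. ((\<lambda>t::real. ereal (ln (norm (T (of_real t * \<zeta>))) / t)) \<longlongrightarrow> L) at_top \<and>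
      (\<forall>\<mu>. ereal (Re (\<mu> * \<zeta>)) > L \<longrightarrow>
        \<mu> \<in> arveson_resolvent a b T \<and>
        (\<forall>x. bochner_integral_eq (restrict_space lborel {0<..})
           (\<lambda>t. \<zeta> *\<^sub>C (exp (- (of_real t * \<zeta> * \<mu>)) *\<^sub>C multiplier_apply (U (of_real t * \<zeta>)) x))
           (multiplier_apply (resolvent \<mu>) x)) \<and>
        set_integrable lborel {0<..} (\<lambda>t. exp (- t * Re (\<mu> * \<zeta>)) * norm (U (of_real t * \<zeta>))) \<and>
        norm (resolvent \<mu>) \<le> cmod \<zeta> *
           (LINT t:{0<..}|lborel. exp (- t * Re (\<mu> * \<zeta>)) * norm (U (of_real t * \<zeta>))))"
    if \<zeta>: "\<zeta> \<in> S" for \<zeta>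
  proof -
    obtain L where L: "((\<lambda>t::real. ereal (ln (norm (T (of_real t * \<zeta>))) / t)) \<longlongrightarrow> L) at_top"
      by (rule growth_limit[OF \<zeta>])
    show ?thesis
      using L resolvent_half_plane[OF \<zeta> L] by (intro exI[of _ L]) (simp add: resolvent_set)
  qed
  have h5: "compact {\<mu> \<in> arveson_spectrum a b T. Re (\<mu> * \<zeta>) \<ge> t}" if "\<zeta> \<in> S" for \<zeta> t
    using compact_spectral[OF that, of t] by (simp add: arveson_spectrum_eq)
  show ?thesis
    by (intro conjI exI[of _ resolvent] ballI allI)
      (rule h1 h3 h4 h5 conjunct1[OF h2] conjunct2[OF h2], assumption?)+
qed

end
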